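(* Let $u$ be a real-valued function on $\mathbb{R}$ with $u\in L^1(\mathbb{R})\cap L^\infty(\mathbb{R})$ and $xu(x)\in L^2(\mathbb{R})$. Then the operator $L_u$ on $H^+$ has only finitely many negative eigenvalues, and the eigenspace of each negative eigenvalue has dimension $1$.
   Context: Fourier transform convention: $\hat f(\xi)=\int_{\mathbb{R}}e^{-ix\xi}f(x)\,dx$. $H^+$ is the Hardy space of (complex-valued) functions in $L^2(\mathbb{R})$ whose Fourier transform is supported on $[0,\infty)$, with the $L^2$ inner product. $C_+$ is the Cauchy projection, $\widehat{C_+\varphi}=\chi_{\mathbb{R}_+}\hat\varphi$, i.e. the orthogonal projection of $L^2(\mathbb{R})$ onto $H^+$. $L_u$ is the self-adjoint operator $L_u\varphi=\frac1i\varphi_x-C_+(uC_+\varphi)$ on $H^+$ with domain $H^+\cap H^1(\mathbb{R})$, where $H^1(\mathbb{R})$ is the $L^2$ Sobolev space. Its essential spectrum is $[0,\infty)$. *)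

theory Defs
  imports "HOL-Analysis.Analysis"
begin

text \<open>
  Elements of \<open>L\<^sup>p(\<real>)\<close> are represented by Borel functions on the real line, and two
  representatives are identified when they agree almost everywhere; every class of
  Lebesgue measurable functions has a Borel representative. Operators on \<open>L\<^sup>2\<close> return a
  representative of the resulting class, selected by Hilbert choice, so their values are
  meaningful up to null sets only.
\<close>

definition L1 :: "(real \<Rightarrow> 'a :: {banach, second_countable_topology}) set" where
  "L1 = {f. integrable lborel f}"

definition L2 :: "(real \<Rightarrow> 'a :: real_normed_vector) set" where
  "L2 = {f. f \<in> borel_measurable lborel \<and> integrable lborel (\<lambda>x. (norm (f x))\<^sup>2)}"

definition Linfty :: "(real \<Rightarrow> 'a :: real_normed_vector) set" where
  "Linfty = {f. f \<in> borel_measurable lborel \<and> (\<exists>C. AE x in lborel. norm (f x) \<le> C)}"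

definition fourier_L1 :: "(real \<Rightarrow> complex) \<Rightarrow> real \<Rightarrow> complex" where
  "fourier_L1 f \<xi> = (LINT x|lborel. exp (- \<i> * of_real (x * \<xi>)) * f x)"

text \<open>
  On \<open>L\<^sup>2\<close> the transform is the \<open>L\<^sup>2\<close>-limit of the transforms of the truncations to
  \<open>[-n, n]\<close>, which are integrable. The limit exists by Plancherel's theorem and is unique
  up to null sets. The nonnegative integral is used because the Bochner integral of a
  non-integrable function is 0.
\<close>

definition is_fourier_L2 :: "(real \<Rightarrow> complex) \<Rightarrow> (real \<Rightarrow> complex) \<Rightarrow> bool" where
  "is_fourier_L2 f g \<longleftrightarrow> g \<in> L2 \<and>
     (\<lambda>n::nat. \<integral>\<^sup>+ \<xi>. ennreal ((norm (fourier_L1 (\<lambda>x. indicator {- real n..real n} x * f x) \<xi> - g \<xi>))\<^sup>2)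
        \<partial>lborel) \<longlonglongrightarrow> 0"

definition fourier_L2 :: "(real \<Rightarrow> complex) \<Rightarrow> real \<Rightarrow> complex" where
  "fourier_L2 f = (SOME g. is_fourier_L2 f g)"

definition Hardy_plus :: "(real \<Rightarrow> complex) set" where
  "Hardy_plus = {f \<in> L2. AE \<xi> in lborel. \<xi> < 0 \<longrightarrow> fourier_L2 f \<xi> = 0}"

definition Cauchy_proj :: "(real \<Rightarrow> complex) \<Rightarrow> real \<Rightarrow> complex" where
  "Cauchy_proj f = (SOME h. h \<in> L2 \<and>
     (AE \<xi> in lborel. fourier_L2 h \<xi> = indicator {0..} \<xi> * fourier_L2 f \<xi>))"

definition test_function :: "(real \<Rightarrow> real) \<Rightarrow> bool" where
  "test_function \<eta> \<longleftrightarrow>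
     (\<forall>n x. (deriv ^^ n) \<eta> differentiable (at x)) \<and> compact (closure {x. \<eta> x \<noteq> 0})"

text \<open>Real test functions suffice, since both sides are complex linear in the test function.\<close>

definition is_weak_deriv :: "(real \<Rightarrow> complex) \<Rightarrow> (real \<Rightarrow> complex) \<Rightarrow> bool" where
  "is_weak_deriv f g \<longleftrightarrow> (\<forall>\<eta>. test_function \<eta> \<longrightarrow>
     (LINT x|lborel. f x * of_real (deriv \<eta> x)) = - (LINT x|lborel. g x * of_real (\<eta> x)))"

definition Sobolev_H1 :: "(real \<Rightarrow> complex) set" where
  "Sobolev_H1 = {f \<in> L2. \<exists>g \<in> L2. is_weak_deriv f g}"

definition weak_deriv :: "(real \<Rightarrow> complex) \<Rightarrow> real \<Rightarrow> complex" where
  "weak_deriv f = (SOME g. g \<in> L2 \<and> is_weak_deriv f g)"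

definition L_dom :: "(real \<Rightarrow> complex) set" where
  "L_dom = Hardy_plus \<inter> Sobolev_H1"

definition L_op :: "(real \<Rightarrow> real) \<Rightarrow> (real \<Rightarrow> complex) \<Rightarrow> real \<Rightarrow> complex" where
  "L_op u \<phi> = (\<lambda>x. 1 / \<i> * weak_deriv \<phi> x - Cauchy_proj (\<lambda>y. of_real (u y) * Cauchy_proj \<phi> y) x)"

definition L_eigenspace :: "(real \<Rightarrow> real) \<Rightarrow> complex \<Rightarrow> (real \<Rightarrow> complex) set" where
  "L_eigenspace u \<mu> = {\<phi> \<in> L_dom. AE x in lborel. L_op u \<phi> x = \<mu> * \<phi> x}"

definition L_eigenvalue :: "(real \<Rightarrow> real) \<Rightarrow> complex \<Rightarrow> bool" where
  "L_eigenvalue u \<mu> \<longleftrightarrow> (\<exists>\<phi> \<in> L_eigenspace u \<mu>. \<not> (AE x in lborel. \<phi> x = 0))"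

text \<open>
  \<open>E\<close> has complex dimension \<open>n\<close> as a space of functions modulo almost everywhere equality:
  it has a basis with \<open>n\<close> elements.
\<close>

definition has_dim_ae :: "(real \<Rightarrow> complex) set \<Rightarrow> nat \<Rightarrow> bool" where
  "has_dim_ae E n \<longleftrightarrow> (\<exists>b :: nat \<Rightarrow> real \<Rightarrow> complex.
     (\<forall>i<n. b i \<in> E) \<and>
     (\<forall>c. (AE x in lborel. (\<Sum>i<n. c i * b i x) = 0) \<longrightarrow> (\<forall>i<n. c i = 0)) \<and>
     (\<forall>f\<in>E. \<exists>c. AE x in lborel. f x = (\<Sum>i<n. c i * b i x)))"

end

theory Submission
  imports Defs "HOL-Probability.Characteristic_Functions"
begin

text \<open>
  Write \<open>V\<close> for the Fourier transform of \<open>u\<phi>\<close> and \<open>P\<close> for that of \<open>\<phi>\<close>. On the Fourier side the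
  eigenvalue equation \<open>L\<^sub>u \<phi> = l \<phi>\<close> with \<open>l < 0\<close> says that \<open>P(t) = V(t) / (t - l)\<close> for \<open>t \<ge> 0\<close> and
  \<open>P(t) = 0\<close> for \<open>t < 0\<close> (\<open>L_eigenspace_imp_fourier_eigenfunction\<close>). Both claims are proved from this
  description.

  Simplicity rests on the identity
  \<open>\<bar>\<integral> u\<phi>\<bar>\<^sup>2 = - 2\<pi> l \<parallel>\<phi>\<parallel>\<^sup>2\<close> (\<open>eigenfunction_mass_identity\<close>). If an eigenspace had two independent
  elements, then some nontrivial combination of them would satisfy \<open>\<integral> u\<phi> = 0\<close>, and the identity
  would make it zero. Formally the identity comes from the commutator of \<open>L\<^sub>u\<close> with multiplication by
  \<open>x\<close>, that is, with a derivative in \<open>t\<close>. Here that derivative is replaced by a difference quotient with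
  step \<open>h\<close>: the integrals of \<open>V(t) cnj P(t + h)\<close> and \<open>V(t + h) cnj P(t)\<close> are conjugate to each other
  because \<open>u\<close> is real, and comparing them leaves \<open>h \<integral> P(t) cnj P(t + h)\<close> on one side and the
  contribution of the strip \<open>-h \<le> t < 0\<close> on the other. Since \<open>V\<close> is continuous,
  one can divide by \<open>h\<close> and let \<open>h\<close> tend to \<open>0\<close>.

  Finiteness is a counting argument. On the span of eigenfunctions with negative eigenvalues the
  quadratic form of \<open>L\<^sub>u\<close> is negative, so that the energy \<open>E = \<integral> t \<bar>P\<bar>\<^sup>2\<close> is smaller than
  \<open>2\<pi> \<integral> u \<bar>\<phi>\<bar>\<^sup>2\<close> (\<open>energy_of_combination\<close>). On the other hand, finitely many linear conditions on
  \<open>\<phi>\<close> force \<open>2\<pi> \<integral> u \<bar>\<phi>\<bar>\<^sup>2 \<le> E\<close> (\<open>potential_energy_bound\<close>): frequencies above a multiple of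
  \<open>sup \<bar>u\<bar>\<close> are harmless because \<open>E\<close> controls their \<open>L\<^sup>2\<close> norm, and the remaining frequencies are cut
  into \<open>k\<close> short cells, on each of which the integral of \<open>P\<close> is required to vanish. With that
  cancellation the low frequency part of \<open>\<phi>\<close> at \<open>x\<close> is bounded by a small constant times
  \<open>\<bar>x\<bar>\<^sup>1\<^sup>/\<^sup>8 E\<^sup>1\<^sup>/\<^sup>2\<close>, and \<open>\<bar>u\<bar> \<bar>x\<bar>\<^sup>1\<^sup>/\<^sup>4\<close> is integrable because \<open>u \<in> L\<^sup>1\<close> and \<open>x u \<in> L\<^sup>2\<close>. Since \<open>k\<close>
  linear conditions have a nontrivial solution in any space of dimension more than \<open>k\<close>, there are at
  most \<open>k\<close> negative eigenvalues.

  The operators are defined through the Fourier transform on \<open>L\<^sup>2\<close>, so its theory comes first. The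
  inequality for the transform \<open>F\<close>, \<open>\<parallel>F f\<parallel>\<^sup>2 \<le> 2\<pi> \<parallel>f\<parallel>\<^sup>2\<close> on \<open>L\<^sup>1 \<inter> L\<^sup>2\<close> gives existence on \<open>L\<^sup>2\<close>. Parseval's formula
  against indicators of intervals, which determine a function, gives the inversion formula and with it
  Plancherel's theorem and surjectivity. The weak derivative enters only through \<open>fourier_L2_weak_deriv\<close>.
\<close>

section \<open>Square-integrable functions\<close>

definition sq_norm :: "(real \<Rightarrow> complex) \<Rightarrow> real" where
  "sq_norm f = (LINT x|lborel. (cmod (f x))\<^sup>2)"

lemma L2_measurable [measurable_dest]: "f \<in> L2 \<Longrightarrow> f \<in> borel_measurable borel"
  by (simp add: L2_def)

lemma L2_integrable: "f \<in> L2 \<Longrightarrow> integrable lborel (\<lambda>x. (norm (f x))\<^sup>2)"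
  by (simp add: L2_def)

lemma L2I_bound:
  assumes [measurable]: "f \<in> borel_measurable borel" and "integrable lborel g"
    and "AE x in lborel. (norm (f x))\<^sup>2 \<le> g x"
  shows "f \<in> L2"
proof -
  have "integrable lborel (\<lambda>x. (norm (f x))\<^sup>2)"
    by (rule Bochner_Integration.integrable_bound[OF assms(2)]) (use assms(3) in auto)
  then show ?thesis by (simp add: L2_def)
qed

lemma sq_norm_nonneg [simp]: "0 \<le> sq_norm f"
  by (simp add: sq_norm_def)

lemma nn_integral_sq_norm:
  assumes "f \<in> L2"
  shows "(\<integral>\<^sup>+ x. ennreal ((cmod (f x))\<^sup>2) \<partial>lborel) = ennreal (sq_norm f)"
  unfolding sq_norm_def by (rule nn_integral_eq_integral[OF L2_integrable[OF assms]]) simp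

lemma L2I_nn_integral:
  fixes f :: "real \<Rightarrow> complex"
  assumes [measurable]: "f \<in> borel_measurable borel"
    and "(\<integral>\<^sup>+ x. ennreal ((cmod (f x))\<^sup>2) \<partial>lborel) < \<infinity>"
  shows "f \<in> L2"
  unfolding L2_def using assms(2) by (auto intro!: integrableI_nonneg)

lemma cmod_add_sq_le: "(cmod (a + b))\<^sup>2 \<le> 2 * (cmod a)\<^sup>2 + 2 * (cmod b)\<^sup>2"
proof -
  have "(cmod (a + b))\<^sup>2 \<le> (cmod a + cmod b)\<^sup>2"
    by (intro power_mono norm_triangle_ineq) simp
  also have "\<dots> \<le> 2 * (cmod a)\<^sup>2 + 2 * (cmod b)\<^sup>2"
    using sum_squares_bound[of "cmod a" "cmod b"] by (simp add: power2_sum)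
  finally show ?thesis .
qed

lemma L2_add:
  fixes f g :: "real \<Rightarrow> complex"
  assumes "f \<in> L2" "g \<in> L2" shows "(\<lambda>x. f x + g x) \<in> L2"
proof (rule L2I_bound)
  show "integrable lborel (\<lambda>x. 2 * (cmod (f x))\<^sup>2 + 2 * (cmod (g x))\<^sup>2)"
    using assms by (intro Bochner_Integration.integrable_add integrable_mult_right L2_integrable)
qed (use assms cmod_add_sq_le in \<open>auto intro!: borel_measurable_add L2_measurable\<close>)

lemma L2_mult_bounded:
  fixes f g :: "real \<Rightarrow> complex"
  assumes "f \<in> L2" and [measurable]: "g \<in> borel_measurable borel"
    and "AE x in lborel. cmod (g x) \<le> C"
  shows "(\<lambda>x. g x * f x) \<in> L2"
proof (rule L2I_bound)
  have [measurable]: "f \<in> borel_measurable borel" by (rule L2_measurable[OF assms(1)])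
  show "(\<lambda>x. g x * f x) \<in> borel_measurable borel" by measurable
  show "integrable lborel (\<lambda>x. C\<^sup>2 * (cmod (f x))\<^sup>2)"
    using assms(1) by (intro integrable_mult_right L2_integrable)
  show "AE x in lborel. (cmod (g x * f x))\<^sup>2 \<le> C\<^sup>2 * (cmod (f x))\<^sup>2"
    using assms(3) by eventually_elim (auto simp: norm_mult power_mult_distrib intro!: mult_right_mono power_mono)
qed

lemma L2_cmult:
  fixes f :: "real \<Rightarrow> complex"
  assumes "f \<in> L2" shows "(\<lambda>x. c * f x) \<in> L2"
  by (rule L2_mult_bounded[OF assms, of _ "cmod c"]) auto

lemma L2_diff:
  fixes f g :: "real \<Rightarrow> complex"
  assumes "f \<in> L2" "g \<in> L2" shows "(\<lambda>x. f x - g x) \<in> L2"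
  using L2_add[OF assms(1) L2_cmult[OF assms(2), of "-1"]] by simp

lemma L2_sum:
  fixes f :: "'i \<Rightarrow> real \<Rightarrow> complex"
  assumes "\<And>i. i \<in> I \<Longrightarrow> f i \<in> L2" shows "(\<lambda>x. \<Sum>i\<in>I. f i x) \<in> L2"
  using assms
proof (induction I rule: infinite_finite_induct)
  case (insert i I)
  then show ?case using L2_add[of "f i" "\<lambda>x. \<Sum>i\<in>I. f i x"] by simp
qed (auto simp: L2_def)

lemma L2_cnj: "f \<in> L2 \<Longrightarrow> (\<lambda>x. cnj (f x)) \<in> L2"
  by (auto simp: L2_def intro!: borel_measurable_continuous_on[of cnj] continuous_intros)

lemma L2_indicator_mult:
  fixes f :: "real \<Rightarrow> complex"
  assumes "f \<in> L2" and [measurable]: "A \<in> sets borel"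
  shows "(\<lambda>x. indicator A x * f x) \<in> L2"
  by (rule L2_mult_bounded[OF assms(1), of _ 1]) (auto simp: indicator_def)

lemma L2_mult_integrable:
  fixes f g :: "real \<Rightarrow> complex"
  assumes "f \<in> L2" "g \<in> L2"
  shows "integrable lborel (\<lambda>x. f x * g x)"
proof (rule Bochner_Integration.integrable_bound)
  have [measurable]: "f \<in> borel_measurable borel" "g \<in> borel_measurable borel"
    using assms by (auto intro: L2_measurable)
  show "integrable lborel (\<lambda>x. (cmod (f x))\<^sup>2 + (cmod (g x))\<^sup>2)"
    using assms by (intro Bochner_Integration.integrable_add L2_integrable)
  show "(\<lambda>x. f x * g x) \<in> borel_measurable lborel" by measurable
  show "AE x in lborel. norm (f x * g x) \<le> norm ((cmod (f x))\<^sup>2 + (cmod (g x))\<^sup>2)"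
  proof (rule AE_I2)
    fix x
    have "2 * cmod (f x) * cmod (g x) \<le> (cmod (f x))\<^sup>2 + (cmod (g x))\<^sup>2"
      by (rule sum_squares_bound)
    moreover have "0 \<le> cmod (f x) * cmod (g x)" by simp
    ultimately have "cmod (f x) * cmod (g x) \<le> (cmod (f x))\<^sup>2 + (cmod (g x))\<^sup>2"
      by linarith
    then show "norm (f x * g x) \<le> norm ((cmod (f x))\<^sup>2 + (cmod (g x))\<^sup>2)"
      by (simp add: norm_mult)
  qed
qed

text \<open>
  The polynomial \<open>s \<mapsto> \<integral> (\<bar>f\<bar> - s \<bar>g\<bar>)\<^sup>2\<close> is nonnegative; its value at the minimum is the inequality.
\<close>

lemma integral_Cauchy_Schwarz:
  assumes "f \<in> L2" "g \<in> L2"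
  shows "(cmod (LINT x|lborel. f x * g x))\<^sup>2 \<le> sq_norm f * sq_norm g"
proof -
  define c where "c = (LINT x|lborel. cmod (f x) * cmod (g x))"
  have I: "integrable lborel (\<lambda>x. cmod (f x) * cmod (g x))"
    using L2_mult_integrable[OF assms] by (simp flip: norm_mult)
  have le: "cmod (LINT x|lborel. f x * g x) \<le> c"
    unfolding c_def using integral_norm_bound[of lborel "\<lambda>x. f x * g x"] by (simp add: norm_mult)
  have quad: "0 \<le> sq_norm f - 2 * s * c + s\<^sup>2 * sq_norm g" for s
  proof -
    have "0 \<le> (LINT x|lborel. (cmod (f x) - s * cmod (g x))\<^sup>2)" by simp
    also have "\<dots> = (LINT x|lborel. ((cmod (f x))\<^sup>2 - 2 * s * (cmod (f x) * cmod (g x))) + s\<^sup>2 * (cmod (g x))\<^sup>2)"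
      by (simp add: power2_eq_square algebra_simps)
    also have "\<dots> = sq_norm f - 2 * s * c + s\<^sup>2 * sq_norm g"
      unfolding sq_norm_def c_def using L2_integrable[OF assms(1)] L2_integrable[OF assms(2)] I
      by (subst Bochner_Integration.integral_add)
         (auto intro!: Bochner_Integration.integrable_diff integrable_mult_right simp: Bochner_Integration.integral_diff)
    finally show ?thesis .
  qed
  have "c\<^sup>2 \<le> sq_norm f * sq_norm g"
  proof (cases "sq_norm g = 0")
    case True
    have "c = 0"
    proof (rule ccontr)
      assume "c \<noteq> 0"
      then show False using quad[of "(sq_norm f + 1) / (2 * c)"] True by (simp add: field_simps)
    qed
    then show ?thesis using True by simp
  next
    case False
    then have "sq_norm g > 0" by (simp add: less_le)
    then show ?thesis using quad[of "c / sq_norm g"] by (simp add: field_simps power2_eq_square)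
  qed
  then show ?thesis using le by (meson norm_ge_zero order_trans power_mono)
qed

lemma sq_norm_add_le:
  assumes "f \<in> L2" "g \<in> L2"
  shows "sq_norm (\<lambda>x. f x + g x) \<le> 2 * sq_norm f + 2 * sq_norm g"
proof -
  have "sq_norm (\<lambda>x. f x + g x) \<le> (LINT x|lborel. 2 * (cmod (f x))\<^sup>2 + 2 * (cmod (g x))\<^sup>2)"
    unfolding sq_norm_def using assms L2_add[OF assms] cmod_add_sq_le
    by (intro integral_mono Bochner_Integration.integrable_add integrable_mult_right L2_integrable) auto
  also have "\<dots> = 2 * sq_norm f + 2 * sq_norm g"
    unfolding sq_norm_def using assms
    by (subst Bochner_Integration.integral_add) (auto intro!: integrable_mult_right L2_integrable)
  finally show ?thesis .
qed

lemma sq_norm_eq_0_iff: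
  assumes "f \<in> L2" shows "sq_norm f = 0 \<longleftrightarrow> (AE x in lborel. f x = 0)"
  unfolding sq_norm_def
  using integral_nonneg_eq_0_iff_AE[OF L2_integrable[OF assms]] by simp

lemma sq_norm_cong_AE:
  assumes "f \<in> L2" "g \<in> L2" "AE x in lborel. f x = g x" shows "sq_norm f = sq_norm g"
proof -
  have [measurable]: "f \<in> borel_measurable borel" "g \<in> borel_measurable borel"
    using assms by (auto intro: L2_measurable)
  show ?thesis unfolding sq_norm_def by (rule integral_cong_AE) (use assms(3) in auto)
qed

lemma of_real_sq_norm: "complex_of_real (sq_norm f) = (LINT x|lborel. f x * cnj (f x))"
proof -
  have "complex_of_real (sq_norm f) = (LINT x|lborel. complex_of_real ((cmod (f x))\<^sup>2))"
    unfolding sq_norm_def by (rule integral_complex_of_real[symmetric])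
  then show ?thesis by (simp add: complex_norm_square del: of_real_power)
qed

lemma sq_norm_minus_commute: "sq_norm (\<lambda>x. f x - g x) = sq_norm (\<lambda>x. g x - f x)"
  by (simp add: sq_norm_def norm_minus_commute)

lemma L2_tendsto_pairing:
  assumes "\<And>n. f n \<in> L2" "f0 \<in> L2" "g \<in> L2"
    and lim: "(\<lambda>n. sq_norm (\<lambda>x. f n x - f0 x)) \<longlonglongrightarrow> 0"
  shows "(\<lambda>n::nat. LINT x|lborel. f n x * g x) \<longlonglongrightarrow> (LINT x|lborel. f0 x * g x)"
proof -
  have eq: "(LINT x|lborel. f n x * g x) - (LINT x|lborel. f0 x * g x) = (LINT x|lborel. (f n x - f0 x) * g x)" for n
    using assms by (subst Bochner_Integration.integral_diff[symmetric]) (auto intro!: L2_mult_integrable simp: algebra_simps)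
  have "(\<lambda>n. sq_norm (\<lambda>x. f n x - f0 x) * sq_norm g) \<longlonglongrightarrow> 0 * sq_norm g"
    by (intro tendsto_intros lim)
  then have "(\<lambda>n. (cmod (LINT x|lborel. (f n x - f0 x) * g x))\<^sup>2) \<longlonglongrightarrow> 0"
    by (rule metric_tendsto_imp_tendsto) (use assms integral_Cauchy_Schwarz[OF L2_diff] in \<open>auto intro!: always_eventually\<close>)
  then have "(\<lambda>n. (LINT x|lborel. (f n x - f0 x) * g x)) \<longlonglongrightarrow> 0"
    by (simp add: tendsto_norm_zero_iff)
  then show ?thesis unfolding eq[symmetric] by (rule Lim_null[THEN iffD2])
qed

lemma L2_truncation_tendsto:
  fixes f :: "real \<Rightarrow> complex"
  assumes "f \<in> L2"
  shows "(\<lambda>n. sq_norm (\<lambda>x. indicator {- real n..real n} x * f x - f x)) \<longlonglongrightarrow> 0"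
proof -
  have [measurable]: "f \<in> borel_measurable borel" using assms by (rule L2_measurable)
  have "(\<lambda>n. LINT x|lborel. (cmod (indicator {- real n..real n} x * f x - f x))\<^sup>2) \<longlonglongrightarrow> (LINT x::real|lborel. (0::real))"
  proof (rule Bochner_Integration.integral_dominated_convergence[where w="\<lambda>x. (cmod (f x))\<^sup>2"])
    show "AE x in lborel. (\<lambda>n. (cmod (indicator {- real n..real n} x * f x - f x))\<^sup>2) \<longlonglongrightarrow> 0"
    proof (rule AE_I2)
      fix x :: real
      have "\<forall>\<^sub>F n in sequentially. (cmod (indicator {- real n..real n} x * f x - f x))\<^sup>2 = 0"
        using eventually_ge_at_top[of "nat \<lceil>\<bar>x\<bar>\<rceil>"]
      proof eventually_elim
        case (elim n)
        then have "\<bar>x\<bar> \<le> real n" by linarith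
        then show ?case by (auto simp: indicator_def)
      qed
      then show "(\<lambda>n. (cmod (indicator {- real n..real n} x * f x - f x))\<^sup>2) \<longlonglongrightarrow> 0"
        by (rule tendsto_eventually)
    qed
  qed (use L2_integrable[OF assms] in \<open>auto simp: indicator_def\<close>)
  then show ?thesis by (simp add: sq_norm_def)
qed

lemma indicator_Icc_integrable [simp]: "integrable lborel (indicator {a..b::real} :: real \<Rightarrow> complex)"
proof -
  have "integrable lborel (indicator {a..b::real} :: real \<Rightarrow> real)"
    by (rule integrable_real_indicator) (auto simp: emeasure_lborel_Icc_eq)
  then have "integrable lborel (\<lambda>x. complex_of_real (indicator {a..b} x))" by simp
  then show ?thesis by (simp add: of_real_indicator)
qed

lemma indicator_Icc_L2 [simp]: "(indicator {a..b::real} :: real \<Rightarrow> complex) \<in> L2"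
proof (rule L2I_bound)
  show "integrable lborel (indicator {a..b} :: real \<Rightarrow> real)"
    by (rule integrable_real_indicator) (auto simp: emeasure_lborel_Icc_eq)
qed (auto simp: indicator_def)

lemma L2_truncation_integrable:
  fixes f :: "real \<Rightarrow> complex"
  assumes "f \<in> L2" shows "integrable lborel (\<lambda>x. indicator {a..b} x * f x)"
  by (rule L2_mult_integrable[OF indicator_Icc_L2 assms])

lemma L2_Ico_integrable:
  fixes f :: "real \<Rightarrow> complex"
  assumes "f \<in> L2" shows "integrable lborel (\<lambda>x. indicator {a..<b} x * f x)"
proof (rule Bochner_Integration.integrable_bound[OF L2_truncation_integrable[OF assms, of a b]])
  have [measurable]: "f \<in> borel_measurable borel" by (rule L2_measurable[OF assms])
  show "(\<lambda>x. indicator {a..<b} x * f x) \<in> borel_measurable lborel" by measurable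
qed (auto simp: indicator_def)

text \<open>
  The Borel sets over which \<open>f\<close> has integral zero form a Dynkin system, and compact intervals are an
  intersection-stable generator of the Borel sets.
\<close>

lemma integrable_eq_0_AE_if_intervals:
  fixes f :: "real \<Rightarrow> complex"
  assumes f: "integrable lborel f"
    and zero: "\<And>a b. a \<le> b \<Longrightarrow> (LINT x|lborel. indicator {a..b} x * f x) = 0"
  shows "AE x in lborel. f x = 0"
proof (rule sigma_finite_measure.density_zero[OF lborel.sigma_finite_measure_axioms f])
  have zero': "(LINT x:{a..b}|lborel. f x) = 0" for a b
    using zero[of a b] by (cases "a \<le> b") (auto simp: set_lebesgue_integral_def scaleR_conv_of_real of_real_indicator)
  have si: "set_integrable lborel A f" if "A \<in> sets borel" for A
    using f that by (simp add: set_integrable_def integrable_mult_indicator)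
  have UN: "(LINT x:UNIV|lborel. f x) = 0"
  proof -
    have "(\<lambda>n. LINT x:{- real n..real n}|lborel. f x) \<longlonglongrightarrow> (LINT x:(\<Union>n. {- real n..real n})|lborel. f x)"
      by (rule set_integral_cont_up) (auto intro!: si simp: incseq_def)
    moreover have "(\<Union>n. {- real n..real n}) = UNIV"
    proof (safe, simp)
      fix x :: real
      have "x \<in> {- real (nat \<lceil>\<bar>x\<bar>\<rceil>)..real (nat \<lceil>\<bar>x\<bar>\<rceil>)}" by simp linarith
      then show "x \<in> (\<Union>n. {- real n..real n})" by blast
    qed
    ultimately show ?thesis by (simp add: zero' LIMSEQ_const_iff)
  qed
  fix A :: "real set" assume "A \<in> sets lborel"
  then have "A \<in> sigma_sets UNIV (range (\<lambda>(a, b). {a..b::real}))"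
    by (simp add: borel_eq_atLeastAtMost)
  then show "(LINT x:A|lborel. f x) = 0"
  proof (induction rule: sigma_sets_induct_disjoint[rotated 2, consumes 1, case_names basic empty compl union])
    case (basic A) then show ?case using zero' by auto
  next
    case empty show ?case by (simp add: set_lebesgue_integral_def)
  next
    case (compl A)
    then have "A \<in> sets borel" by (simp add: borel_eq_atLeastAtMost)
    then have "(LINT x:(A \<union> (UNIV - A))|lborel. f x) = (LINT x:A|lborel. f x) + (LINT x:(UNIV - A)|lborel. f x)"
      by (intro set_integral_Un si) auto
    then show ?case using compl UN by simp
  next
    case (union A)
    then have "A i \<in> sets borel" for i by (auto simp: borel_eq_atLeastAtMost)
    then have "(LINT x:(\<Union>i. A i)|lborel. f x) = (\<Sum>i. LINT x:A i|lborel. f x)"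
      using union by (intro lebesgue_integral_countable_add si) (auto simp: disjoint_family_on_def)
    then show ?case using union by simp
  next
    show "Int_stable (range (\<lambda>(a, b). {a..b::real}))"
      by (auto simp: Int_stable_def)
  qed auto
qed

lemma L2_eq_0_AE_if_intervals:
  fixes f :: "real \<Rightarrow> complex"
  assumes f: "f \<in> L2"
    and zero: "\<And>a b. a \<le> b \<Longrightarrow> (LINT x|lborel. indicator {a..b} x * f x) = 0"
  shows "AE x in lborel. f x = 0"
proof -
  have "AE x in lborel. indicator {- real n..real n} x * f x = 0" for n
  proof (rule integrable_eq_0_AE_if_intervals)
    show "integrable lborel (\<lambda>x. indicator {- real n..real n} x * f x)"
      by (rule L2_truncation_integrable[OF f])
    fix a b :: real
    have "(\<lambda>x. indicator {a..b} x * (indicator {- real n..real n} x * f x)) =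
      (\<lambda>x. indicator {max a (- real n)..min b (real n)} x * f x)"
      by (auto simp: indicator_def)
    moreover have "(LINT x|lborel. indicator {max a (- real n)..min b (real n)} x * f x) = 0"
      using zero[of "max a (- real n)" "min b (real n)"]
      by (cases "max a (- real n) \<le> min b (real n)") (auto simp del: atLeastatMost_empty_iff)
    ultimately show "(LINT x|lborel. indicator {a..b} x * (indicator {- real n..real n} x * f x)) = 0"
      by simp
  qed
  then have "AE x in lborel. \<forall>n. indicator {- real n..real n} x * f x = 0"
    unfolding AE_all_countable by blast
  then show ?thesis
  proof eventually_elim
    case (elim x)
    have "x \<in> {- real (nat \<lceil>\<bar>x\<bar>\<rceil>)..real (nat \<lceil>\<bar>x\<bar>\<rceil>)}" by simp linarith
    then show ?case using elim[rule_format, of "nat \<lceil>\<bar>x\<bar>\<rceil>"] by simp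
  qed
qed

section \<open>The Fourier transform of integrable functions\<close>

abbreviation modulation :: "real \<Rightarrow> real \<Rightarrow> complex" where
  "modulation h x \<equiv> exp (- \<i> * of_real (x * h))"

lemma cmod_exp_i [simp]: "cmod (exp (- \<i> * of_real t)) = 1" "cmod (exp (- (\<i> * of_real t))) = 1"
  using norm_exp_i_times[of "-t"] by simp_all

lemma integrable_exp_mult [intro]:
  assumes "integrable lborel f"
  shows "integrable lborel (\<lambda>x. modulation t x * f x)"
proof (rule Bochner_Integration.integrable_bound[OF assms])
  have [measurable]: "f \<in> borel_measurable borel" using borel_measurable_integrable[OF assms] by simp
  show "(\<lambda>x. modulation t x * f x) \<in> borel_measurable lborel" by measurable
qed (simp add: norm_mult)

lemma fourier_L1_measurable [measurable]:
  assumes "integrable lborel f"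
  shows "fourier_L1 f \<in> borel_measurable borel"
proof -
  have [measurable]: "f \<in> borel_measurable borel" using borel_measurable_integrable[OF assms] by simp
  have "(\<lambda>t. LINT x|lborel. modulation t x * f x) \<in> borel_measurable borel"
    by (rule lborel.borel_measurable_lebesgue_integral) measurable
  then show ?thesis by (simp add: fourier_L1_def[abs_def])
qed

lemma cmod_fourier_L1_le:
  assumes "integrable lborel f"
  shows "cmod (fourier_L1 f t) \<le> (LINT x|lborel. cmod (f x))"
  unfolding fourier_L1_def
  using integral_norm_bound[of lborel "\<lambda>x. modulation t x * f x"] by (simp add: norm_mult)

lemma fourier_L1_continuous:
  assumes "integrable lborel f"
  shows "isCont (fourier_L1 f) t"
proof (unfold continuous_at_sequentially, intro allI impI)
  fix s :: "nat \<Rightarrow> real" assume s: "s \<longlonglongrightarrow> t"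
  have [measurable]: "f \<in> borel_measurable borel" using borel_measurable_integrable[OF assms] by simp
  have "(\<lambda>n. LINT x|lborel. exp (- \<i> * of_real (x * s n)) * f x) \<longlonglongrightarrow> (LINT x|lborel. modulation t x * f x)"
  proof (rule integral_dominated_convergence[where w="\<lambda>x. cmod (f x)"])
    show "AE x in lborel. (\<lambda>n. exp (- \<i> * of_real (x * s n)) * f x) \<longlonglongrightarrow> modulation t x * f x"
      by (intro AE_I2 tendsto_intros s)
  qed (use assms in \<open>auto simp: norm_mult\<close>)
  then show "(fourier_L1 f \<circ> s) \<longlonglongrightarrow> fourier_L1 f t"
    by (simp add: fourier_L1_def o_def)
qed

lemma fourier_L1_add:
  assumes "integrable lborel f" "integrable lborel g"
  shows "fourier_L1 (\<lambda>x. f x + g x) t = fourier_L1 f t + fourier_L1 g t"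
  unfolding fourier_L1_def using assms integrable_exp_mult[OF assms(1)] integrable_exp_mult[OF assms(2)]
  by (simp add: ring_distribs)

lemma fourier_L1_cmult: "fourier_L1 (\<lambda>x. c * f x) t = c * fourier_L1 f t"
  unfolding fourier_L1_def by (simp add: mult.left_commute)

lemma fourier_L1_diff:
  assumes "integrable lborel f" "integrable lborel g"
  shows "fourier_L1 (\<lambda>x. f x - g x) t = fourier_L1 f t - fourier_L1 g t"
  using fourier_L1_add[OF assms(1) integrable_mult_right[OF assms(2), of "-1"], of t]
    fourier_L1_cmult[of "-1" g t] by simp

lemma fourier_L1_modulate:
  "fourier_L1 (\<lambda>x. modulation h x * f x) t = fourier_L1 f (t + h)"
proof -
  have "modulation t x * modulation h x = exp (- \<i> * of_real (x * (t + h)))" for x :: real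
    unfolding mult_exp_exp by (simp add: algebra_simps)
  then show ?thesis
    unfolding fourier_L1_def by (simp add: mult.assoc[symmetric])
qed

lemma fourier_L1_cong_AE:
  assumes "f \<in> borel_measurable borel" "g \<in> borel_measurable borel" "AE x in lborel. f x = g x"
  shows "fourier_L1 f = fourier_L1 g"
  unfolding fourier_L1_def using assms
  by (intro ext integral_cong_AE) auto

text \<open>
  Fubini's theorem in its simplest form. Parseval's formula and the inversion formula are all derived
  from this symmetry.
\<close>

lemma fourier_L1_multiplication:
  assumes f: "integrable lborel f" and g: "integrable lborel g"
  shows "(LINT t|lborel. fourier_L1 f t * g t) = (LINT x|lborel. f x * fourier_L1 g x)"
proof -
  have [measurable]: "f \<in> borel_measurable borel" "g \<in> borel_measurable borel"
    using borel_measurable_integrable[OF f] borel_measurable_integrable[OF g] by simp_all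
  define K where "K = (\<lambda>x t. modulation t x * f x * g t)"
  have K: "integrable (lborel \<Otimes>\<^sub>M lborel) (\<lambda>(x, t). K x t)"
  proof (rule lborel_pair.Fubini_integrable)
    show "(\<lambda>(x, t). K x t) \<in> borel_measurable (lborel \<Otimes>\<^sub>M lborel)"
      unfolding K_def by measurable
    have "integrable lborel (\<lambda>x. cmod (f x) * (LINT t|lborel. cmod (g t)))"
      using f by simp
    then show "integrable lborel (\<lambda>x. LINT y|lborel. norm (case (x, y) of (x, t) \<Rightarrow> K x t))"
      by (simp add: K_def norm_mult)
    show "AE x in lborel. integrable lborel (\<lambda>y. case (x, y) of (x, t) \<Rightarrow> K x t)"
    proof (rule AE_I2)
      fix x
      have "integrable lborel (\<lambda>t. f x * (modulation x t * g t))"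
        by (intro integrable_mult_right integrable_exp_mult g)
      then show "integrable lborel (\<lambda>y. case (x, y) of (x, t) \<Rightarrow> K x t)"
        by (simp add: K_def mult_ac)
    qed
  qed
  have "(LINT t|lborel. fourier_L1 f t * g t) = (LINT t|lborel. LINT x|lborel. K x t)"
    unfolding fourier_L1_def K_def by simp
  also have "\<dots> = (LINT x|lborel. LINT t|lborel. K x t)"
    by (rule lborel_pair.Fubini_integral[OF K])
  also have "\<dots> = (LINT x|lborel. f x * fourier_L1 g x)"
  proof (rule Bochner_Integration.integral_cong[OF refl])
    fix x
    have "(LINT t|lborel. K x t) = (LINT t|lborel. f x * (modulation x t * g t))"
      unfolding K_def by (intro Bochner_Integration.integral_cong) (simp_all add: mult_ac)
    also have "\<dots> = f x * fourier_L1 g x"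
      unfolding fourier_L1_def by (rule integral_mult_right_zero)
    finally show "(LINT t|lborel. K x t) = f x * fourier_L1 g x" .
  qed
  finally show ?thesis .
qed

section \<open>Gaussian regularisation\<close>

definition gauss :: "real \<Rightarrow> real \<Rightarrow> complex" where
  "gauss e t = of_real (exp (- (e * t)\<^sup>2 / 2))"

lemma gauss_measurable [measurable]: "gauss e \<in> borel_measurable borel"
  unfolding gauss_def by measurable

lemma gauss_eq: "gauss e t = of_real (sqrt (2 * pi) * std_normal_density (e * t))"
  by (simp add: gauss_def std_normal_density_def)

lemma gauss_integrable: "e \<noteq> 0 \<Longrightarrow> integrable lborel (gauss e)"
proof -
  assume e: "e \<noteq> 0"
  have "integrable lborel (\<lambda>t. complex_of_real (sqrt (2 * pi) * std_normal_density t))"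
    using integrable_std_normal_moment[of 0] by simp
  from lborel_integrable_real_affine[OF this e, of 0] show ?thesis
    by (simp add: gauss_eq[abs_def] del: of_real_mult)
qed

lemma cmod_gauss_le: "cmod (gauss e t) \<le> 1"
  by (simp add: gauss_def)

lemma gauss_tendsto: "(\<lambda>n. gauss (1 / real (Suc n)) t) \<longlonglongrightarrow> 1"
proof -
  have "(\<lambda>n. 1 / real (Suc n)) \<longlonglongrightarrow> 0" using LIMSEQ_inverse_real_of_nat by (simp add: inverse_eq_divide)
  then have "(\<lambda>n. gauss (1 / real (Suc n)) t) \<longlonglongrightarrow> gauss 0 t"
    unfolding gauss_def by (intro tendsto_intros) simp_all
  then show ?thesis by (simp add: gauss_def)
qed

lemma fourier_L1_gauss:
  assumes e: "e > 0"
  shows "fourier_L1 (gauss e) x = of_real (2 * pi * std_normal_density (x / e) / e)"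
proof -
  have "char std_normal_distribution (- x / e) = (LINT t|lborel. std_normal_density t *\<^sub>R iexp (- x / e * t))"
    unfolding char_def by (subst integral_density) (auto simp: normal_density_nonneg)
  then have c: "(LINT t|lborel. std_normal_density t *\<^sub>R iexp (- x / e * t)) = of_real (exp (- ((- x / e)\<^sup>2) / 2))"
    by (simp add: char_std_normal_distribution)
  have "fourier_L1 (gauss e) x = \<bar>1 / e\<bar> *\<^sub>R (LINT t|lborel. exp (- \<i> * of_real ((0 + 1 / e * t) * x)) * gauss e (0 + 1 / e * t))"
    unfolding fourier_L1_def using e by (intro lborel_integral_real_affine) auto
  also have "(LINT t|lborel. exp (- \<i> * of_real ((0 + 1 / e * t) * x)) * gauss e (0 + 1 / e * t)) =
      (LINT t|lborel. of_real (sqrt (2 * pi)) * (std_normal_density t *\<^sub>R iexp (- x / e * t)))"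
    using e by (intro Bochner_Integration.integral_cong) (auto simp: gauss_eq scaleR_conv_of_real mult_ac)
  also have "\<dots> = of_real (sqrt (2 * pi) * exp (- ((- x / e)\<^sup>2) / 2))"
    unfolding integral_mult_right_zero c by simp
  also have "sqrt (2 * pi) * exp (- ((- x / e)\<^sup>2) / 2) = 2 * pi * std_normal_density (x / e)"
    by (simp add: std_normal_density_def field_simps flip: real_sqrt_mult)
  finally show ?thesis using e by (simp add: scaleR_conv_of_real)
qed

text \<open>
  The convolution of \<open>g\<close> with the centred normal density of standard deviation \<open>e\<close>, after a substitution
  that leaves the limit \<open>e \<rightarrow> 0\<close> to the argument of \<open>g\<close>.
\<close>

definition gauss_mean :: "real \<Rightarrow> (real \<Rightarrow> complex) \<Rightarrow> real \<Rightarrow> complex" where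
  "gauss_mean e g x = (LINT s|lborel. g (x + e * s) * of_real (std_normal_density s))"

text \<open>
  The Gaussian factor makes the product of the two bounded transforms integrable, so that the
  multiplication formula can be applied twice. Since the transform of a Gaussian is a Gaussian, what
  remains on the other side is an average of \<open>g\<close> over a normal distribution.
\<close>

lemma fourier_L1_pairing_gauss:
  assumes f: "integrable lborel f" and g: "integrable lborel g" and e: "e > 0"
  shows "(LINT t|lborel. fourier_L1 f t * cnj (fourier_L1 g t) * gauss e t) =
    2 * of_real pi * (LINT x|lborel. f x * cnj (gauss_mean e g x))"
proof -
  have [measurable]: "f \<in> borel_measurable borel" "g \<in> borel_measurable borel"
    using borel_measurable_integrable[OF f] borel_measurable_integrable[OF g] by simp_all
  have [measurable]: "fourier_L1 g \<in> borel_measurable borel" by (rule fourier_L1_measurable[OF g])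
  define m where "m = (\<lambda>t. cnj (fourier_L1 g t) * gauss e t)"
  have ig: "integrable lborel (gauss e)" using e by (intro gauss_integrable) simp
  have [measurable]: "(\<lambda>t. cnj (fourier_L1 g t)) \<in> borel_measurable borel"
    by (rule borel_measurable_continuous_on[of cnj]) (auto intro: continuous_intros)
  have m: "integrable lborel m"
  proof (rule Bochner_Integration.integrable_bound)
    show "integrable lborel (\<lambda>t. of_real (LINT x|lborel. cmod (g x)) * gauss e t)"
      using ig by simp
    show "m \<in> borel_measurable lborel" unfolding m_def by measurable
    show "AE t in lborel. norm (m t) \<le> norm (of_real (LINT x|lborel. cmod (g x)) * gauss e t)"
      using cmod_fourier_L1_le[OF g] by (auto simp: m_def norm_mult intro!: mult_right_mono order_trans[OF _ abs_ge_self])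
  qed
  have Fm: "fourier_L1 m x = 2 * of_real pi * cnj (gauss_mean e g x)" for x
  proof -
    have im: "integrable lborel (\<lambda>t. exp (- \<i> * of_real (t * (- x))) * gauss e t)"
      by (rule integrable_exp_mult[OF ig])
    \<comment> \<open>Conjugation outside the integral turns the conjugated transform of \<open>g\<close> into one to which the multiplication formula applies.\<close>
    have "fourier_L1 m x = cnj (LINT t|lborel. fourier_L1 g t * (exp (- \<i> * of_real (t * (- x))) * gauss e t))"
      unfolding fourier_L1_def[of m] unfolding m_def Bochner_Integration.integral_cnj[symmetric]
      by (intro Bochner_Integration.integral_cong) (auto simp: exp_cnj gauss_def mult_ac)
    also have "(LINT t|lborel. fourier_L1 g t * (exp (- \<i> * of_real (t * (- x))) * gauss e t)) =
        (LINT y|lborel. g y * fourier_L1 (gauss e) (y + (- x)))"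
      by (subst fourier_L1_multiplication[OF g im]) (simp only: fourier_L1_modulate)
    also have "\<dots> = \<bar>e\<bar> *\<^sub>R (LINT s|lborel. g (x + e * s) * fourier_L1 (gauss e) ((x + e * s) + (- x)))"
      using e by (intro lborel_integral_real_affine) auto
    also have "\<dots> = (LINT s|lborel. 2 * of_real pi * (g (x + e * s) * of_real (std_normal_density s)))"
      unfolding fourier_L1_gauss[OF e] using e
      by (subst integral_scaleR_right[symmetric], intro Bochner_Integration.integral_cong) (simp_all add: scaleR_conv_of_real)
    also have "\<dots> = 2 * of_real pi * gauss_mean e g x"
      unfolding gauss_mean_def integral_mult_right_zero ..
    finally show ?thesis by simp
  qed
  have "(LINT t|lborel. fourier_L1 f t * cnj (fourier_L1 g t) * gauss e t) = (LINT x|lborel. f x * fourier_L1 m x)"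
    using fourier_L1_multiplication[OF f m] by (simp add: m_def mult.assoc)
  also have "\<dots> = (LINT x|lborel. 2 * of_real pi * (f x * cnj (gauss_mean e g x)))"
    by (simp add: Fm mult_ac)
  also have "\<dots> = 2 * of_real pi * (LINT x|lborel. f x * cnj (gauss_mean e g x))"
    by (rule integral_mult_right_zero)
  finally show ?thesis .
qed

lemma std_normal_integrable: "integrable lborel std_normal_density"
  using integrable_std_normal_moment[of 0] by simp

lemma std_normal_integral: "(LINT s|lborel. std_normal_density s) = 1"
  using integral_std_normal_moment_even[of 0] by simp

lemma nn_integral_std_normal: "(\<integral>\<^sup>+s. ennreal (std_normal_density s) \<partial>lborel) = 1"
  by (subst nn_integral_eq_integral[OF std_normal_integrable]) (auto simp: std_normal_integral)

lemma nn_integral_autocorrelation_le: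
  assumes f: "f \<in> L2"
  shows "(\<integral>\<^sup>+x. ennreal (cmod (f x) * cmod (f (x + c))) \<partial>lborel) \<le> ennreal (sq_norm f)"
proof -
  have [measurable]: "f \<in> borel_measurable borel" by (rule L2_measurable[OF f])
  have shift: "(\<integral>\<^sup>+x. ennreal ((cmod (f (x + c)))\<^sup>2) \<partial>lborel) = ennreal (sq_norm f)"
  proof -
    have "(\<integral>\<^sup>+x. ennreal ((cmod (f x))\<^sup>2) \<partial>lborel) = ennreal \<bar>1\<bar> * (\<integral>\<^sup>+x. ennreal ((cmod (f (c + 1 * x)))\<^sup>2) \<partial>lborel)"
      by (subst nn_integral_real_affine[where c=1 and t=c]) auto
    then show ?thesis using nn_integral_sq_norm[OF f] by (simp add: add.commute)
  qed
  have "(\<integral>\<^sup>+x. ennreal (cmod (f x) * cmod (f (x + c))) \<partial>lborel) \<le>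
      (\<integral>\<^sup>+x. ennreal (1/2) * (ennreal ((cmod (f x))\<^sup>2) + ennreal ((cmod (f (x + c)))\<^sup>2)) \<partial>lborel)"
  proof (rule nn_integral_mono)
    fix x
    have "cmod (f x) * cmod (f (x + c)) \<le> 1/2 * ((cmod (f x))\<^sup>2 + (cmod (f (x + c)))\<^sup>2)"
      using sum_squares_bound[of "cmod (f x)" "cmod (f (x + c))"] by simp
    then have "ennreal (cmod (f x) * cmod (f (x + c))) \<le> ennreal (1/2 * ((cmod (f x))\<^sup>2 + (cmod (f (x + c)))\<^sup>2))"
      by (rule ennreal_leI)
    also have "\<dots> = ennreal (1/2) * (ennreal ((cmod (f x))\<^sup>2) + ennreal ((cmod (f (x + c)))\<^sup>2))"
      by (subst ennreal_mult) auto
    finally show "ennreal (cmod (f x) * cmod (f (x + c))) \<le> ennreal (1/2) * (ennreal ((cmod (f x))\<^sup>2) + ennreal ((cmod (f (x + c)))\<^sup>2))" .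
  qed
  also have "\<dots> = ennreal (1/2) * (ennreal (sq_norm f) + ennreal (sq_norm f))"
    by (simp add: nn_integral_cmult nn_integral_add shift nn_integral_sq_norm[OF f])
  also have "\<dots> = ennreal (1/2 * (sq_norm f + sq_norm f))"
    unfolding ennreal_plus[OF sq_norm_nonneg sq_norm_nonneg, symmetric] by (rule ennreal_mult[symmetric]) auto
  finally show ?thesis by simp
qed

text \<open>
  By Tonelli's theorem this is an average over \<open>s\<close> of the correlations of \<open>\<bar>f\<bar>\<close> with its translate by
  \<open>e s\<close>, and each of them is at most the squared norm of \<open>f\<close>.
\<close>

lemma cmod_pairing_gauss_mean_le:
  assumes f: "f \<in> L2"
  shows "cmod (LINT x|lborel. f x * cnj (gauss_mean e f x)) \<le> sq_norm f"
proof -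
  have [measurable]: "f \<in> borel_measurable borel" by (rule L2_measurable[OF f])
  have "ennreal (cmod (LINT x|lborel. f x * cnj (gauss_mean e f x))) \<le>
      (\<integral>\<^sup>+x. ennreal (cmod (f x * cnj (gauss_mean e f x))) \<partial>lborel)"
    by (cases "integrable lborel (\<lambda>x. f x * cnj (gauss_mean e f x))")
       (auto simp: not_integrable_integral_eq intro: integral_norm_bound_ennreal)
  also have "\<dots> \<le> (\<integral>\<^sup>+x. (\<integral>\<^sup>+s. ennreal (cmod (f x) * cmod (f (x + e * s)) * std_normal_density s) \<partial>lborel) \<partial>lborel)"
  proof (rule nn_integral_mono)
    fix x
    have "ennreal (cmod (gauss_mean e f x)) \<le> (\<integral>\<^sup>+s. ennreal (cmod (f (x + e * s) * of_real (std_normal_density s))) \<partial>lborel)"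
      unfolding gauss_mean_def
      by (cases "integrable lborel (\<lambda>s. f (x + e * s) * of_real (std_normal_density s))")
         (auto simp: not_integrable_integral_eq intro: integral_norm_bound_ennreal)
    then have "ennreal (cmod (f x)) * ennreal (cmod (gauss_mean e f x)) \<le>
        ennreal (cmod (f x)) * (\<integral>\<^sup>+s. ennreal (cmod (f (x + e * s) * of_real (std_normal_density s))) \<partial>lborel)"
      by (rule mult_left_mono) simp
    also have "\<dots> = (\<integral>\<^sup>+s. ennreal (cmod (f x) * cmod (f (x + e * s)) * std_normal_density s) \<partial>lborel)"
      by (subst nn_integral_cmult[symmetric])
         (auto simp: norm_mult ennreal_mult normal_density_nonneg mult.assoc intro!: nn_integral_cong)
    finally show "ennreal (cmod (f x * cnj (gauss_mean e f x))) \<le> (\<integral>\<^sup>+s. ennreal (cmod (f x) * cmod (f (x + e * s)) * std_normal_density s) \<partial>lborel)"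
      by (simp add: norm_mult ennreal_mult)
  qed
  also have "\<dots> = (\<integral>\<^sup>+s. (\<integral>\<^sup>+x. ennreal (cmod (f x) * cmod (f (x + e * s)) * std_normal_density s) \<partial>lborel) \<partial>lborel)"
    by (rule lborel_pair.Fubini') measurable
  also have "\<dots> \<le> (\<integral>\<^sup>+s. ennreal (sq_norm f) * ennreal (std_normal_density s) \<partial>lborel)"
  proof (rule nn_integral_mono)
    fix s
    have "(\<integral>\<^sup>+x. ennreal (cmod (f x) * cmod (f (x + e * s)) * std_normal_density s) \<partial>lborel) =
        (\<integral>\<^sup>+x. ennreal (cmod (f x) * cmod (f (x + e * s))) \<partial>lborel) * ennreal (std_normal_density s)"
      by (subst nn_integral_multc[symmetric]) (auto simp: ennreal_mult normal_density_nonneg)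
    also have "\<dots> \<le> ennreal (sq_norm f) * ennreal (std_normal_density s)"
      by (intro mult_right_mono nn_integral_autocorrelation_le[OF f]) simp
    finally show "(\<integral>\<^sup>+x. ennreal (cmod (f x) * cmod (f (x + e * s)) * std_normal_density s) \<partial>lborel)
        \<le> ennreal (sq_norm f) * ennreal (std_normal_density s)" .
  qed
  also have "\<dots> = ennreal (sq_norm f)"
    by (simp add: nn_integral_cmult nn_integral_std_normal)
  finally show ?thesis by simp
qed

text \<open>
  Fatou's lemma lets the width of the Gaussian tend to infinity in the regularised integral of
  \<open>\<bar>F f\<bar>\<^sup>2\<close>. At this stage the Cauchy-Schwarz inequality yields only an upper bound; equality
  follows later from the inversion formula.
\<close>

lemma fourier_L1_Bessel:
  assumes f: "integrable lborel f" "f \<in> L2"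
  shows "fourier_L1 f \<in> L2" "sq_norm (fourier_L1 f) \<le> 2 * pi * sq_norm f"
proof -
  have [measurable]: "fourier_L1 f \<in> borel_measurable borel" by (rule fourier_L1_measurable[OF f(1)])
  define G where "G = (\<lambda>n t. (cmod (fourier_L1 f t))\<^sup>2 * exp (- (1 / real (Suc n) * t)\<^sup>2 / 2))"
  have le: "(\<integral>\<^sup>+t. ennreal (G n t) \<partial>lborel) \<le> ennreal (2 * pi * sq_norm f)" for n
  proof -
    have eq: "fourier_L1 f t * cnj (fourier_L1 f t) * gauss (1 / real (Suc n)) t = of_real (G n t)" for t
      by (simp add: G_def gauss_def complex_norm_square[unfolded of_real_power])
    have "integrable lborel (\<lambda>t. (LINT x|lborel. cmod (f x))\<^sup>2 *\<^sub>R gauss (1 / real (Suc n)) t)"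
      by (intro integrable_scaleR_right gauss_integrable) simp
    then have "integrable lborel (G n)"
    proof (rule Bochner_Integration.integrable_bound)
      show "G n \<in> borel_measurable lborel" unfolding G_def by measurable
      show "AE t in lborel. norm (G n t) \<le> norm ((LINT x|lborel. cmod (f x))\<^sup>2 *\<^sub>R gauss (1 / real (Suc n)) t)"
        using cmod_fourier_L1_le[OF f(1)]
        by (intro AE_I2) (auto simp: G_def gauss_def intro!: mult_right_mono power_mono)
    qed
    then have "(\<integral>\<^sup>+t. ennreal (G n t) \<partial>lborel) = ennreal (LINT t|lborel. G n t)"
      by (rule nn_integral_eq_integral) (simp add: G_def)
    also have "(LINT t|lborel. G n t) \<le> cmod (of_real (LINT t|lborel. G n t))"
      by simp
    also have "of_real (LINT t|lborel. G n t) = 2 * of_real pi * (LINT x|lborel. f x * cnj (gauss_mean (1 / real (Suc n)) f x))"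
      using fourier_L1_pairing_gauss[OF f(1) f(1), of "1 / real (Suc n)"]
      unfolding eq integral_complex_of_real by simp
    also have "cmod \<dots> \<le> 2 * pi * sq_norm f"
      using cmod_pairing_gauss_mean_le[OF f(2)] by (auto simp: norm_mult intro!: mult_left_mono)
    finally show ?thesis by (simp add: ennreal_leI)
  qed
  have "(\<lambda>n. ennreal (G n t)) \<longlonglongrightarrow> ennreal ((cmod (fourier_L1 f t))\<^sup>2)" for t
  proof -
    have "(\<lambda>n. (cmod (fourier_L1 f t))\<^sup>2 * cmod (gauss (1 / real (Suc n)) t)) \<longlonglongrightarrow> (cmod (fourier_L1 f t))\<^sup>2 * cmod 1"
      by (intro tendsto_intros gauss_tendsto)
    then show ?thesis by (intro tendsto_ennrealI) (simp add: G_def gauss_def)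
  qed
  then have "(\<integral>\<^sup>+t. ennreal ((cmod (fourier_L1 f t))\<^sup>2) \<partial>lborel) = (\<integral>\<^sup>+t. liminf (\<lambda>n. ennreal (G n t)) \<partial>lborel)"
    by (intro nn_integral_cong lim_imp_Liminf[symmetric]) simp_all
  also have "\<dots> \<le> liminf (\<lambda>n. \<integral>\<^sup>+t. ennreal (G n t) \<partial>lborel)"
    by (rule nn_integral_liminf) (simp add: G_def)
  also have "\<dots> \<le> ennreal (2 * pi * sq_norm f)"
    using Liminf_mono[of "\<lambda>n. \<integral>\<^sup>+t. ennreal (G n t) \<partial>lborel" "\<lambda>_. ennreal (2 * pi * sq_norm f)" sequentially] le
    by (simp add: Liminf_const)
  finally have *: "(\<integral>\<^sup>+t. ennreal ((cmod (fourier_L1 f t))\<^sup>2) \<partial>lborel) \<le> ennreal (2 * pi * sq_norm f)" .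
  show L: "fourier_L1 f \<in> L2"
    by (rule L2I_nn_integral) (use * in \<open>auto intro: le_less_trans\<close>)
  show "sq_norm (fourier_L1 f) \<le> 2 * pi * sq_norm f"
    using * unfolding nn_integral_sq_norm[OF L] by simp
qed

section \<open>Inversion against intervals\<close>

text \<open>
  At the endpoints of a nondegenerate interval the means tend to \<open>1/2\<close> instead.
\<close>

lemma gauss_mean_indicator_tendsto:
  assumes "x \<noteq> a" "x \<noteq> b"
  shows "(\<lambda>n. gauss_mean (1 / real (Suc n)) (indicator {a..b}) x) \<longlonglongrightarrow> indicator {a..b} x"
proof -
  have "(\<lambda>n. LINT s|lborel. indicator {a..b} (x + 1 / real (Suc n) * s) * complex_of_real (std_normal_density s))
      \<longlonglongrightarrow> (LINT s|lborel. indicator {a..b} x * complex_of_real (std_normal_density s))"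
  proof (rule integral_dominated_convergence[where w=std_normal_density])
    show "AE s in lborel. (\<lambda>n. indicator {a..b} (x + 1 / real (Suc n) * s) * complex_of_real (std_normal_density s))
        \<longlonglongrightarrow> indicator {a..b} x * complex_of_real (std_normal_density s)"
    proof (intro AE_I2 tendsto_mult tendsto_const)
      fix s :: real
      have "(\<lambda>n. 1 / real (Suc n)) \<longlonglongrightarrow> 0" using LIMSEQ_inverse_real_of_nat by (simp add: inverse_eq_divide)
      then have lim: "(\<lambda>n. x + 1 / real (Suc n) * s) \<longlonglongrightarrow> x + 0 * s"
        by (intro tendsto_intros)
      have ev: "\<forall>\<^sub>F n in sequentially. indicator {a..b} (x + 1 / real (Suc n) * s) = (indicator {a..b} x :: complex)"
      proof (cases "a < x \<and> x < b")
        case True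
        then have "\<forall>\<^sub>F n in sequentially. a < x + 1 / real (Suc n) * s" "\<forall>\<^sub>F n in sequentially. x + 1 / real (Suc n) * s < b"
          using order_tendstoD[OF lim] by auto
        then show ?thesis by eventually_elim (use True in \<open>auto simp: indicator_def\<close>)
      next
        case False
        then consider "x < a" | "x > b" using assms by linarith
        then show ?thesis
        proof cases
          case 1
          then have "\<forall>\<^sub>F n in sequentially. x + 1 / real (Suc n) * s < a" using order_tendstoD[OF lim] by auto
          then show ?thesis by eventually_elim (use 1 in \<open>auto simp: indicator_def\<close>)
        next
          case 2
          then have "\<forall>\<^sub>F n in sequentially. x + 1 / real (Suc n) * s > b" using order_tendstoD[OF lim] by auto
          then show ?thesis by eventually_elim (use 2 in \<open>auto simp: indicator_def\<close>)
        qed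
      qed
      then show "(\<lambda>n. indicator {a..b} (x + 1 / real (Suc n) * s) :: complex) \<longlonglongrightarrow> indicator {a..b} x"
        by (rule tendsto_eventually)
    qed
  qed (auto simp: norm_mult indicator_def normal_density_nonneg std_normal_integrable)
  moreover have "(LINT s|lborel. indicator {a..b} x * complex_of_real (std_normal_density s)) = indicator {a..b} x"
    by (simp add: std_normal_integral)
  ultimately show ?thesis by (simp add: gauss_mean_def)
qed

lemma cmod_gauss_mean_indicator_le: "cmod (gauss_mean e (indicator {a..b}) x) \<le> 1"
proof -
  have "cmod (gauss_mean e (indicator {a..b}) x) \<le> (LINT s|lborel. std_normal_density s)"
    unfolding gauss_mean_def
  proof (rule Bochner_Integration.integral_norm_bound_integral)
    show "integrable lborel (\<lambda>s. indicator {a..b} (x + e * s) * complex_of_real (std_normal_density s))"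
      by (rule Bochner_Integration.integrable_bound[OF std_normal_integrable])
         (auto simp: norm_mult indicator_def normal_density_nonneg)
  qed (auto simp: norm_mult indicator_def normal_density_nonneg std_normal_integrable)
  then show ?thesis by (simp add: std_normal_integral)
qed

text \<open>
  When the second function is the indicator of an interval, all the smoothing falls on it, and the
  means of the indicator converge almost everywhere and boundedly. So \<open>w\<close> may
  be any integrable function. As intervals determine a function, this is a form of the inversion formula.
\<close>

lemma fourier_L1_inversion_interval:
  assumes w: "integrable lborel w"
  shows "(\<lambda>n. LINT t|lborel. fourier_L1 w t * cnj (fourier_L1 (indicator {a..b}) t) * gauss (1 / real (Suc n)) t)
    \<longlonglongrightarrow> 2 * of_real pi * (LINT x|lborel. indicator {a..b} x * w x)"
proof -
  have [measurable]: "w \<in> borel_measurable borel" using borel_measurable_integrable[OF w] by simp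
  have [measurable]: "(\<lambda>x. cnj (gauss_mean e (indicator {a..b}) x)) \<in> borel_measurable borel" for e
    unfolding gauss_mean_def
    by (rule borel_measurable_continuous_on[of cnj]) (auto intro: continuous_intros)
  have "(\<lambda>n. LINT x|lborel. w x * cnj (gauss_mean (1 / real (Suc n)) (indicator {a..b}) x))
      \<longlonglongrightarrow> (LINT x|lborel. w x * cnj (indicator {a..b} x))"
  proof (rule integral_dominated_convergence[where w="\<lambda>x. cmod (w x)"])
    show "AE x in lborel. (\<lambda>n. w x * cnj (gauss_mean (1 / real (Suc n)) (indicator {a..b}) x))
        \<longlonglongrightarrow> w x * cnj (indicator {a..b} x)"
      using AE_lborel_singleton[of a] AE_lborel_singleton[of b]
      by eventually_elim (intro tendsto_intros gauss_mean_indicator_tendsto)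
    show "AE x in lborel. norm (w x * cnj (gauss_mean (1 / real (Suc n)) (indicator {a..b}) x)) \<le> cmod (w x)" for n
      using cmod_gauss_mean_indicator_le by (auto simp: norm_mult intro!: mult_left_le)
  qed (use w in \<open>auto simp: indicator_def\<close>)
  then have "(\<lambda>n. 2 * of_real pi * (LINT x|lborel. w x * cnj (gauss_mean (1 / real (Suc n)) (indicator {a..b}) x)))
      \<longlonglongrightarrow> 2 * of_real pi * (LINT x|lborel. w x * cnj (indicator {a..b} x))"
    by (rule tendsto_mult[OF tendsto_const])
  moreover have "w x * cnj (indicator {a..b} x) = indicator {a..b} x * w x" for x
    by (simp add: indicator_def)
  ultimately show ?thesis
    by (simp add: fourier_L1_pairing_gauss[OF w])
qed

lemma fourier_L1_eq_0_AE:
  assumes w: "integrable lborel w" and "\<And>t. fourier_L1 w t = 0"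
  shows "AE x in lborel. w x = 0"
proof (rule integrable_eq_0_AE_if_intervals[OF w])
  fix a b :: real
  show "(LINT x|lborel. indicator {a..b} x * w x) = 0"
    using fourier_L1_inversion_interval[OF w, of a b] by (simp add: assms(2) LIMSEQ_const_iff)
qed

lemma fourier_L1_Parseval_interval:
  assumes f: "integrable lborel f" "f \<in> L2"
  shows "(LINT t|lborel. fourier_L1 f t * cnj (fourier_L1 (indicator {a..b}) t)) =
    2 * of_real pi * (LINT x|lborel. indicator {a..b} x * f x)"
proof (rule LIMSEQ_unique[OF _ fourier_L1_inversion_interval[OF f(1)]])
  let ?p = "\<lambda>t. fourier_L1 f t * cnj (fourier_L1 (indicator {a..b}) t)"
  have L: "fourier_L1 f \<in> L2" "fourier_L1 (indicator {a..b}) \<in> L2"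
    by (intro fourier_L1_Bessel f; simp)+
  have I: "integrable lborel (\<lambda>t. ?p t)"
    by (intro L2_mult_integrable L2_cnj L)
  note [measurable] = borel_measurable_integrable[OF I]
  show "(\<lambda>n. LINT t|lborel. ?p t * gauss (1 / real (Suc n)) t)
    \<longlonglongrightarrow> (LINT t|lborel. ?p t)"
  proof (rule integral_dominated_convergence[where w="\<lambda>t. cmod (?p t)"])
    show "AE t in lborel. (\<lambda>n. ?p t * gauss (1 / real (Suc n)) t)
      \<longlonglongrightarrow> ?p t"
      using tendsto_mult[OF tendsto_const gauss_tendsto] by simp
    show "AE t in lborel. norm (?p t * gauss (1 / real (Suc n)) t)
      \<le> cmod (?p t)" for n
      using cmod_gauss_le by (intro AE_I2) (auto simp: norm_mult intro!: mult_left_le)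
  qed (use I in auto)
qed

section \<open>The Fourier transform of square-integrable functions\<close>

text \<open>
  Pairing with a fixed square-integrable function turns a Cauchy sequence in \<open>L\<^sup>2\<close> into one in \<open>L\<^sup>1\<close>,
  which has a subsequence converging almost everywhere. A Gaussian has no zeros, so it can be divided
  out. Fatou's lemma then shows that the pointwise limit is the limit in \<open>L\<^sup>2\<close>.
\<close>

lemma L2_complete:
  assumes L: "\<And>n. \<Phi> n \<in> L2"
    and Cau: "\<And>e. e > 0 \<Longrightarrow> \<exists>N. \<forall>i\<ge>N. \<forall>j\<ge>N. sq_norm (\<lambda>x. \<Phi> i x - \<Phi> j x) < e"
  shows "\<exists>g\<in>L2. (\<lambda>n::nat. sq_norm (\<lambda>x. \<Phi> n x - g x)) \<longlonglongrightarrow> 0"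
proof -
  have [measurable]: "\<Phi> n \<in> borel_measurable borel" for n by (rule L2_measurable[OF L])
  have w: "gauss 1 \<in> L2"
  proof (rule L2I_bound)
    show "integrable lborel (\<lambda>x. cmod (gauss 1 x))" using gauss_integrable[of 1] by simp
    show "AE x in lborel. (cmod (gauss 1 x))\<^sup>2 \<le> cmod (gauss 1 x)"
      using cmod_gauss_le by (intro AE_I2) (simp add: power2_eq_square mult_left_le)
  qed simp
  have w0: "gauss 1 x \<noteq> 0" for x by (simp add: gauss_def)
  define s where "s = (\<lambda>n x. gauss 1 x * \<Phi> n x)"
  have s: "integrable lborel (s n)" for n
    unfolding s_def by (rule L2_mult_integrable[OF w L])
  have sC: "\<exists>N. \<forall>i\<ge>N. \<forall>j\<ge>N. (LINT x|lborel. norm (s i x - s j x)) < e" if e: "e > 0" for e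
  proof -
    define W where "W = sq_norm (gauss 1) + 1"
    have W: "W > 0" unfolding W_def using sq_norm_nonneg[of "gauss 1"] by linarith
    from Cau[of "e\<^sup>2 / W"] e W obtain N where
      N: "\<And>i j. i \<ge> N \<Longrightarrow> j \<ge> N \<Longrightarrow> sq_norm (\<lambda>x. \<Phi> i x - \<Phi> j x) < e\<^sup>2 / W" by auto
    have "(LINT x|lborel. norm (s i x - s j x)) < e" if ij: "i \<ge> N" "j \<ge> N" for i j
    proof -
      define D where "D = (\<lambda>x. complex_of_real (cmod (\<Phi> i x - \<Phi> j x)))"
      have DL: "D \<in> L2"
        using L2_diff[OF L[of i] L[of j]] by (auto simp: L2_def D_def)
      have "(LINT x|lborel. norm (s i x - s j x)) = (LINT x|lborel. cmod (gauss 1 x) * cmod (\<Phi> i x - \<Phi> j x))"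
        unfolding s_def by (simp flip: right_diff_distrib add: norm_mult)
      also have "complex_of_real \<dots> = (LINT x|lborel. gauss 1 x * D x)"
        unfolding integral_complex_of_real[symmetric] D_def by (simp add: gauss_def)
      finally have eq: "complex_of_real (LINT x|lborel. norm (s i x - s j x)) = (LINT x|lborel. gauss 1 x * D x)" .
      have "(LINT x|lborel. norm (s i x - s j x))\<^sup>2 = (cmod (LINT x|lborel. gauss 1 x * D x))\<^sup>2"
        unfolding eq[symmetric] by simp
      also have "\<dots> \<le> sq_norm (gauss 1) * sq_norm D"
        by (rule integral_Cauchy_Schwarz[OF w DL])
      also have "sq_norm D = sq_norm (\<lambda>x. \<Phi> i x - \<Phi> j x)"
        by (simp add: D_def sq_norm_def)
      also have "sq_norm (gauss 1) * sq_norm (\<lambda>x. \<Phi> i x - \<Phi> j x) \<le> W * sq_norm (\<lambda>x. \<Phi> i x - \<Phi> j x)"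
        by (intro mult_right_mono) (simp_all add: W_def)
      also have "\<dots> < W * (e\<^sup>2 / W)"
        using N[OF ij] W by (intro mult_strict_left_mono)
      finally have "(LINT x|lborel. norm (s i x - s j x))\<^sup>2 < e\<^sup>2" using W by simp
      then show ?thesis by (rule power_less_imp_less_base) (use e in simp)
    qed
    then show ?thesis by blast
  qed
  obtain r where r: "strict_mono r" "AE x in lborel. Cauchy (\<lambda>i. s (r i) x)"
    by (rule cauchy_L1_AE_cauchy_subseq[OF s sC])
  define g where "g = (\<lambda>x. lim (\<lambda>i. \<Phi> (r i) x))"
  have [measurable]: "g \<in> borel_measurable borel"
    unfolding g_def by (rule borel_measurable_lim_metric) simp
  have conv: "AE x in lborel. (\<lambda>i. \<Phi> (r i) x) \<longlonglongrightarrow> g x"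
    using r(2)
  proof eventually_elim
    case (elim x)
    then obtain l where "(\<lambda>i. s (r i) x) \<longlonglongrightarrow> l" using Cauchy_convergent_iff convergent_def by blast
    then have "(\<lambda>i. s (r i) x / gauss 1 x) \<longlonglongrightarrow> l / gauss 1 x"
      using w0 by (intro tendsto_intros)
    then have "convergent (\<lambda>i. \<Phi> (r i) x)" using w0 by (auto simp: s_def convergent_def)
    then show ?case by (simp add: g_def convergent_LIMSEQ_iff)
  qed
  have bound: "(\<integral>\<^sup>+x. ennreal ((cmod (\<Phi> n x - g x))\<^sup>2) \<partial>lborel) \<le> ennreal e"
    if N: "\<And>i j. i \<ge> N \<Longrightarrow> j \<ge> N \<Longrightarrow> sq_norm (\<lambda>x. \<Phi> i x - \<Phi> j x) < e" and n: "n \<ge> N" for e n N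
  proof -
    have "AE x in lborel. (\<lambda>i. ennreal ((cmod (\<Phi> n x - \<Phi> (r i) x))\<^sup>2)) \<longlonglongrightarrow> ennreal ((cmod (\<Phi> n x - g x))\<^sup>2)"
      using conv by eventually_elim (intro tendsto_intros)
    then have "AE x in lborel. ennreal ((cmod (\<Phi> n x - g x))\<^sup>2) = liminf (\<lambda>i. ennreal ((cmod (\<Phi> n x - \<Phi> (r i) x))\<^sup>2))"
      by eventually_elim (rule lim_imp_Liminf[symmetric], simp_all del: tendsto_ennreal_iff)
    then have "(\<integral>\<^sup>+x. ennreal ((cmod (\<Phi> n x - g x))\<^sup>2) \<partial>lborel) =
        (\<integral>\<^sup>+x. liminf (\<lambda>i. ennreal ((cmod (\<Phi> n x - \<Phi> (r i) x))\<^sup>2)) \<partial>lborel)"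
      by (rule nn_integral_cong_AE)
    also have "\<dots> \<le> liminf (\<lambda>i. \<integral>\<^sup>+x. ennreal ((cmod (\<Phi> n x - \<Phi> (r i) x))\<^sup>2) \<partial>lborel)"
      by (rule nn_integral_liminf) measurable
    also have "\<dots> \<le> liminf (\<lambda>i::nat. ennreal e)"
    proof (rule Liminf_mono)
      show "\<forall>\<^sub>F i in sequentially. (\<integral>\<^sup>+x. ennreal ((cmod (\<Phi> n x - \<Phi> (r i) x))\<^sup>2) \<partial>lborel) \<le> ennreal e"
        using eventually_ge_at_top[of N]
      proof eventually_elim
        case (elim i)
        then have "r i \<ge> N" using strict_mono_imp_increasing[OF r(1), of i] by simp
        then show ?case
          using N[OF n, of "r i"] by (subst nn_integral_sq_norm[OF L2_diff[OF L L]]) (simp add: ennreal_leI)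
      qed
    qed
    also have "\<dots> = ennreal e" by (simp add: Liminf_const)
    finally show ?thesis .
  qed
  have gL: "g \<in> L2"
  proof -
    obtain N where N: "\<And>i j. i \<ge> N \<Longrightarrow> j \<ge> N \<Longrightarrow> sq_norm (\<lambda>x. \<Phi> i x - \<Phi> j x) < 1"
      using Cau[of 1] by auto
    have "(\<lambda>x. \<Phi> N x - g x) \<in> L2"
      using bound[OF N, of N] by (intro L2I_nn_integral) (auto intro: le_less_trans[where y=1])
    from L2_diff[OF L[of N] this] show ?thesis by simp
  qed
  have "(\<lambda>n. sq_norm (\<lambda>x. \<Phi> n x - g x)) \<longlonglongrightarrow> 0"
  proof (rule LIMSEQ_I)
    fix e :: real assume e: "e > 0"
    then obtain N where N: "\<And>i j. i \<ge> N \<Longrightarrow> j \<ge> N \<Longrightarrow> sq_norm (\<lambda>x. \<Phi> i x - \<Phi> j x) < e/2"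
      using Cau[of "e/2"] by auto
    have "sq_norm (\<lambda>x. \<Phi> n x - g x) \<le> e/2" if "n \<ge> N" for n
      using bound[OF N that] e unfolding nn_integral_sq_norm[OF L2_diff[OF L gL]] by simp
    then show "\<exists>N. \<forall>n\<ge>N. norm (sq_norm (\<lambda>x. \<Phi> n x - g x) - 0) < e"
      using e by (intro exI[of _ N]) (auto intro: le_less_trans[where y="e/2"])
  qed
  with gL show ?thesis by blast
qed

definition trunc :: "nat \<Rightarrow> (real \<Rightarrow> complex) \<Rightarrow> real \<Rightarrow> complex" where
  "trunc n f = (\<lambda>x. indicator {- real n..real n} x * f x)"

lemma trunc_L2 [intro]: "f \<in> L2 \<Longrightarrow> trunc n f \<in> L2"
  unfolding trunc_def by (rule L2_indicator_mult) auto

lemma trunc_integrable [intro]: "f \<in> L2 \<Longrightarrow> integrable lborel (trunc n f)"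
  unfolding trunc_def by (rule L2_truncation_integrable)

lemma trunc_tendsto: "f \<in> L2 \<Longrightarrow> (\<lambda>n. sq_norm (\<lambda>x. trunc n f x - f x)) \<longlonglongrightarrow> 0"
  unfolding trunc_def by (rule L2_truncation_tendsto)

lemma fourier_trunc_L2 [intro]: "f \<in> L2 \<Longrightarrow> fourier_L1 (trunc n f) \<in> L2"
  by (intro fourier_L1_Bessel) auto

lemma is_fourier_L2_iff:
  assumes f: "f \<in> L2"
  shows "is_fourier_L2 f g \<longleftrightarrow> g \<in> L2 \<and> (\<lambda>n. sq_norm (\<lambda>t. fourier_L1 (trunc n f) t - g t)) \<longlonglongrightarrow> 0"
proof (cases "g \<in> L2")
  case True
  have "(\<integral>\<^sup>+ t. ennreal ((norm (fourier_L1 (\<lambda>x. indicator {- real n..real n} x * f x) t - g t))\<^sup>2) \<partial>lborel)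
      = ennreal (sq_norm (\<lambda>t. fourier_L1 (trunc n f) t - g t))" for n
    using nn_integral_sq_norm[OF L2_diff[OF fourier_trunc_L2[OF f] True], of n] by (simp add: trunc_def)
  then show ?thesis
    unfolding is_fourier_L2_def using True by (simp add: ennreal_tendsto_0_iff)
qed (simp add: is_fourier_L2_def)

text \<open>
  The truncations of \<open>f\<close> converge in \<open>L\<^sup>2\<close>, so by the bound on \<open>L\<^sup>1 \<inter> L\<^sup>2\<close> their transforms form a
  Cauchy sequence.
\<close>

lemma fourier_L2_exists:
  assumes f: "f \<in> L2"
  shows "\<exists>g. is_fourier_L2 f g"
proof -
  have "\<exists>g\<in>L2. (\<lambda>n. sq_norm (\<lambda>t. fourier_L1 (trunc n f) t - g t)) \<longlonglongrightarrow> 0"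
  proof (rule L2_complete)
    show "fourier_L1 (trunc n f) \<in> L2" for n using f by blast
    fix e :: real assume e: "e > 0"
    then obtain N where N: "\<And>n. n \<ge> N \<Longrightarrow> sq_norm (\<lambda>x. trunc n f x - f x) < e / (8 * pi)"
      using LIMSEQ_D[OF trunc_tendsto[OF f], of "e / (8 * pi)"] by (auto simp: pi_gt_zero)
    have "sq_norm (\<lambda>t. fourier_L1 (trunc i f) t - fourier_L1 (trunc j f) t) < e" if "i \<ge> N" "j \<ge> N" for i j
    proof -
      have L: "(\<lambda>x. trunc i f x - trunc j f x) \<in> L2" "integrable lborel (\<lambda>x. trunc i f x - trunc j f x)"
        using f by (auto intro!: L2_diff Bochner_Integration.integrable_diff)
      have "sq_norm (\<lambda>t. fourier_L1 (trunc i f) t - fourier_L1 (trunc j f) t) =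
          sq_norm (fourier_L1 (\<lambda>x. trunc i f x - trunc j f x))"
        using f by (auto simp: fourier_L1_diff trunc_integrable intro!: arg_cong[where f=sq_norm])
      also have "\<dots> \<le> 2 * pi * sq_norm (\<lambda>x. trunc i f x - trunc j f x)"
        by (rule fourier_L1_Bessel(2)[OF L(2,1)])
      also have "sq_norm (\<lambda>x. trunc i f x - trunc j f x) =
          sq_norm (\<lambda>x. (trunc i f x - f x) + (f x - trunc j f x))" by simp
      also have "\<dots> \<le> 2 * sq_norm (\<lambda>x. trunc i f x - f x) + 2 * sq_norm (\<lambda>x. trunc j f x - f x)"
        using sq_norm_add_le[of "\<lambda>x. trunc i f x - f x" "\<lambda>x. f x - trunc j f x"] f
        by (auto simp: sq_norm_minus_commute[of f] intro!: L2_diff)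
      also have "\<dots> < 4 * (e / (8 * pi))" using N[OF that(1)] N[OF that(2)] by simp
      finally show ?thesis by (simp add: field_simps)
    qed
    then show "\<exists>N. \<forall>i\<ge>N. \<forall>j\<ge>N. sq_norm (\<lambda>t. fourier_L1 (trunc i f) t - fourier_L1 (trunc j f) t) < e"
      by blast
  qed
  then show ?thesis using is_fourier_L2_iff[OF f] by blast
qed

lemma is_fourier_L2_fourier_L2: "f \<in> L2 \<Longrightarrow> is_fourier_L2 f (fourier_L2 f)"
  unfolding fourier_L2_def using someI_ex[OF fourier_L2_exists] .

lemma fourier_L2_L2 [intro]: "f \<in> L2 \<Longrightarrow> fourier_L2 f \<in> L2"
  using is_fourier_L2_fourier_L2 by (auto simp: is_fourier_L2_def)

lemma fourier_L2_tendsto: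
  "f \<in> L2 \<Longrightarrow> (\<lambda>n. sq_norm (\<lambda>t. fourier_L1 (trunc n f) t - fourier_L2 f t)) \<longlonglongrightarrow> 0"
  using is_fourier_L2_fourier_L2 is_fourier_L2_iff by blast

lemma fourier_L2_unique:
  assumes f: "f \<in> L2" and g: "is_fourier_L2 f g"
  shows "AE t in lborel. fourier_L2 f t = g t"
proof -
  have gL: "g \<in> L2" and lim: "(\<lambda>n. sq_norm (\<lambda>t. fourier_L1 (trunc n f) t - g t)) \<longlonglongrightarrow> 0"
    using g is_fourier_L2_iff[OF f] by auto
  have D: "(\<lambda>t. fourier_L2 f t - g t) \<in> L2" using f gL by (auto intro: L2_diff)
  have "sq_norm (\<lambda>t. fourier_L2 f t - g t) \<le> 2 * 0 + 2 * 0"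
  proof (rule LIMSEQ_le_const)
    show "(\<lambda>n. 2 * sq_norm (\<lambda>t. fourier_L1 (trunc n f) t - fourier_L2 f t) +
        2 * sq_norm (\<lambda>t. fourier_L1 (trunc n f) t - g t)) \<longlonglongrightarrow> 2 * 0 + 2 * 0"
      by (intro tendsto_intros lim fourier_L2_tendsto f)
    show "\<exists>N. \<forall>n\<ge>N. sq_norm (\<lambda>t. fourier_L2 f t - g t) \<le>
        2 * sq_norm (\<lambda>t. fourier_L1 (trunc n f) t - fourier_L2 f t) +
        2 * sq_norm (\<lambda>t. fourier_L1 (trunc n f) t - g t)"
    proof (intro exI allI impI)
      fix n
      have "sq_norm (\<lambda>t. (fourier_L2 f t - fourier_L1 (trunc n f) t) + (fourier_L1 (trunc n f) t - g t)) \<le>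
          2 * sq_norm (\<lambda>t. fourier_L2 f t - fourier_L1 (trunc n f) t) +
          2 * sq_norm (\<lambda>t. fourier_L1 (trunc n f) t - g t)"
        using f gL by (intro sq_norm_add_le L2_diff) auto
      then show "sq_norm (\<lambda>t. fourier_L2 f t - g t) \<le>
        2 * sq_norm (\<lambda>t. fourier_L1 (trunc n f) t - fourier_L2 f t) +
        2 * sq_norm (\<lambda>t. fourier_L1 (trunc n f) t - g t)"
        by (simp add: sq_norm_minus_commute[of "fourier_L2 f"])
    qed
  qed
  then have "sq_norm (\<lambda>t. fourier_L2 f t - g t) = 0" using sq_norm_nonneg[of "\<lambda>t. fourier_L2 f t - g t"] by simp
  then show ?thesis using sq_norm_eq_0_iff[OF D] by simp
qed

lemma fourier_L2_eq_L1:
  assumes f: "f \<in> L2" "integrable lborel f"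
  shows "AE t in lborel. fourier_L2 f t = fourier_L1 f t"
proof (rule fourier_L2_unique[OF f(1)], unfold is_fourier_L2_iff[OF f(1)], intro conjI)
  show "fourier_L1 f \<in> L2" by (rule fourier_L1_Bessel[OF f(2,1)])
  have "(\<lambda>n. 2 * pi * sq_norm (\<lambda>x. trunc n f x - f x)) \<longlonglongrightarrow> 2 * pi * 0"
    by (intro tendsto_intros trunc_tendsto f)
  then have lim: "(\<lambda>n. 2 * pi * sq_norm (\<lambda>x. trunc n f x - f x)) \<longlonglongrightarrow> 0" by simp
  have "sq_norm (\<lambda>t. fourier_L1 (trunc n f) t - fourier_L1 f t) \<le> 2 * pi * sq_norm (\<lambda>x. trunc n f x - f x)" for n
  proof -
    have "(\<lambda>t. fourier_L1 (trunc n f) t - fourier_L1 f t) = fourier_L1 (\<lambda>x. trunc n f x - f x)"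
      using f by (auto simp: fourier_L1_diff trunc_integrable)
    then show ?thesis
      using fourier_L1_Bessel(2)[of "\<lambda>x. trunc n f x - f x"] f
      by (auto simp: trunc_integrable intro: L2_diff)
  qed
  then show "(\<lambda>n. sq_norm (\<lambda>t. fourier_L1 (trunc n f) t - fourier_L1 f t)) \<longlonglongrightarrow> 0"
    by (intro tendsto_sandwich[OF _ _ tendsto_const lim]) auto
qed

lemma fourier_L2_add:
  assumes f: "f \<in> L2" and g: "g \<in> L2"
  shows "AE t in lborel. fourier_L2 (\<lambda>x. f x + g x) t = fourier_L2 f t + fourier_L2 g t"
proof (rule fourier_L2_unique[OF L2_add[OF f g]], unfold is_fourier_L2_iff[OF L2_add[OF f g]], intro conjI)
  let ?A = "\<lambda>n. sq_norm (\<lambda>t. fourier_L1 (trunc n f) t - fourier_L2 f t)"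
  let ?B = "\<lambda>n. sq_norm (\<lambda>t. fourier_L1 (trunc n g) t - fourier_L2 g t)"
  show "(\<lambda>t. fourier_L2 f t + fourier_L2 g t) \<in> L2" using f g by (auto intro: L2_add)
  have eq: "fourier_L1 (trunc n (\<lambda>x. f x + g x)) t = fourier_L1 (trunc n f) t + fourier_L1 (trunc n g) t" for n t
    using fourier_L1_add[OF trunc_integrable[OF f] trunc_integrable[OF g], of n n t]
    by (simp add: trunc_def ring_distribs)
  have "(\<lambda>n. 2 * ?A n +
      2 * ?B n) \<longlonglongrightarrow> 2 * 0 + 2 * 0"
    by (intro tendsto_intros fourier_L2_tendsto f g)
  then have lim: "(\<lambda>n. 2 * ?A n +
      2 * ?B n) \<longlonglongrightarrow> 0" by simp
  have "sq_norm (\<lambda>t. fourier_L1 (trunc n (\<lambda>x. f x + g x)) t - (fourier_L2 f t + fourier_L2 g t)) \<le>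
      2 * ?A n +
      2 * ?B n" for n
    using sq_norm_add_le[of "\<lambda>t. fourier_L1 (trunc n f) t - fourier_L2 f t" "\<lambda>t. fourier_L1 (trunc n g) t - fourier_L2 g t"] f g
    by (auto simp: eq add_diff_add intro!: L2_diff)
  then show "(\<lambda>n. sq_norm (\<lambda>t. fourier_L1 (trunc n (\<lambda>x. f x + g x)) t - (fourier_L2 f t + fourier_L2 g t))) \<longlonglongrightarrow> 0"
    by (intro tendsto_sandwich[OF _ _ tendsto_const lim]) auto
qed

lemma sq_norm_cmult: "sq_norm (\<lambda>x. c * f x) = (cmod c)\<^sup>2 * sq_norm f"
  unfolding sq_norm_def by (simp add: norm_mult power_mult_distrib)

lemma fourier_L2_cmult:
  assumes f: "f \<in> L2"
  shows "AE t in lborel. fourier_L2 (\<lambda>x. c * f x) t = c * fourier_L2 f t"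
proof (rule fourier_L2_unique[OF L2_cmult[OF f]], unfold is_fourier_L2_iff[OF L2_cmult[OF f]], intro conjI)
  show "(\<lambda>t. c * fourier_L2 f t) \<in> L2" using f by (auto intro: L2_cmult)
  have "trunc n (\<lambda>x. c * f x) = (\<lambda>x. c * trunc n f x)" for n by (auto simp: trunc_def)
  then have eq: "fourier_L1 (trunc n (\<lambda>x. c * f x)) t - c * fourier_L2 f t = c * (fourier_L1 (trunc n f) t - fourier_L2 f t)" for n t
    by (simp add: fourier_L1_cmult right_diff_distrib)
  have "(\<lambda>n. (cmod c)\<^sup>2 * sq_norm (\<lambda>t. fourier_L1 (trunc n f) t - fourier_L2 f t)) \<longlonglongrightarrow> (cmod c)\<^sup>2 * 0"
    by (intro tendsto_intros fourier_L2_tendsto f)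
  then show "(\<lambda>n. sq_norm (\<lambda>t. fourier_L1 (trunc n (\<lambda>x. c * f x)) t - c * fourier_L2 f t)) \<longlonglongrightarrow> 0"
    by (simp add: eq sq_norm_cmult)
qed

lemma fourier_L2_diff:
  assumes f: "f \<in> L2" and g: "g \<in> L2"
  shows "AE t in lborel. fourier_L2 (\<lambda>x. f x - g x) t = fourier_L2 f t - fourier_L2 g t"
  using fourier_L2_add[OF f L2_cmult[OF g, of "-1"]] fourier_L2_cmult[OF g, of "-1"]
  by eventually_elim simp

lemma fourier_L2_sum:
  assumes "finite I" "\<And>i. i \<in> I \<Longrightarrow> f i \<in> L2"
  shows "AE t in lborel. fourier_L2 (\<lambda>x. \<Sum>i\<in>I. c i * f i x) t = (\<Sum>i\<in>I. c i * fourier_L2 (f i) t)"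
  using assms
proof (induction I rule: finite_induct)
  case empty
  show ?case using fourier_L2_cmult[of "\<lambda>_. 0" 0] by (simp add: L2_def)
next
  case (insert i I)
  have "AE t in lborel. fourier_L2 (\<lambda>x. c i * f i x + (\<Sum>i\<in>I. c i * f i x)) t =
      fourier_L2 (\<lambda>x. c i * f i x) t + fourier_L2 (\<lambda>x. \<Sum>i\<in>I. c i * f i x) t"
    using insert.prems by (intro fourier_L2_add L2_cmult L2_sum) auto
  moreover have "AE t in lborel. fourier_L2 (\<lambda>x. c i * f i x) t = c i * fourier_L2 (f i) t"
    using insert.prems by (intro fourier_L2_cmult) auto
  moreover have "AE t in lborel. fourier_L2 (\<lambda>x. \<Sum>i\<in>I. c i * f i x) t = (\<Sum>i\<in>I. c i * fourier_L2 (f i) t)"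
    using insert by auto
  ultimately show ?case by eventually_elim (use insert.hyps in simp)
qed

lemma fourier_L2_cong_AE:
  assumes "f \<in> borel_measurable borel" "g \<in> borel_measurable borel" "AE x in lborel. f x = g x"
  shows "fourier_L2 f = fourier_L2 g"
proof -
  have "fourier_L1 (\<lambda>x. indicator {- real n..real n} x * f x) =
      fourier_L1 (\<lambda>x. indicator {- real n..real n} x * g x)" for n
    by (rule fourier_L1_cong_AE) (use assms in \<open>auto elim: eventually_mono\<close>)
  then show ?thesis by (simp add: fourier_L2_def is_fourier_L2_def)
qed

lemma fourier_L2_multiplication:
  assumes f: "f \<in> L2" and g: "g \<in> L2"
  shows "(LINT t|lborel. fourier_L2 f t * g t) = (LINT x|lborel. f x * fourier_L2 g x)"
proof -
  have 1: "(LINT t|lborel. fourier_L2 f t * trunc m g t) = (LINT x|lborel. f x * fourier_L1 (trunc m g) x)" for m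
  proof (rule LIMSEQ_unique)
    show "(\<lambda>n. LINT t|lborel. fourier_L1 (trunc n f) t * trunc m g t) \<longlonglongrightarrow> (LINT t|lborel. fourier_L2 f t * trunc m g t)"
      using f g by (intro L2_tendsto_pairing fourier_L2_tendsto) auto
    have "(\<lambda>n. LINT x|lborel. trunc n f x * fourier_L1 (trunc m g) x) \<longlonglongrightarrow> (LINT x|lborel. f x * fourier_L1 (trunc m g) x)"
      using f g by (intro L2_tendsto_pairing trunc_tendsto) auto
    then show "(\<lambda>n. LINT t|lborel. fourier_L1 (trunc n f) t * trunc m g t) \<longlonglongrightarrow> (LINT x|lborel. f x * fourier_L1 (trunc m g) x)"
      using f g by (simp add: fourier_L1_multiplication trunc_integrable)
  qed
  show ?thesis
  proof (rule LIMSEQ_unique)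
    have "(\<lambda>m. LINT t|lborel. trunc m g t * fourier_L2 f t) \<longlonglongrightarrow> (LINT t|lborel. g t * fourier_L2 f t)"
      using f g by (intro L2_tendsto_pairing trunc_tendsto) auto
    then show "(\<lambda>m. LINT t|lborel. fourier_L2 f t * trunc m g t) \<longlonglongrightarrow> (LINT t|lborel. fourier_L2 f t * g t)"
      by (simp only: mult.commute[of "fourier_L2 f _"])
    have "(\<lambda>m. LINT x|lborel. fourier_L1 (trunc m g) x * f x) \<longlonglongrightarrow> (LINT x|lborel. fourier_L2 g x * f x)"
      using f g by (intro L2_tendsto_pairing fourier_L2_tendsto) auto
    then show "(\<lambda>m. LINT t|lborel. fourier_L2 f t * trunc m g t) \<longlonglongrightarrow> (LINT x|lborel. f x * fourier_L2 g x)"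
      by (simp only: 1 mult.commute[of "f _"])
  qed
qed

lemma fourier_L2_Parseval_interval:
  assumes f: "f \<in> L2"
  shows "(LINT t|lborel. fourier_L2 f t * cnj (fourier_L1 (indicator {a..b}) t)) =
    2 * of_real pi * (LINT x|lborel. indicator {a..b} x * f x)"
proof (rule LIMSEQ_unique)
  have L: "(\<lambda>t. cnj (fourier_L1 (indicator {a..b}) t)) \<in> L2"
    by (intro L2_cnj fourier_L1_Bessel) auto
  show "(\<lambda>n. LINT t|lborel. fourier_L1 (trunc n f) t * cnj (fourier_L1 (indicator {a..b}) t)) \<longlonglongrightarrow>
      (LINT t|lborel. fourier_L2 f t * cnj (fourier_L1 (indicator {a..b}) t))"
    using f L by (intro L2_tendsto_pairing fourier_L2_tendsto) auto
  have "(\<lambda>n. LINT x|lborel. trunc n f x * indicator {a..b} x) \<longlonglongrightarrow> (LINT x|lborel. f x * indicator {a..b} x)"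
    using f by (intro L2_tendsto_pairing trunc_tendsto) auto
  then have "(\<lambda>n. 2 * of_real pi * (LINT x|lborel. indicator {a..b} x * trunc n f x)) \<longlonglongrightarrow>
      2 * of_real pi * (LINT x|lborel. indicator {a..b} x * f x)"
    by (intro tendsto_mult tendsto_const) (simp only: mult.commute[of "indicator {a..b} _"])
  then show "(\<lambda>n. LINT t|lborel. fourier_L1 (trunc n f) t * cnj (fourier_L1 (indicator {a..b}) t)) \<longlonglongrightarrow>
      2 * of_real pi * (LINT x|lborel. indicator {a..b} x * f x)"
    using f by (simp add: fourier_L1_Parseval_interval trunc_integrable trunc_L2)
qed

text \<open>
  The inverse transform, with the sign change in the exponent expressed by two conjugations. In this
  form it is visibly the adjoint of the transform up to the factor \<open>2\<pi>\<close>, and a statement about one of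
  the two maps becomes a statement about the other by conjugation.
\<close>

definition fourier_inv :: "(real \<Rightarrow> complex) \<Rightarrow> real \<Rightarrow> complex" where
  "fourier_inv h x = inverse (2 * of_real pi) * cnj (fourier_L2 (\<lambda>t. cnj (h t)) x)"

lemma fourier_inv_L2 [intro]:
  assumes "h \<in> L2" shows "fourier_inv h \<in> L2"
proof -
  have "(\<lambda>x. inverse (2 * of_real pi) * cnj (fourier_L2 (\<lambda>t. cnj (h t)) x)) \<in> L2"
    using assms by (intro L2_cmult L2_cnj fourier_L2_L2)
  then show ?thesis by (simp only: fourier_inv_def[abs_def])
qed

text \<open>
  By the multiplication formula, integrating the left-hand side over an interval amounts to pairing
  \<open>F f\<close> with the transform of the indicator of the interval, which Parseval's formula evaluates.
\<close>

lemma fourier_inv_fourier_L2: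
  assumes f: "f \<in> L2"
  shows "AE x in lborel. fourier_inv (fourier_L2 f) x = f x"
proof -
  define c where "c = (\<lambda>t. cnj (fourier_L2 f t))"
  have cL: "c \<in> L2" unfolding c_def using f by (intro L2_cnj fourier_L2_L2)
  have "AE x in lborel. fourier_inv (fourier_L2 f) x - f x = 0"
  proof (rule L2_eq_0_AE_if_intervals)
    show "(\<lambda>x. fourier_inv (fourier_L2 f) x - f x) \<in> L2"
      using f by (intro L2_diff fourier_inv_L2 fourier_L2_L2)
    fix a b :: real
    let ?I = "indicator {a..b} :: real \<Rightarrow> complex"
    have iI: "integrable lborel (\<lambda>x. ?I x * g x)" if "g \<in> L2" for g
      by (rule L2_mult_integrable[OF indicator_Icc_L2 that])
    have "(LINT x|lborel. ?I x * fourier_inv (fourier_L2 f) x) =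
        (LINT x|lborel. inverse (2 * of_real pi) * cnj (fourier_L2 c x * ?I x))"
      by (intro Bochner_Integration.integral_cong)
         (auto simp: fourier_inv_def c_def indicator_def)
    also have "\<dots> = inverse (2 * of_real pi) * cnj (LINT x|lborel. fourier_L2 c x * ?I x)"
      by (simp only: integral_mult_right_zero Bochner_Integration.integral_cnj)
    also have "(LINT x|lborel. fourier_L2 c x * ?I x) = (LINT x|lborel. c x * fourier_L2 ?I x)"
      by (rule fourier_L2_multiplication[OF cL]) simp
    also have "\<dots> = (LINT x|lborel. c x * fourier_L1 ?I x)"
    proof (rule integral_cong_AE)
      have "fourier_L1 ?I \<in> L2" by (intro fourier_L1_Bessel) auto
      then have [measurable]: "fourier_L1 ?I \<in> borel_measurable borel" "fourier_L2 ?I \<in> borel_measurable borel" "c \<in> borel_measurable borel"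
        using cL by (auto intro!: L2_measurable)
      show "(\<lambda>x. c x * fourier_L2 ?I x) \<in> borel_measurable lborel" "(\<lambda>x. c x * fourier_L1 ?I x) \<in> borel_measurable lborel"
        by measurable
      show "AE x in lborel. c x * fourier_L2 ?I x = c x * fourier_L1 ?I x"
        using fourier_L2_eq_L1[of ?I] by simp (auto elim!: eventually_mono)
    qed
    also have "cnj (LINT x|lborel. c x * fourier_L1 ?I x) = (LINT x|lborel. fourier_L2 f x * cnj (fourier_L1 ?I x))"
      unfolding Bochner_Integration.integral_cnj[symmetric] by (simp add: c_def)
    also have "\<dots> = 2 * of_real pi * (LINT x|lborel. ?I x * f x)"
      by (rule fourier_L2_Parseval_interval[OF f])
    finally have "(LINT x|lborel. ?I x * fourier_inv (fourier_L2 f) x) = (LINT x|lborel. ?I x * f x)"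
      by simp
    then show "(LINT x|lborel. ?I x * (fourier_inv (fourier_L2 f) x - f x)) = 0"
      using f by (simp add: right_diff_distrib Bochner_Integration.integral_diff iI fourier_inv_L2 fourier_L2_L2)
  qed
  then show ?thesis by simp
qed

text \<open>
  Conjugating the previous lemma by complex conjugation exchanges the two maps. So the left inverse
  is also a right inverse, which makes the transform surjective on \<open>L\<^sup>2\<close>.
\<close>

lemma fourier_L2_fourier_inv:
  assumes h: "h \<in> L2"
  shows "AE t in lborel. fourier_L2 (fourier_inv h) t = h t"
proof -
  define k where "k = fourier_L2 (\<lambda>t. cnj (h t))"
  have kL: "k \<in> L2" unfolding k_def by (intro fourier_L2_L2 L2_cnj h)
  have eq: "(\<lambda>x. inverse (2 * of_real pi) * cnj (k x)) = fourier_inv h"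
    by (simp only: fourier_inv_def[abs_def] k_def)
  have 1: "AE t in lborel. fourier_L2 (fourier_inv h) t = inverse (2 * of_real pi) * fourier_L2 (\<lambda>x. cnj (k x)) t"
    unfolding eq[symmetric] by (intro fourier_L2_cmult L2_cnj kL)
  have 2: "AE t in lborel. fourier_inv k t = cnj (h t)"
    unfolding k_def by (rule fourier_inv_fourier_L2[OF L2_cnj[OF h]])
  from 1 2 show ?thesis
  proof eventually_elim
    case (elim t)
    have "inverse (2 * of_real pi) * fourier_L2 (\<lambda>x. cnj (k x)) t = cnj (fourier_inv k t)"
      by (simp add: fourier_inv_def)
    then show ?case using elim by simp
  qed
qed

theorem Plancherel:
  assumes f: "f \<in> L2" and g: "g \<in> L2"
  shows "(LINT t|lborel. fourier_L2 f t * cnj (fourier_L2 g t)) = 2 * of_real pi * (LINT x|lborel. f x * cnj (g x))"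
proof -
  have c: "(\<lambda>t. cnj (fourier_L2 g t)) \<in> L2" using g by (intro L2_cnj fourier_L2_L2)
  have "(LINT t|lborel. fourier_L2 f t * cnj (fourier_L2 g t)) = (LINT x|lborel. f x * fourier_L2 (\<lambda>t. cnj (fourier_L2 g t)) x)"
    by (rule fourier_L2_multiplication[OF f c])
  also have "\<dots> = (LINT x|lborel. 2 * of_real pi * (f x * cnj (g x)))"
  proof (rule integral_cong_AE)
    note [measurable] = L2_measurable[OF f] L2_measurable[OF L2_cnj[OF g]] L2_measurable[OF fourier_L2_L2[OF c]]
    show "(\<lambda>x. f x * fourier_L2 (\<lambda>t. cnj (fourier_L2 g t)) x) \<in> borel_measurable lborel"
      "(\<lambda>x. 2 * of_real pi * (f x * cnj (g x))) \<in> borel_measurable lborel" by measurable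
    show "AE x in lborel. f x * fourier_L2 (\<lambda>t. cnj (fourier_L2 g t)) x = 2 * of_real pi * (f x * cnj (g x))"
      using fourier_inv_fourier_L2[OF g]
    proof eventually_elim
      case (elim x)
      have "fourier_L2 (\<lambda>t. cnj (fourier_L2 g t)) x = 2 * of_real pi * cnj (fourier_inv (fourier_L2 g) x)"
        by (simp add: fourier_inv_def)
      then show ?case using elim by simp
    qed
  qed
  also have "\<dots> = 2 * of_real pi * (LINT x|lborel. f x * cnj (g x))"
    by (rule integral_mult_right_zero)
  finally show ?thesis .
qed

corollary sq_norm_fourier_L2:
  assumes "f \<in> L2" shows "sq_norm (fourier_L2 f) = 2 * pi * sq_norm f"
proof -
  have "complex_of_real (sq_norm (fourier_L2 f)) = complex_of_real (2 * pi * sq_norm f)"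
    unfolding of_real_mult of_real_sq_norm Plancherel[OF assms assms] by simp
  then show ?thesis by (simp only: of_real_eq_iff)
qed

lemma fourier_L2_inj:
  assumes f: "f \<in> L2" and g: "g \<in> L2" and "AE t in lborel. fourier_L2 f t = fourier_L2 g t"
  shows "AE x in lborel. f x = g x"
proof -
  have "fourier_L2 (\<lambda>t. cnj (fourier_L2 f t)) = fourier_L2 (\<lambda>t. cnj (fourier_L2 g t))"
    using f g assms(3) by (intro fourier_L2_cong_AE L2_measurable L2_cnj) (auto elim: eventually_mono)
  then have "fourier_inv (fourier_L2 f) = fourier_inv (fourier_L2 g)"
    by (simp only: fourier_inv_def[abs_def])
  with fourier_inv_fourier_L2[OF f] fourier_inv_fourier_L2[OF g]
  show ?thesis by (auto elim: eventually_elim2)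
qed

lemma fourier_inv_eq_L1:
  assumes "h \<in> L2" "integrable lborel h"
  shows "AE x in lborel. fourier_inv h x = fourier_L1 h (- x) / (2 * of_real pi)"
proof -
  have "AE x in lborel. fourier_L2 (\<lambda>t. cnj (h t)) x = fourier_L1 (\<lambda>t. cnj (h t)) x"
    using assms by (intro fourier_L2_eq_L1 L2_cnj) auto
  moreover have "cnj (fourier_L1 (\<lambda>t. cnj (h t)) x) = fourier_L1 h (- x)" for x
    unfolding fourier_L1_def Bochner_Integration.integral_cnj[symmetric] by (simp add: exp_cnj)
  ultimately show ?thesis
    by (simp only: fourier_inv_def divide_inverse) (auto elim!: eventually_mono)
qed

section \<open>A test function\<close>

text \<open>
  These functions are smooth with support in \<open>[-1, 1]\<close>. The polynomial and the power of \<open>1 - x\<^sup>2\<close> make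
  the family closed under differentiation; the usual bump function is \<open>bump 1 0\<close>.
\<close>

definition bump :: "real poly \<Rightarrow> nat \<Rightarrow> real \<Rightarrow> real" where
  "bump p k x = (if \<bar>x\<bar> < 1 then poly p x / (1 - x\<^sup>2) ^ k * exp (- 1 / (1 - x\<^sup>2)) else 0)"

lemma power_le_fact_exp:
  assumes "0 \<le> (s::real)" shows "s ^ m \<le> fact m * exp s"
proof -
  have "(\<Sum>n\<in>{m}. s ^ n /\<^sub>R fact n) \<le> (\<Sum>n. s ^ n /\<^sub>R fact n)"
    using assms by (intro sum_le_suminf summable_exp_generic) auto
  then have "s ^ m / fact m \<le> exp s" by (simp add: exp_def divide_inverse mult.commute)
  then show ?thesis by (simp add: field_simps)
qed

text \<open>
  The exponential beats every power of \<open>1 - y\<^sup>2\<close>, so the function vanishes to second order at \<open>1\<close> and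
  \<open>-1\<close>; which makes it differentiable there with derivative zero.
\<close>

lemma bump_near_boundary:
  obtains K where "\<And>x y. \<bar>x\<bar> = 1 \<Longrightarrow> \<bar>bump p k y\<bar> \<le> K * (y - x)\<^sup>2"
proof -
  have "bounded (poly p ` {-1..1})"
    by (intro compact_imp_bounded compact_continuous_image continuous_intros compact_Icc)
  then obtain B where B: "B > 0" "\<And>y. \<bar>y\<bar> \<le> 1 \<Longrightarrow> \<bar>poly p y\<bar> \<le> B"
    unfolding bounded_pos by (auto simp: abs_le_iff)
  have "\<bar>bump p k y\<bar> \<le> (B * fact (k + 2) * 4) * (y - x)\<^sup>2" if x: "\<bar>x\<bar> = 1" for x y
  proof (cases "\<bar>y\<bar> < 1")
    case True
    define s where "s = 1 / (1 - y\<^sup>2)"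
    have y1: "y\<^sup>2 < 1" using True by (simp add: abs_square_less_1)
    then have s: "s > 0" by (simp add: s_def)
    have "s ^ k * exp (- s) \<le> fact (k + 2) * (1 / s)\<^sup>2"
    proof -
      have "s ^ (k + 2) * exp (- s) \<le> fact (k + 2)"
        using power_le_fact_exp[of s "k + 2"] s by (simp add: exp_minus field_simps del: fact_Suc)
      then show ?thesis using s by (simp add: field_simps power_add power2_eq_square del: fact_Suc)
    qed
    then have 1: "s ^ k * exp (- s) \<le> fact (k + 2) * (1 - y\<^sup>2)\<^sup>2"
      by (simp add: s_def del: fact_Suc)
    have "\<bar>1 - y\<^sup>2\<bar> = \<bar>x - y\<bar> * \<bar>x + y\<bar>"
    proof -
      have "x\<^sup>2 = 1" using x by (simp add: abs_square_eq_1)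
      then have "1 - y\<^sup>2 = (x - y) * (x + y)" by (simp add: algebra_simps power2_eq_square)
      then show ?thesis by (simp add: abs_mult)
    qed
    also have "\<dots> \<le> \<bar>x - y\<bar> * 2" using True x by (intro mult_left_mono) auto
    also have "\<dots> = \<bar>2 * (y - x)\<bar>" unfolding abs_mult by (simp add: abs_minus_commute)
    finally have "(1 - y\<^sup>2)\<^sup>2 \<le> (2 * (y - x))\<^sup>2"
      by (rule abs_le_square_iff[THEN iffD1])
    then have 2: "(1 - y\<^sup>2)\<^sup>2 \<le> 4 * (y - x)\<^sup>2" by (simp only: power_mult_distrib) simp
    have "\<bar>bump p k y\<bar> = \<bar>poly p y\<bar> * (s ^ k * exp (- s))"
      using True s y1 by (simp add: bump_def s_def abs_mult power_divide)
    also have "\<dots> \<le> B * (fact (k + 2) * (1 - y\<^sup>2)\<^sup>2)"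
      by (rule mult_mono[OF B(2) 1]) (use B True s in auto)
    also have "\<dots> \<le> B * (fact (k + 2) * (4 * (y - x)\<^sup>2))"
      using 2 B by (intro mult_left_mono) auto
    finally show ?thesis by (simp add: mult_ac del: fact_Suc)
  qed (use B in \<open>simp add: bump_def\<close>)
  then show ?thesis by (rule that)
qed

lemma bump_has_derivative:
  "(bump p k has_real_derivative
     bump (pderiv p * [:1, 0, -1:]\<^sup>2 + smult (2 * real k) ([:0, 1:] * p * [:1, 0, -1:]) - smult 2 ([:0, 1:] * p)) (k + 2) x) (at x)"
  (is "(_ has_real_derivative bump ?q _ x) _")
proof -
  consider "\<bar>x\<bar> < 1" | "\<bar>x\<bar> > 1" | "\<bar>x\<bar> = 1" by linarith
  then show ?thesis
  proof cases
    case 1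
    define d where "d = 1 - x\<^sup>2"
    have d: "d > 0" using 1 by (simp add: d_def abs_square_less_1)
    have "((\<lambda>x. poly p x / (1 - x\<^sup>2) ^ k * exp (- 1 / (1 - x\<^sup>2))) has_real_derivative
        ((poly (pderiv p) x * d ^ k - poly p x * (real k * d ^ (k - 1) * (- 2 * x))) / (d ^ k * d ^ k)) * exp (- 1 / d)
        + poly p x / d ^ k * (exp (- 1 / d) * (- 2 * x / (d * d)))) (at x)"
    proof -
      have "((\<lambda>x. poly p x / (1 - x\<^sup>2) ^ k) has_real_derivative
          (poly (pderiv p) x * d ^ k - poly p x * (real k * d ^ (k - 1) * (- 2 * x))) / (d ^ k * d ^ k)) (at x)"
        using d unfolding d_def
        by (auto intro!: derivative_eq_intros)
      moreover have "((\<lambda>x. exp (- 1 / (1 - x\<^sup>2))) has_real_derivative exp (- 1 / d) * (- 2 * x / (d * d))) (at x)"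
        using d unfolding d_def
        by (auto intro!: derivative_eq_intros)
      ultimately show ?thesis by (rule DERIV_cong[OF DERIV_mult]) (simp add: d_def mult_ac)
    qed
    moreover have "((poly (pderiv p) x * d ^ k - poly p x * (real k * d ^ (k - 1) * (- 2 * x))) / (d ^ k * d ^ k)) * exp (- 1 / d)
        + poly p x / d ^ k * (exp (- 1 / d) * (- 2 * x / (d * d))) = bump ?q (k + 2) x"
    proof -
      have "bump ?q (k + 2) x = poly ?q x / d ^ (k + 2) * exp (- 1 / d)"
        using 1 by (simp add: bump_def d_def)
      moreover have "poly ?q x = poly (pderiv p) x * d\<^sup>2 + 2 * real k * (x * poly p x * d) - 2 * (x * poly p x)"
        by (simp add: d_def power2_eq_square algebra_simps)
      moreover have "(poly (pderiv p) x * d ^ k - poly p x * (real k * d ^ (k - 1) * (- 2 * x))) / (d ^ k * d ^ k)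
          + poly p x / d ^ k * (- 2 * x / (d * d)) =
          (poly (pderiv p) x * d\<^sup>2 + 2 * real k * (x * poly p x * d) - 2 * (x * poly p x)) / d ^ (k + 2)"
      proof (cases "k = 0")
        case True
        then show ?thesis using d by (simp add: field_simps power2_eq_square)
      next
        case False
        then obtain j where "k = Suc j" by (cases k) auto
        then show ?thesis using d by (simp add: field_simps power2_eq_square)
      qed
      moreover have "a * e + c * (e * b) = (a + c * b) * e" for a b c e :: real
        by (simp add: algebra_simps)
      ultimately show ?thesis by (simp only:)
    qed
    ultimately have D: "((\<lambda>x. poly p x / (1 - x\<^sup>2) ^ k * exp (- 1 / (1 - x\<^sup>2))) has_real_derivative bump ?q (k + 2) x) (at x)"
      by simp
    show ?thesis
      by (rule has_field_derivative_transform_within_open[OF D, of "{-1<..<1}"]) (use 1 in \<open>auto simp: bump_def\<close>)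
  next
    case 2
    have "open {y::real. \<bar>y\<bar> > 1}" by (intro open_Collect_less continuous_intros)
    then have "(bump p k has_real_derivative 0) (at x)"
      by (intro has_field_derivative_transform_within_open[OF DERIV_const[of 0], of "{y. \<bar>y\<bar> > 1}"])
         (use 2 in \<open>auto simp: bump_def\<close>)
    then show ?thesis using 2 by (simp add: bump_def)
  next
    case 3
    obtain K where K: "\<And>x y. \<bar>x\<bar> = 1 \<Longrightarrow> \<bar>bump p k y\<bar> \<le> K * (y - x)\<^sup>2"
      using bump_near_boundary[of p k] by blast
    have z: "bump r j x = 0" for r j using 3 by (simp add: bump_def)
    have "((\<lambda>h. (bump p k (x + h) - bump p k x) / h) \<longlongrightarrow> 0) (at 0)"
    proof (rule Lim_null_comparison)
      show "\<forall>\<^sub>F h in at 0. norm ((bump p k (x + h) - bump p k x) / h) \<le> \<bar>K\<bar> * \<bar>h\<bar>"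
      proof (rule always_eventually, rule allI)
        fix h
        have "\<bar>bump p k (x + h)\<bar> \<le> K * h\<^sup>2" using K[OF 3, of "x + h"] by simp
        also have "\<dots> \<le> \<bar>K\<bar> * h\<^sup>2" by (intro mult_right_mono) auto
        also have "h\<^sup>2 = \<bar>h\<bar> * \<bar>h\<bar>" by (simp add: power2_eq_square)
        finally show "norm ((bump p k (x + h) - bump p k x) / h) \<le> \<bar>K\<bar> * \<bar>h\<bar>"
          by (cases "h = 0") (auto simp: z divide_le_eq mult.assoc)
      qed
      show "((\<lambda>h. \<bar>K\<bar> * \<bar>h\<bar>) \<longlongrightarrow> 0) (at 0)"
        by (auto intro!: tendsto_eq_intros)
    qed
    then show ?thesis by (simp add: z DERIV_def)
  qed
qed

lemma higher_deriv_bump: "\<exists>q j. (deriv ^^ n) (bump p k) = bump q j"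
proof (induction n)
  case (Suc n)
  then obtain q j where "(deriv ^^ n) (bump p k) = bump q j" by blast
  then have "(deriv ^^ Suc n) (bump p k) = deriv (bump q j)" by simp
  also have "deriv (bump q j) = bump (pderiv q * [:1, 0, -1:]\<^sup>2 + smult (2 * real j) ([:0, 1:] * q * [:1, 0, -1:]) - smult 2 ([:0, 1:] * q)) (j + 2)"
    using DERIV_imp_deriv[OF bump_has_derivative] by blast
  finally show ?case by blast
qed auto

lemma test_function_affine:
  assumes f: "test_function f" and a: "a \<noteq> 0"
  shows "test_function (\<lambda>x. f (a * x + c))"
proof -
  have d: "(deriv ^^ n) f differentiable at x" for n x using f by (simp add: test_function_def)
  have D: "((deriv ^^ n) f has_real_derivative (deriv ^^ Suc n) f x) (at x)" for n x
    using d[of n x] by (auto simp: DERIV_deriv_iff_real_differentiable)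
  have D': "((\<lambda>x. a ^ n * (deriv ^^ n) f (a * x + c)) has_real_derivative a ^ Suc n * (deriv ^^ Suc n) f (a * x + c)) (at x)" for n x
  proof -
    have "((\<lambda>x. (deriv ^^ n) f (a * x + c)) has_real_derivative (deriv ^^ Suc n) f (a * x + c) * a) (at x)"
      by (rule DERIV_chain2[OF D]) (auto intro!: derivative_eq_intros)
    from DERIV_cmult[OF this, of "a ^ n"] show ?thesis by (simp add: mult_ac)
  qed
  have eq: "(deriv ^^ n) (\<lambda>x. f (a * x + c)) = (\<lambda>x. a ^ n * (deriv ^^ n) f (a * x + c))" for n
  proof (induction n)
    case (Suc n)
    then have "(deriv ^^ Suc n) (\<lambda>x. f (a * x + c)) = deriv (\<lambda>x. a ^ n * (deriv ^^ n) f (a * x + c))" by simp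
    also have "\<dots> = (\<lambda>x. a ^ Suc n * (deriv ^^ Suc n) f (a * x + c))"
      using DERIV_imp_deriv[OF D'] by blast
    finally show ?case .
  qed simp
  have "bounded {x. f (a * x + c) \<noteq> 0}"
  proof -
    have "bounded {x. f x \<noteq> 0}" using f by (simp add: test_function_def)
    then obtain B where B: "\<And>x. f x \<noteq> 0 \<Longrightarrow> \<bar>x\<bar> \<le> B" unfolding bounded_iff by auto
    have "\<bar>x\<bar> \<le> (B + \<bar>c\<bar>) / \<bar>a\<bar>" if "f (a * x + c) \<noteq> 0" for x
    proof -
      have "\<bar>a\<bar> * \<bar>x\<bar> = \<bar>(a * x + c) - c\<bar>" by (simp add: abs_mult)
      also have "\<dots> \<le> \<bar>a * x + c\<bar> + \<bar>c\<bar>" by (rule abs_triangle_ineq4)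
      also have "\<dots> \<le> B + \<bar>c\<bar>" using B[OF that] by simp
      finally show ?thesis using a by (simp add: field_simps)
    qed
    then show ?thesis unfolding bounded_iff by auto
  qed
  moreover have "(deriv ^^ n) (\<lambda>x. f (a * x + c)) differentiable at x" for n x
    using D'[of n x] unfolding eq by (auto simp: real_differentiable_def)
  ultimately show ?thesis by (simp add: test_function_def)
qed

lemma test_function_bump: "test_function (bump p k)"
proof -
  have "(deriv ^^ n) (bump p k) differentiable at x" for n x
  proof -
    obtain q j where "(deriv ^^ n) (bump p k) = bump q j" using higher_deriv_bump by blast
    then show ?thesis using bump_has_derivative[of q j x] by (auto simp: real_differentiable_def)
  qed
  moreover have "bounded {x. bump p k x \<noteq> 0}"
    by (rule bounded_subset[of "{-1..1}"]) (auto simp: bump_def split: if_splits)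
  ultimately show ?thesis by (simp add: test_function_def)
qed

section \<open>Weak derivatives and the Fourier transform\<close>

lemma test_function_derivative:
  assumes "test_function f"
  shows "(f has_real_derivative deriv f x) (at x)" "isCont (deriv f) x"
proof -
  have d: "(deriv ^^ n) f differentiable at x" for n using assms by (simp add: test_function_def)
  show "(f has_real_derivative deriv f x) (at x)"
    using d[of 0] by (simp add: DERIV_deriv_iff_real_differentiable)
  show "isCont (deriv f) x"
    using d[of 1] by (simp add: differentiable_imp_continuous_within)
qed

lemma test_function_support:
  assumes "test_function f"
  obtains M where "\<And>x. x \<notin> {-M<..<M} \<Longrightarrow> f x = 0" "\<And>x. x \<notin> {-M<..<M} \<Longrightarrow> deriv f x = 0"
proof -
  have "bounded {x. f x \<noteq> 0}" using assms by (simp add: test_function_def)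
  then obtain B where B: "\<And>x. f x \<noteq> 0 \<Longrightarrow> \<bar>x\<bar> \<le> B" unfolding bounded_iff by auto
  have 1: "f x = 0" if "\<bar>x\<bar> > B" for x using B[of x] that by auto
  have 2: "deriv f x = 0" if "\<bar>x\<bar> > B" for x
  proof -
    have "open {y::real. \<bar>y\<bar> > B}" by (intro open_Collect_less continuous_intros)
    then have "(f has_real_derivative 0) (at x)"
      by (intro has_field_derivative_transform_within_open[OF DERIV_const[of 0], of "{y. \<bar>y\<bar> > B}"])
         (use that 1 in auto)
    then show ?thesis by (rule DERIV_imp_deriv)
  qed
  show ?thesis by (rule that[of "B + 1"]; intro 1 2; auto)
qed

lemma compact_support_L1_L2:
  fixes h :: "real \<Rightarrow> complex"
  assumes c: "\<And>x. isCont h x" and z: "\<And>x. x \<notin> {a..b} \<Longrightarrow> h x = 0"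
  shows "integrable lborel h" "h \<in> L2"
proof -
  have c': "continuous_on S h" for S using c by (simp add: continuous_at_imp_continuous_on)
  have I: "integrable lborel k" if "continuous_on UNIV k" "\<And>x. x \<notin> {a..b} \<Longrightarrow> k x = 0" for k :: "real \<Rightarrow> 'z::{banach, second_countable_topology}"
  proof -
    have "integrable lborel (\<lambda>x. indicator {a..b} x *\<^sub>R k x)"
      using borel_integrable_atLeastAtMost'[of a b k] continuous_on_subset[OF that(1)]
      by (simp add: set_integrable_def)
    moreover have "(\<lambda>x. indicator {a..b} x *\<^sub>R k x) = k" using that(2) by (auto simp: indicator_def)
    ultimately show ?thesis by simp
  qed
  show "integrable lborel h" by (rule I[OF c' z])
  have "integrable lborel (\<lambda>x. (cmod (h x))\<^sup>2)"
    by (rule I) (use z c' in \<open>auto intro!: continuous_intros\<close>)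
  then show "h \<in> L2" using c'[of UNIV] by (simp add: L2_def borel_measurable_continuous_onI)
qed

lemma fourier_L1_deriv_test_function:
  assumes f: "test_function f"
  shows "fourier_L1 (\<lambda>x. of_real (deriv f x)) t = \<i> * of_real t * fourier_L1 (\<lambda>x. of_real (f x)) t"
proof -
  obtain M where M: "\<And>x. x \<notin> {-M<..<M} \<Longrightarrow> f x = 0" "\<And>x. x \<notin> {-M<..<M} \<Longrightarrow> deriv f x = 0"
    using test_function_support[OF f] by metis
  note D = test_function_derivative[OF f]
  have ct: "isCont f x" for x using DERIV_isCont[OF D(1)] .
  define M' where "M' = max M 0"
  have M': "x \<notin> {-M'..M'} \<Longrightarrow> f x = 0" "x \<notin> {-M'..M'} \<Longrightarrow> deriv f x = 0" "f M' = 0" "f (-M') = 0" "M' \<ge> 0" for x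
  proof -
    have out: "x \<notin> {-M<..<M}" if "x \<notin> {-M'..M'}" for x using that by (auto simp: M'_def)
    show "x \<notin> {-M'..M'} \<Longrightarrow> f x = 0" "x \<notin> {-M'..M'} \<Longrightarrow> deriv f x = 0"
      using M out by blast+
    show "f M' = 0" "f (-M') = 0" by (intro M(1); simp add: M'_def)+
    show "M' \<ge> 0" by (simp add: M'_def)
  qed
  define h where "h = (\<lambda>x. modulation t x * of_real (f x))"
  define h' where "h' = (\<lambda>x. modulation t x * (of_real (deriv f x) - \<i> * of_real t * of_real (f x)))"
  have dh: "(h has_vector_derivative h' x) (at x)" for x
  proof -
    have "((\<lambda>x. complex_of_real (f x)) has_vector_derivative of_real (deriv f x)) (at x)"
      using D(1)[of x] by (intro has_vector_derivative_of_real) (simp add: has_real_derivative_iff_has_vector_derivative)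
    moreover have "((\<lambda>x. modulation t x) has_vector_derivative (- \<i> * of_real t) * modulation t x) (at x)"
    proof -
      have "((\<lambda>z. exp (- \<i> * (z * of_real t))) has_field_derivative (- \<i> * of_real t) * exp (- \<i> * (of_real x * of_real t))) (at (of_real x))"
        by (auto intro!: derivative_eq_intros)
      from has_vector_derivative_real_field[OF this] show ?thesis by simp
    qed
    ultimately have "(h has_vector_derivative (modulation t x * of_real (deriv f x) + ((- \<i> * of_real t) * modulation t x) * of_real (f x))) (at x)"
      unfolding h_def by (rule has_vector_derivative_mult[rotated])
    then show ?thesis by (simp add: h'_def algebra_simps)
  qed
  have ch': "continuous_on {-M'..M'} h'"
    unfolding h'_def by (intro continuous_intros continuous_at_imp_continuous_on ballI ct D(2))
  have "(LINT x|lborel. indicator {-M'..M'} x *\<^sub>R h' x) = h M' - h (-M')"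
    using M'(5) ch' by (intro integral_FTC_atLeastAtMost has_vector_derivative_at_within[OF dh]) auto
  also have "\<dots> = 0" by (simp add: h_def M')
  also have "(\<lambda>x. indicator {-M'..M'} x *\<^sub>R h' x) = h'"
    using M'(1,2) by (auto simp: h'_def indicator_def)
  finally have "(LINT x|lborel. modulation t x * of_real (deriv f x) - \<i> * of_real t * (modulation t x * of_real (f x))) = 0"
    by (simp add: h'_def algebra_simps)
  moreover have "integrable lborel (\<lambda>x. modulation t x * complex_of_real (deriv f x))"
    "integrable lborel (\<lambda>x. modulation t x * complex_of_real (f x))"
    by (intro integrable_exp_mult compact_support_L1_L2[of _ "-M'" M'] continuous_intros ct D(2); simp add: M')+
  ultimately show ?thesis unfolding fourier_L1_def
    by (subst (asm) Bochner_Integration.integral_diff) auto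
qed

lemma fourier_L1_translate: "fourier_L1 (\<lambda>x. f (x - c)) t = modulation t c * fourier_L1 f t"
proof -
  have "fourier_L1 (\<lambda>x. f (x - c)) t = \<bar>1\<bar> *\<^sub>R (LINT x|lborel. exp (- \<i> * of_real ((c + 1 * x) * t)) * f ((c + 1 * x) - c))"
    unfolding fourier_L1_def by (rule lborel_integral_real_affine) simp
  also have "\<dots> = (LINT x|lborel. modulation t c * (modulation t x * f x))"
  proof -
    have "exp (- \<i> * of_real ((c + 1 * x) * t)) = modulation t c * modulation t x" for x
      unfolding mult_exp_exp by (simp add: algebra_simps)
    then show ?thesis by (simp add: mult.assoc)
  qed
  also have "\<dots> = modulation t c * fourier_L1 f t"
    unfolding fourier_L1_def by (rule integral_mult_right_zero)
  finally show ?thesis .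
qed

text \<open>
  By Plancherel's theorem, the weak derivative condition for the translates of \<open>b\<close> says that a single
  integrable function, built from the transforms of \<open>f\<close>, \<open>g\<close> and \<open>b\<close>, has a transform that vanishes
  at every point: the translation parameter is the frequency.
\<close>

lemma weak_deriv_fourier_test:
  assumes f: "f \<in> L2" and g: "g \<in> L2" and wd: "is_weak_deriv f g" and b: "test_function b"
  shows "AE t in lborel. (fourier_L2 g t - \<i> * of_real t * fourier_L2 f t) * cnj (fourier_L1 (\<lambda>x. of_real (b x)) t) = 0"
proof -
  obtain M where M: "\<And>x. x \<notin> {-M<..<M} \<Longrightarrow> b x = 0" "\<And>x. x \<notin> {-M<..<M} \<Longrightarrow> deriv b x = 0"
    using test_function_support[OF b] by metis
  note D = test_function_derivative[OF b]
  have ct: "isCont b x" for x using DERIV_isCont[OF D(1)] .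
  define B where "B = (\<lambda>x. complex_of_real (b x))"
  define B' where "B' = (\<lambda>x. complex_of_real (deriv b x))"
  have cB: "isCont B x" "isCont B' x" for x
    unfolding B_def B'_def by (intro continuous_intros ct D(2))+
  have zB: "B x = 0" "B' x = 0" if "x \<notin> {-M..M}" for x
    using that M[of x] by (auto simp: B_def B'_def)
  have B: "integrable lborel B" "B \<in> L2" "integrable lborel B'" "B' \<in> L2"
    by (rule compact_support_L1_L2[OF cB(1) zB(1)] compact_support_L1_L2[OF cB(2) zB(2)], assumption)+
  have FL: "fourier_L1 B \<in> L2" "fourier_L1 B' \<in> L2" by (intro fourier_L1_Bessel B)+
  define w where "w = (\<lambda>t. fourier_L2 g t * cnj (fourier_L1 B t) + fourier_L2 f t * cnj (fourier_L1 B' t))"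
  have i1: "integrable lborel (\<lambda>t. fourier_L2 g t * cnj (fourier_L1 B t))"
    "integrable lborel (\<lambda>t. fourier_L2 f t * cnj (fourier_L1 B' t))"
    using f g FL by (auto intro!: L2_mult_integrable L2_cnj)
  have pair: "(LINT t|lborel. modulation c t * (fourier_L2 k t * cnj (fourier_L1 C t))) =
      2 * of_real pi * (LINT x|lborel. k x * cnj (C (x - - c)))"
    if k: "k \<in> L2" and C: "integrable lborel C" "C \<in> L2" for k C c
  proof -
    have Cc: "integrable lborel (\<lambda>x. C (x - - c))" "(\<lambda>x. C (x - - c)) \<in> L2"
      using lborel_integrable_real_affine[OF C(1), of 1 c] lborel_integrable_real_affine[OF L2_integrable[OF C(2)], of 1 c]
        L2_measurable[OF C(2)]
      by (auto simp: L2_def add.commute)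
    have "(LINT t|lborel. modulation c t * (fourier_L2 k t * cnj (fourier_L1 C t))) =
        (LINT t|lborel. fourier_L2 k t * cnj (fourier_L1 (\<lambda>x. C (x - - c)) t))"
      unfolding fourier_L1_translate
      by (intro Bochner_Integration.integral_cong) (auto simp: exp_cnj mult_ac)
    also have "\<dots> = (LINT t|lborel. fourier_L2 k t * cnj (fourier_L2 (\<lambda>x. C (x - - c)) t))"
    proof (rule integral_cong_AE)
      note m = L2_measurable[OF fourier_L2_L2[OF k]] L2_measurable[OF L2_cnj[OF fourier_L1_Bessel(1)[OF Cc]]]
        L2_measurable[OF L2_cnj[OF fourier_L2_L2[OF Cc(2)]]]
      show "(\<lambda>t. fourier_L2 k t * cnj (fourier_L1 (\<lambda>x. C (x - - c)) t)) \<in> borel_measurable lborel"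
        using m by measurable
      show "(\<lambda>t. fourier_L2 k t * cnj (fourier_L2 (\<lambda>x. C (x - - c)) t)) \<in> borel_measurable lborel"
        using m by measurable
      show "AE t in lborel. fourier_L2 k t * cnj (fourier_L1 (\<lambda>x. C (x - - c)) t) = fourier_L2 k t * cnj (fourier_L2 (\<lambda>x. C (x - - c)) t)"
        using fourier_L2_eq_L1[OF Cc(2,1)] by eventually_elim simp
    qed
    also have "\<dots> = 2 * of_real pi * (LINT x|lborel. k x * cnj (C (x - - c)))"
      by (rule Plancherel[OF k Cc(2)])
    finally show ?thesis .
  qed
  have "fourier_L1 w c = 0" for c
  proof -
    have tb: "test_function (\<lambda>x. b (1 * x + c))" by (rule test_function_affine[OF b]) simp
    have db: "deriv (\<lambda>x. b (1 * x + c)) = (\<lambda>x. deriv b (x + c))"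
      by (rule ext, rule DERIV_imp_deriv, rule DERIV_cong, rule DERIV_chain2[OF D(1)]) (auto intro!: derivative_eq_intros)
    have "(LINT x|lborel. f x * cnj (B' (x - - c))) = - (LINT x|lborel. g x * cnj (B (x - - c)))"
      using wd[unfolded is_weak_deriv_def, rule_format, OF tb] unfolding db by (simp add: B_def B'_def)
    moreover have "fourier_L1 w c = (LINT t|lborel. modulation c t * (fourier_L2 g t * cnj (fourier_L1 B t))) +
       (LINT t|lborel. modulation c t * (fourier_L2 f t * cnj (fourier_L1 B' t)))"
      unfolding w_def fourier_L1_add[OF i1] by (simp only: fourier_L1_def)
    ultimately show ?thesis
      by (simp only: pair[OF g B(1,2)] pair[OF f B(3,4)]) simp
  qed
  then have "AE t in lborel. w t = 0"
    using i1 by (intro fourier_L1_eq_0_AE) (auto simp: w_def)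
  then show ?thesis
    by eventually_elim (simp add: w_def B_def B'_def fourier_L1_deriv_test_function[OF b] algebra_simps)
qed

text \<open>
  If the support of \<open>b\<close> has radius \<open>1/R\<close>, then the phases \<open>x t\<close> in the transform stay in \<open>[-1, 1]\<close>,
  where the cosine is positive. So the real part of the transform is positive.
\<close>

lemma ex_test_function_fourier_nonzero:
  assumes R: "R > 0"
  obtains b where "test_function b" "\<And>t. \<bar>t\<bar> \<le> R \<Longrightarrow> fourier_L1 (\<lambda>x. complex_of_real (b x)) t \<noteq> 0"
proof -
  define b where "b = (\<lambda>x. bump 1 0 (R * x + 0))"
  have tb: "test_function b"
    unfolding b_def using R by (intro test_function_affine test_function_bump) simp
  have b_eq: "b x = (if \<bar>R * x\<bar> < 1 then exp (- 1 / (1 - (R * x)\<^sup>2)) else 0)" for x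
    by (simp add: b_def bump_def)
  have "fourier_L1 (\<lambda>x. complex_of_real (b x)) t \<noteq> 0" if t: "\<bar>t\<bar> \<le> R" for t
  proof -
    have cos_pos: "cos 1 \<le> cos (x * t)" if "\<bar>R * x\<bar> < 1" for x
    proof -
      have "\<bar>x * t\<bar> \<le> \<bar>x\<bar> * R" using t by (simp add: abs_mult mult_left_mono)
      also have "\<dots> \<le> 1" using that R by (simp add: abs_mult mult.commute)
      finally have "cos 1 \<le> cos \<bar>x * t\<bar>"
        using pi_gt3 by (intro cos_monotone_0_pi_le) auto
      then show ?thesis by simp
    qed
    have c1: "cos (1::real) > 0" using pi_gt3 by (intro cos_gt_zero) auto
    have "isCont (\<lambda>x. complex_of_real (b x)) x" for x
      using DERIV_isCont[OF test_function_derivative(1)[OF tb]] by (intro continuous_intros)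
    moreover have "b x = 0" if "x \<notin> {-1/R..1/R}" for x
      using that R by (auto simp: b_eq abs_less_iff field_simps)
    ultimately have ib: "integrable lborel (\<lambda>x. complex_of_real (b x))"
      by (intro compact_support_L1_L2(1)[of _ "-1/R" "1/R"]) auto
    have I: "integrable lborel (\<lambda>x. Re (modulation t x * complex_of_real (b x)))"
      using integrable_exp_mult[OF ib, of t] by (rule integrable_Re)
    have "0 < cos 1 * exp (- 4 / 3) * (1 / R)" using c1 R by simp
    also have "\<dots> = (LINT x|lborel. cos 1 * exp (- 4 / 3) * indicator {-1/(2*R)..1/(2*R)} x)"
      using R by (simp add: field_simps)
    also have "\<dots> \<le> (LINT x|lborel. Re (modulation t x * complex_of_real (b x)))"
    proof (rule integral_mono[OF _ I])
      show "integrable lborel (\<lambda>x. cos 1 * exp (- 4 / 3) * indicator {-1/(2*R)..1/(2*R)} x :: real)"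
        by (intro integrable_mult_right integrable_real_indicator) (auto simp: emeasure_lborel_Icc_eq)
      fix x :: real
      have Re: "Re (modulation t x * complex_of_real (b x)) = cos (x * t) * b x"
        by (simp add: Re_exp)
      show "cos 1 * exp (- 4 / 3) * indicator {-1/(2*R)..1/(2*R)} x \<le> Re (modulation t x * complex_of_real (b x))"
      proof (cases "x \<in> {-1/(2*R)..1/(2*R)}")
        case True
        then have x: "\<bar>R * x\<bar> \<le> 1/2" using R by (auto simp: abs_le_iff field_simps)
        then have "(R * x)\<^sup>2 \<le> (1/2)\<^sup>2" by (intro abs_le_square_iff[THEN iffD1]) simp
        then have "1 - (R * x)\<^sup>2 \<ge> 3/4" by (simp add: power2_eq_square)
        then have "1 / (1 - (R * x)\<^sup>2) \<le> 4 / 3" by (simp add: field_simps)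
        then have "exp (- 4 / 3) \<le> b x" using x by (simp add: b_eq)
        then show ?thesis unfolding Re using True cos_pos[of x] x c1
          by (auto intro!: mult_mono)
      next
        case False
        then show ?thesis unfolding Re using cos_pos[of x] c1 by (auto simp: b_eq)
      qed
    qed
    also have "\<dots> = Re (fourier_L1 (\<lambda>x. complex_of_real (b x)) t)"
      unfolding fourier_L1_def using integrable_exp_mult[OF ib, of t] by (rule integral_Re)
    finally show ?thesis by auto
  qed
  with tb show ?thesis by (rule that)
qed

text \<open>
  Each test function gives the equation wherever its transform does not vanish, and the choices above
  cover every bounded interval.
\<close>

theorem fourier_L2_weak_deriv:
  assumes f: "f \<in> L2" and g: "g \<in> L2" and w: "is_weak_deriv f g"
  shows "AE t in lborel. fourier_L2 g t = \<i> * of_real t * fourier_L2 f t"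
proof -
  have "AE t in lborel. \<bar>t\<bar> \<le> real (Suc n) \<longrightarrow> fourier_L2 g t = \<i> * of_real t * fourier_L2 f t" for n
  proof -
    obtain b where b: "test_function b" "\<And>t. \<bar>t\<bar> \<le> real (Suc n) \<Longrightarrow> fourier_L1 (\<lambda>x. complex_of_real (b x)) t \<noteq> 0"
      using ex_test_function_fourier_nonzero[of "real (Suc n)"] by auto
    from weak_deriv_fourier_test[OF f g w b(1)] show ?thesis
      by eventually_elim (use b(2) in auto)
  qed
  then have "AE t in lborel. \<forall>n. \<bar>t\<bar> \<le> real (Suc n) \<longrightarrow> fourier_L2 g t = \<i> * of_real t * fourier_L2 f t"
    unfolding AE_all_countable by blast
  then show ?thesis
  proof eventually_elim
    case (elim t)
    have "\<bar>t\<bar> \<le> real (Suc (nat \<lceil>\<bar>t\<bar>\<rceil>))" by simp linarith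
    then show ?case using elim by blast
  qed
qed

section \<open>Eigenfunctions on the Fourier side\<close>

lemma sq_norm_translate:
  fixes f :: "real \<Rightarrow> complex"
  assumes "f \<in> L2"
  shows "(\<lambda>x. f (x + h)) \<in> L2" "sq_norm (\<lambda>x. f (x + h)) = sq_norm f"
proof -
  have [measurable]: "f \<in> borel_measurable borel" by (rule L2_measurable[OF assms])
  show "(\<lambda>x. f (x + h)) \<in> L2"
    using lborel_integrable_real_affine[OF L2_integrable[OF assms], of 1 h] by (simp add: L2_def add.commute)
  show "sq_norm (\<lambda>x. f (x + h)) = sq_norm f"
    using lborel_integral_real_affine[of 1 "\<lambda>x. (cmod (f x))\<^sup>2" h] by (simp add: sq_norm_def add.commute)
qed

lemma AE_eq_translate:
  fixes f g :: "real \<Rightarrow> complex"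
  assumes "f \<in> L2" "g \<in> L2" "AE x in lborel. f x = g x"
  shows "AE x in lborel. f (x + h) = g (x + h)"
proof -
  have D: "(\<lambda>x. f x - g x) \<in> L2" by (rule L2_diff[OF assms(1,2)])
  have "sq_norm (\<lambda>x. f x - g x) = 0"
    using assms(3) unfolding sq_norm_eq_0_iff[OF D] by simp
  then show ?thesis
    using sq_norm_eq_0_iff[OF sq_norm_translate(1)[OF D], of h] sq_norm_translate(2)[OF D, of h] by simp
qed

lemma L2_modulation:
  assumes "f \<in> L2" shows "(\<lambda>x. modulation h x * f x) \<in> L2"
  by (rule L2_mult_bounded[OF assms, of _ 1]) auto

lemma fourier_L2_modulate:
  assumes f: "f \<in> L2"
  shows "AE t in lborel. fourier_L2 (\<lambda>x. modulation h x * f x) t = fourier_L2 f (t + h)"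
proof (rule fourier_L2_unique[OF L2_modulation[OF f]], unfold is_fourier_L2_iff[OF L2_modulation[OF f]], intro conjI)
  show "(\<lambda>t. fourier_L2 f (t + h)) \<in> L2" using f by (intro sq_norm_translate fourier_L2_L2)
  have "trunc n (\<lambda>x. modulation h x * f x) = (\<lambda>x. modulation h x * trunc n f x)" for n
    by (auto simp: trunc_def indicator_def)
  then have "fourier_L1 (trunc n (\<lambda>x. modulation h x * f x)) t = fourier_L1 (trunc n f) (t + h)" for n t
    by (simp only: fourier_L1_modulate)
  then show "(\<lambda>n. sq_norm (\<lambda>t. fourier_L1 (trunc n (\<lambda>x. modulation h x * f x)) t - fourier_L2 f (t + h))) \<longlonglongrightarrow> 0"
    using fourier_L2_tendsto[OF f] sq_norm_translate(2)[OF L2_diff[OF fourier_trunc_L2[OF f] fourier_L2_L2[OF f]], of _ h]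
    by simp
qed

lemma integral_pairing_cong:
  assumes "f \<in> L2" "f' \<in> L2" "g \<in> L2" "g' \<in> L2"
    and "AE x in lborel. f x = f' x" "AE x in lborel. g x = g' x"
  shows "(LINT x|lborel. f x * cnj (g x)) = (LINT x|lborel. f' x * cnj (g' x))"
proof (rule integral_cong_AE)
  note m = assms(1-4)[THEN L2_measurable] assms(3,4)[THEN L2_cnj, THEN L2_measurable]
  show "(\<lambda>x. f x * cnj (g x)) \<in> borel_measurable lborel" "(\<lambda>x. f' x * cnj (g' x)) \<in> borel_measurable lborel"
    using m by measurable
  show "AE x in lborel. f x * cnj (g x) = f' x * cnj (g' x)"
    using assms(5,6) by eventually_elim simp
qed

lemma Plancherel_representatives:
  assumes f: "f \<in> L2" "AE t in lborel. fourier_L2 f t = F t" "F \<in> L2"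
    and g: "g \<in> L2" "AE t in lborel. fourier_L2 g t = G t" "G \<in> L2"
  shows "(LINT t|lborel. F t * cnj (G t)) = 2 * of_real pi * (LINT x|lborel. f x * cnj (g x))"
  using Plancherel[OF f(1) g(1)] integral_pairing_cong[OF fourier_L2_L2[OF f(1)] f(3) fourier_L2_L2[OF g(1)] g(3) f(2) g(2)]
  by simp

lemma L1_Linfty_facts:
  fixes u :: "real \<Rightarrow> real"
  assumes "u \<in> L1 \<inter> Linfty"
  shows "u \<in> borel_measurable borel" "integrable lborel u"
    "\<exists>C>0. AE x in lborel. \<bar>u x\<bar> \<le> C" "(\<lambda>x. complex_of_real (u x)) \<in> L2"
proof -
  show i: "integrable lborel u" using assms by (simp add: L1_def)
  then show [measurable]: "u \<in> borel_measurable borel" using borel_measurable_integrable by fastforce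
  obtain C where C: "AE x in lborel. \<bar>u x\<bar> \<le> C" using assms by (auto simp: Linfty_def)
  then have C': "AE x in lborel. \<bar>u x\<bar> \<le> \<bar>C\<bar> + 1" by eventually_elim linarith
  then show "\<exists>C>0. AE x in lborel. \<bar>u x\<bar> \<le> C" by (intro exI[of _ "\<bar>C\<bar> + 1"]) auto
  show "(\<lambda>x. complex_of_real (u x)) \<in> L2"
  proof (rule L2I_bound)
    show "integrable lborel (\<lambda>x. (\<bar>C\<bar> + 1) * \<bar>u x\<bar>)" using i by simp
    show "AE x in lborel. (norm (complex_of_real (u x)))\<^sup>2 \<le> (\<bar>C\<bar> + 1) * \<bar>u x\<bar>"
      using C'
    proof eventually_elim
      case (elim x)
      have "(norm (complex_of_real (u x)))\<^sup>2 = \<bar>u x\<bar> * \<bar>u x\<bar>" by (simp add: power2_eq_square)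
      also have "\<dots> \<le> (\<bar>C\<bar> + 1) * \<bar>u x\<bar>" using elim by (intro mult_right_mono) auto
      finally show ?case .
    qed
  qed simp
qed

lemma potential_mult:
  fixes u :: "real \<Rightarrow> real" and f :: "real \<Rightarrow> complex"
  assumes u: "u \<in> L1 \<inter> Linfty" and f: "f \<in> L2"
  shows "(\<lambda>x. of_real (u x) * f x) \<in> L2" "integrable lborel (\<lambda>x. of_real (u x) * f x)"
proof -
  note U = L1_Linfty_facts[OF u]
  obtain C where "AE x in lborel. \<bar>u x\<bar> \<le> C" using U(3) by blast
  then show "(\<lambda>x. of_real (u x) * f x) \<in> L2"
    using U(1) by (intro L2_mult_bounded[OF f]) auto
  show "integrable lborel (\<lambda>x. of_real (u x) * f x)"
    by (rule L2_mult_integrable[OF U(4) f])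
qed

text \<open>
  The value that the equation \<open>(t - l) F f = F (u f)\<close> on \<open>t \<ge> 0\<close> prescribes for \<open>F f\<close>. As a function
  defined everywhere, and not only up to null sets, it has a meaningful value at \<open>t = 0\<close>.
\<close>

definition eigen_symbol :: "(real \<Rightarrow> real) \<Rightarrow> real \<Rightarrow> (real \<Rightarrow> complex) \<Rightarrow> real \<Rightarrow> complex" where
  "eigen_symbol u l f t = (if 0 \<le> t then fourier_L1 (\<lambda>x. of_real (u x) * f x) t / of_real (t - l) else 0)"

definition fourier_eigenfunction :: "(real \<Rightarrow> real) \<Rightarrow> real \<Rightarrow> (real \<Rightarrow> complex) \<Rightarrow> bool" where
  "fourier_eigenfunction u l f \<longleftrightarrow> f \<in> L2 \<and> (AE t in lborel. fourier_L2 f t = eigen_symbol u l f t)"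

lemma Cauchy_proj_spec:
  assumes f: "f \<in> L2"
  shows "Cauchy_proj f \<in> L2"
    "AE t in lborel. fourier_L2 (Cauchy_proj f) t = indicator {0..} t * fourier_L2 f t"
proof -
  have c: "(\<lambda>t. indicator {0..} t * fourier_L2 f t) \<in> L2"
    using f by (intro L2_indicator_mult fourier_L2_L2) auto
  have "\<exists>h. h \<in> L2 \<and> (AE t in lborel. fourier_L2 h t = indicator {0..} t * fourier_L2 f t)"
    using fourier_inv_L2[OF c] fourier_L2_fourier_inv[OF c] by blast
  from someI_ex[OF this] show "Cauchy_proj f \<in> L2"
    "AE t in lborel. fourier_L2 (Cauchy_proj f) t = indicator {0..} t * fourier_L2 f t"
    unfolding Cauchy_proj_def by auto
qed

text \<open>
  The inner Cauchy projection in \<open>L\<^sub>u\<close> fixes \<open>f\<close>, the outer one restricts to \<open>t \<ge> 0\<close>, and the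
  derivative becomes multiplication by \<open>\<i> t\<close>. All further arguments use this form of the
  equation, which is linear in \<open>f\<close>.
\<close>

lemma L_eigenspace_imp_fourier_eigenfunction:
  assumes u: "u \<in> L1 \<inter> Linfty" and l: "l < 0" and f: "f \<in> L_eigenspace u (of_real l)"
  shows "fourier_eigenfunction u l f"
proof -
  have fL: "f \<in> L2" and f0: "AE t in lborel. t < 0 \<longrightarrow> fourier_L2 f t = 0"
    and fS: "\<exists>g. g \<in> L2 \<and> is_weak_deriv f g"
    and eq: "AE x in lborel. L_op u f x = of_real l * f x"
    using f by (auto simp: L_eigenspace_def L_dom_def Hardy_plus_def Sobolev_H1_def)
  define g where "g = weak_deriv f"
  have g: "g \<in> L2" "is_weak_deriv f g"
    using someI_ex[OF fS] unfolding g_def weak_deriv_def by auto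
  define h where "h = Cauchy_proj f"
  note h = Cauchy_proj_spec[OF fL, folded h_def]
  have "AE t in lborel. fourier_L2 h t = fourier_L2 f t"
    using h(2) f0 by eventually_elim (auto simp: indicator_def)
  then have hf: "AE x in lborel. h x = f x" by (rule fourier_L2_inj[OF h(1) fL])
  define v where "v = (\<lambda>x. of_real (u x) * h x)"
  define k where "k = Cauchy_proj v"
  have v: "v \<in> L2" unfolding v_def by (rule potential_mult[OF u h(1)])
  note k = Cauchy_proj_spec[OF v, folded k_def]
  note uf = potential_mult[OF u fL]
  have "fourier_L2 v = fourier_L2 (\<lambda>x. of_real (u x) * f x)"
    using v uf hf by (intro fourier_L2_cong_AE L2_measurable) (auto simp: v_def elim: eventually_mono)
  then have Fv: "AE t in lborel. fourier_L2 v t = fourier_L1 (\<lambda>x. of_real (u x) * f x) t"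
    using fourier_L2_eq_L1[OF uf] by simp
  define r where "r = (\<lambda>x. \<i> * (of_real l * f x + k x))"
  have r: "r \<in> L2" unfolding r_def using fL k by (intro L2_cmult L2_add)
  have "AE x in lborel. g x = r x"
    using eq
  proof eventually_elim
    case (elim x)
    then have "of_real l * f x + k x = 1 / \<i> * g x"
      by (simp add: L_op_def g_def k_def v_def h_def algebra_simps)
    then show ?case by (simp add: r_def)
  qed
  then have "fourier_L2 g = fourier_L2 r"
    using g(1) r by (intro fourier_L2_cong_AE L2_measurable)
  then have "AE t in lborel. fourier_L2 r t = \<i> * of_real t * fourier_L2 f t"
    using fourier_L2_weak_deriv[OF fL g] by simp
  moreover have "AE t in lborel. fourier_L2 r t = \<i> * fourier_L2 (\<lambda>x. of_real l * f x + k x) t"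
    unfolding r_def using fL k by (intro fourier_L2_cmult L2_add L2_cmult)
  moreover have "AE t in lborel. fourier_L2 (\<lambda>x. of_real l * f x + k x) t = fourier_L2 (\<lambda>x. of_real l * f x) t + fourier_L2 k t"
    using fL k by (intro fourier_L2_add L2_cmult)
  moreover have "AE t in lborel. fourier_L2 (\<lambda>x. of_real l * f x) t = of_real l * fourier_L2 f t"
    by (rule fourier_L2_cmult[OF fL])
  ultimately have "AE t in lborel. fourier_L2 f t = eigen_symbol u l f t"
    using f0 Fv k(2)
  proof eventually_elim
    case (elim t)
    show ?case
    proof (cases "0 \<le> t")
      case True
      have "\<i> * (of_real l * fourier_L2 f t + fourier_L2 k t) = \<i> * (of_real t * fourier_L2 f t)"
        using elim by (simp add: mult.assoc)
      then have "of_real l * fourier_L2 f t + fourier_L2 k t = of_real t * fourier_L2 f t" by simp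
      then have "of_real (t - l) * fourier_L2 f t = fourier_L2 k t" by (simp add: algebra_simps)
      moreover have "complex_of_real (t - l) \<noteq> 0" using l True by (simp del: of_real_diff)
      moreover have "fourier_L2 k t = fourier_L1 (\<lambda>x. of_real (u x) * f x) t"
        using elim True by simp
      ultimately show ?thesis using True by (simp add: eigen_symbol_def field_simps)
    qed (use elim in \<open>simp add: eigen_symbol_def\<close>)
  qed
  with fL show ?thesis by (simp add: fourier_eigenfunction_def)
qed

lemma eigen_symbol_L2:
  assumes u: "u \<in> L1 \<inter> Linfty" and f: "f \<in> L2" and l: "l < 0"
  shows "eigen_symbol u l f \<in> L2"
proof -
  note uf = potential_mult[OF u f]
  have "(\<lambda>t. (if 0 \<le> t then 1 / complex_of_real (t - l) else 0) * fourier_L1 (\<lambda>x. of_real (u x) * f x) t) \<in> L2"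
  proof (rule L2_mult_bounded[of _ _ "1 / (- l)"])
    show "fourier_L1 (\<lambda>x. of_real (u x) * f x) \<in> L2" by (rule fourier_L1_Bessel[OF uf(2,1)])
    show "AE t in lborel. cmod (if 0 \<le> t then 1 / complex_of_real (t - l) else 0) \<le> 1 / (- l)"
      using l by (intro AE_I2) (auto simp: norm_divide field_simps simp del: of_real_diff)
  qed simp
  then show ?thesis by (rule back_subst[of "\<lambda>f. f \<in> L2"]) (auto simp: eigen_symbol_def)
qed

lemma eigen_symbol_mult:
  assumes "l < 0" "0 \<le> t"
  shows "of_real (t - l) * eigen_symbol u l f t = fourier_L1 (\<lambda>x. of_real (u x) * f x) t"
proof -
  have "complex_of_real (t - l) \<noteq> 0" using assms by (simp del: of_real_diff)
  then show ?thesis using assms by (simp add: eigen_symbol_def)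
qed

section \<open>The identity for the total mass of \<open>u \<phi>\<close>\<close>

text \<open>
  Let \<open>I\<close> and \<open>J\<close> be the integrals of \<open>V(t) cnj P(t + h)\<close> and \<open>V(t + h) cnj P(t)\<close>. By Plancherel's
  theorem they are \<open>2\<pi>\<close> times the integrals of \<open>u \<bar>f\<bar>\<^sup>2\<close> against conjugate exponentials, so \<open>J = cnj I\<close>
  because \<open>u\<close> is real. For \<open>t \<ge> 0\<close> one can substitute \<open>V(t) = (t - l) P(t)\<close> and
  \<open>V(t + h) = (t + h - l) P(t + h)\<close>, and the two integrands then differ, up to conjugation, by
  \<open>h P(t) cnj P(t + h)\<close>. For \<open>t < 0\<close> the first integrand survives on the strip \<open>-h \<le> t < 0\<close>.
\<close>

lemma eigenfunction_boundary_identity: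
  assumes u: "u \<in> L1 \<inter> Linfty" and l: "l < 0" and f: "fourier_eigenfunction u l f" and h: "h > 0"
  shows "(LINT t|lborel. indicator {-h..<0} t * (fourier_L1 (\<lambda>x. of_real (u x) * f x) t * cnj (eigen_symbol u l f (t + h)))) =
    2 * of_real (pi * h) * (LINT x|lborel. f x * cnj (modulation h x * f x))"
proof -
  have fL: "f \<in> L2" and fF: "AE t in lborel. fourier_L2 f t = eigen_symbol u l f t"
    using f by (auto simp: fourier_eigenfunction_def)
  define v where "v = (\<lambda>x. complex_of_real (u x) * f x)"
  define V where "V = fourier_L1 v"
  define P where "P = eigen_symbol u l f"
  have v: "v \<in> L2" "integrable lborel v" unfolding v_def by (rule potential_mult[OF u fL])+
  have VL: "V \<in> L2" unfolding V_def by (rule fourier_L1_Bessel[OF v(2,1)])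
  have PL: "P \<in> L2" unfolding P_def by (rule eigen_symbol_L2[OF u fL l])
  have Vh: "(\<lambda>t. V (t + h)) \<in> L2" and Ph: "(\<lambda>t. P (t + h)) \<in> L2"
    by (intro sq_norm_translate VL PL)+
  have FV: "AE t in lborel. fourier_L2 v t = V t" unfolding V_def by (rule fourier_L2_eq_L1[OF v])
  have FP: "AE t in lborel. fourier_L2 f t = P t" unfolding P_def by (rule fF)
  have FVh: "AE t in lborel. fourier_L2 (\<lambda>x. modulation h x * v x) t = V (t + h)"
    using fourier_L2_modulate[OF v(1), of h] AE_eq_translate[OF fourier_L2_L2[OF v(1)] VL FV, of h]
    by eventually_elim simp
  have FPh: "AE t in lborel. fourier_L2 (\<lambda>x. modulation h x * f x) t = P (t + h)"
    using fourier_L2_modulate[OF fL, of h] AE_eq_translate[OF fourier_L2_L2[OF fL] PL FP, of h]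
    by eventually_elim simp
  define I where "I = (LINT t|lborel. V t * cnj (P (t + h)))"
  define J where "J = (LINT t|lborel. V (t + h) * cnj (P t))"
  define K where "K = (LINT t|lborel. P t * cnj (P (t + h)))"
  define I0 where "I0 = (LINT t|lborel. indicator {-h..<0} t * (V t * cnj (P (t + h))))"
  have I: "I = 2 * of_real pi * (LINT x|lborel. v x * cnj (modulation h x * f x))"
    unfolding I_def by (rule Plancherel_representatives[OF v(1) FV VL L2_modulation[OF fL] FPh Ph])
  have J: "J = 2 * of_real pi * (LINT x|lborel. modulation h x * v x * cnj (f x))"
    unfolding J_def by (rule Plancherel_representatives[OF L2_modulation[OF v(1)] FVh Vh fL FP PL])
  have K: "K = 2 * of_real pi * (LINT x|lborel. f x * cnj (modulation h x * f x))"
    unfolding K_def by (rule Plancherel_representatives[OF fL FP PL L2_modulation[OF fL] FPh Ph])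
  have "J = cnj I"
    unfolding I J by (simp add: v_def mult_ac flip: Bochner_Integration.integral_cnj)
  have pt: "V (t + h) * cnj (P t) =
      cnj ((V t * cnj (P (t + h)) - indicator {-h..<0} t * (V t * cnj (P (t + h)))) + of_real h * (P t * cnj (P (t + h))))" for t
  proof (cases "0 \<le> t")
    case True
    have 1: "V t = of_real (t - l) * P t" "V (t + h) = of_real (t + h - l) * P (t + h)"
      unfolding V_def v_def P_def using eigen_symbol_mult[OF l, of t] eigen_symbol_mult[OF l, of "t + h"] True h by auto
    show ?thesis unfolding 1 using True by (simp add: algebra_simps)
  next
    case False
    then have "P t = 0" by (simp add: P_def eigen_symbol_def)
    moreover have "P (t + h) = 0" if "t < - h" using that by (simp add: P_def eigen_symbol_def)
    ultimately show ?thesis using False by (cases "t < - h") (auto simp: indicator_def)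
  qed
  have int: "integrable lborel (\<lambda>t. V t * cnj (P (t + h)))" "integrable lborel (\<lambda>t. P t * cnj (P (t + h)))"
    by (intro L2_mult_integrable L2_cnj VL PL Ph)+
  have int0: "integrable lborel (\<lambda>t. indicator {-h..<0} t * (V t * cnj (P (t + h))))"
    using L2_mult_integrable[OF L2_indicator_mult[OF VL, of "{-h..<0}"] L2_cnj[OF Ph]] by (simp add: mult.assoc)
  have "J = cnj (LINT t|lborel. (V t * cnj (P (t + h)) - indicator {-h..<0} t * (V t * cnj (P (t + h)))) + of_real h * (P t * cnj (P (t + h))))"
    unfolding J_def pt Bochner_Integration.integral_cnj ..
  also have "\<dots> = cnj (I - I0 + of_real h * K)"
    unfolding I_def I0_def K_def using int int0 by simp
  finally have "cnj I = cnj (I - I0 + of_real h * K)" using \<open>J = cnj I\<close> by simp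
  then have "I0 = of_real h * K" by (simp only: complex_cnj_cancel_iff) simp
  then show ?thesis unfolding I0_def K V_def v_def P_def by simp
qed

text \<open>
  Divide the previous identity by \<open>h\<close> and let \<open>h\<close> tend to \<open>0\<close>. Rescaled to unit length, the strip
  contributes \<open>V(0) cnj P(0)\<close> in the limit, by continuity of \<open>V\<close>; here \<open>P(0) = V(0) / (- l)\<close> is the limit of \<open>P\<close>
  from the right, and \<open>V(0)\<close> is the integral of \<open>u f\<close>. The other side tends to \<open>2\<pi>\<close> times the squared
  norm of \<open>f\<close>.
\<close>

theorem eigenfunction_mass_identity:
  assumes u: "u \<in> L1 \<inter> Linfty" and l: "l < 0" and f: "fourier_eigenfunction u l f"
  shows "(cmod (LINT x|lborel. of_real (u x) * f x))\<^sup>2 = - 2 * pi * l * sq_norm f"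
proof -
  have fL: "f \<in> L2" using f by (simp add: fourier_eigenfunction_def)
  define v where "v = (\<lambda>x. complex_of_real (u x) * f x)"
  define V where "V = fourier_L1 v"
  define P where "P = eigen_symbol u l f"
  have v: "v \<in> L2" "integrable lborel v" unfolding v_def by (rule potential_mult[OF u fL])+
  have [measurable]: "V \<in> borel_measurable borel" unfolding V_def by (rule fourier_L1_measurable[OF v(2)])
  have [measurable]: "P \<in> borel_measurable borel"
    unfolding P_def by (rule L2_measurable[OF eigen_symbol_L2[OF u fL l]])
  have [measurable]: "(\<lambda>x. cnj (P x)) \<in> borel_measurable borel"
    by (rule borel_measurable_continuous_on[of cnj]) (auto intro: continuous_intros)
  have [measurable]: "f \<in> borel_measurable borel" by (rule L2_measurable[OF fL])
  have [measurable]: "(\<lambda>x. cnj (f x)) \<in> borel_measurable borel"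
    by (rule L2_measurable[OF L2_cnj[OF fL]])
  have Vc: "isCont V t" for t unfolding V_def by (rule fourier_L1_continuous[OF v(2)])
  define A where "A = (LINT x|lborel. cmod (v x))"
  have VA: "cmod (V t) \<le> A" for t unfolding V_def A_def by (rule cmod_fourier_L1_le[OF v(2)])
  have A0: "0 \<le> A" unfolding A_def by simp
  have P: "P t = V t / of_real (t - l)" if "0 \<le> t" for t
    using that by (simp add: P_def eigen_symbol_def V_def v_def)
  have PA: "cmod (P t) \<le> A / (- l)" if "0 \<le> t" for t
  proof -
    have "cmod (P t) = cmod (V t) / (t - l)" using that l by (simp add: P norm_divide del: of_real_diff)
    also have "\<dots> \<le> A / (- l)" using that l VA A0 by (intro frac_le) auto
    finally show ?thesis .
  qed
  define h where "h = (\<lambda>n. 1 / real (Suc n))"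
  have h0: "h n > 0" for n by (simp add: h_def)
  have hlim: "h \<longlonglongrightarrow> 0" unfolding h_def using LIMSEQ_inverse_real_of_nat by (simp add: inverse_eq_divide)
  let ?g = "\<lambda>n s. indicator {0..<1} s * (V (h n * s - h n) * cnj (P (h n * s)))"
  let ?m = "\<lambda>n x. f x * cnj (modulation (h n) x * f x)"
  define L where "L = (\<lambda>n. LINT s|lborel. ?g n s)"
  have L_eq: "L n = 2 * of_real pi * (LINT x|lborel. ?m n x)" for n
  proof -
    define C where "C = (LINT x|lborel. ?m n x)"
    have "2 * of_real (pi * h n) * C = (LINT t|lborel. indicator {-h n..<0} t * (V t * cnj (P (t + h n))))"
      unfolding C_def V_def v_def P_def by (rule eigenfunction_boundary_identity[OF u l f h0[of n], symmetric])
    also have "\<dots> =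
        \<bar>h n\<bar> *\<^sub>R (LINT s|lborel. indicator {-h n..<0} (- h n + h n * s) * (V (- h n + h n * s) * cnj (P ((- h n + h n * s) + h n))))"
      using h0[of n] by (intro lborel_integral_real_affine) simp
    also have "(\<lambda>s. indicator {-h n..<0} (- h n + h n * s) * (V (- h n + h n * s) * cnj (P ((- h n + h n * s) + h n)))) =
        (\<lambda>s. ?g n s)"
    proof
      fix s
      have "indicator {-h n..<0} (- h n + h n * s) = (indicator {0..<1} s :: complex)"
        using h0[of n] by (auto simp: indicator_def zero_le_mult_iff)
      then show "indicator {-h n..<0} (- h n + h n * s) * (V (- h n + h n * s) * cnj (P ((- h n + h n * s) + h n))) =
        ?g n s" by simp
    qed
    finally have "2 * of_real (pi * h n) * C = of_real (h n) * L n"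
      using h0[of n] by (simp add: L_def scaleR_conv_of_real)
    then have "L n = 2 * of_real pi * C" using h0[of n] by (simp add: mult.assoc)
    then show ?thesis by (simp only: C_def)
  qed
  have "L \<longlonglongrightarrow> (LINT s::real|lborel. indicator {0..<1} s * (V 0 * cnj (P 0)))"
    unfolding L_def
  proof (rule integral_dominated_convergence[where w="\<lambda>s. indicator {0..<1} s * (A * (A / (- l)))"])
    show "integrable lborel (\<lambda>s::real. indicator {0..<1} s * (A * (A / (- l))) :: real)"
      by (intro integrable_mult_left integrable_real_indicator) auto
    show "AE s in lborel. (\<lambda>n. ?g n s) \<longlonglongrightarrow> indicator {0..<1} s * (V 0 * cnj (P 0))"
    proof (rule AE_I2)
      fix s :: real
      show "(\<lambda>n. ?g n s) \<longlonglongrightarrow> indicator {0..<1} s * (V 0 * cnj (P 0))"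
      proof (cases "s \<in> {0..<1}")
        case True
        have l1: "(\<lambda>n. h n * s) \<longlonglongrightarrow> 0" by (rule tendsto_mult_left_zero[OF hlim])
        have l2: "(\<lambda>n. h n * s - h n) \<longlonglongrightarrow> 0" using tendsto_diff[OF l1 hlim] by simp
        have "(\<lambda>n. V (h n * s) / of_real (h n * s - l)) \<longlonglongrightarrow> V 0 / of_real (0 - l)"
          using l by (intro tendsto_intros isCont_tendsto_compose[OF Vc] l1) auto
        moreover have "P (h n * s) = V (h n * s) / of_real (h n * s - l)" for n
          using True h0[of n] by (intro P) auto
        ultimately have "(\<lambda>n. P (h n * s)) \<longlonglongrightarrow> P 0" using P[of 0] by simp
        then show ?thesis
          by (intro tendsto_intros isCont_tendsto_compose[OF Vc] l2)
      qed simp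
    qed
    show "AE s in lborel. norm (?g n s) \<le> indicator {0..<1} s * (A * (A / (- l)))" for n
    proof (rule AE_I2)
      fix s :: real
      show "norm (?g n s) \<le> indicator {0..<1} s * (A * (A / (- l)))"
      proof (cases "s \<in> {0..<1}")
        case True
        then have "cmod (V (h n * s - h n)) * cmod (P (h n * s)) \<le> A * (A / (- l))"
          using h0[of n] A0 by (intro mult_mono VA PA) auto
        then show ?thesis using True by (simp add: norm_mult)
      qed simp
    qed
  qed measurable
  moreover have "(LINT s::real|lborel. indicator {0..<1} s * (V 0 * cnj (P 0))) = V 0 * cnj (P 0)"
  proof -
    have "(LINT s::real|lborel. indicator {0..<1} s * (V 0 * cnj (P 0))) = (LINT s::real|lborel. indicator {0..<1} s *\<^sub>R (V 0 * cnj (P 0)))"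
      by (intro Bochner_Integration.integral_cong) (auto simp: indicator_def)
    then show ?thesis by simp
  qed
  ultimately have lim1: "L \<longlonglongrightarrow> V 0 * cnj (P 0)" by (simp only:)
  have "(\<lambda>n. LINT x|lborel. ?m n x) \<longlonglongrightarrow> (LINT x|lborel. f x * cnj (1 * f x))"
  proof (rule integral_dominated_convergence[where w="\<lambda>x. (cmod (f x))\<^sup>2"])
    show "AE x in lborel. (\<lambda>n. ?m n x) \<longlonglongrightarrow> f x * cnj (1 * f x)"
    proof (rule AE_I2)
      fix x :: real
      have "(\<lambda>n. exp (- \<i> * of_real (x * h n))) \<longlonglongrightarrow> modulation 0 x"
        by (intro tendsto_intros hlim)
      then have "(\<lambda>n. modulation (h n) x) \<longlonglongrightarrow> 1" by simp
      then show "(\<lambda>n. ?m n x) \<longlonglongrightarrow> f x * cnj (1 * f x)"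
        by (intro tendsto_intros)
    qed
  qed (use L2_integrable[OF fL] in \<open>auto simp: norm_mult power2_eq_square exp_cnj\<close>)
  then have "(\<lambda>n. 2 * of_real pi * (LINT x|lborel. ?m n x)) \<longlonglongrightarrow> 2 * of_real pi * of_real (sq_norm f)"
    by (intro tendsto_mult tendsto_const) (simp add: of_real_sq_norm)
  then have lim2: "L \<longlonglongrightarrow> 2 * of_real pi * of_real (sq_norm f)"
    by (simp only: L_eq[abs_def])
  have "V 0 * cnj (P 0) = 2 * of_real pi * of_real (sq_norm f)"
    by (rule LIMSEQ_unique[OF lim1 lim2])
  moreover have "V 0 * cnj (P 0) = of_real ((cmod (V 0))\<^sup>2 / (- l))"
    using P[of 0] l by (simp add: complex_norm_square[unfolded of_real_power])
  ultimately have "complex_of_real ((cmod (V 0))\<^sup>2 / (- l)) = of_real (2 * pi * sq_norm f)" by simp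
  then have "(cmod (V 0))\<^sup>2 / (- l) = 2 * pi * sq_norm f" by (simp only: of_real_eq_iff)
  then have "(cmod (V 0))\<^sup>2 = - 2 * pi * l * sq_norm f" using l by (simp add: field_simps)
  moreover have "V 0 = (LINT x|lborel. of_real (u x) * f x)" by (simp add: V_def v_def fourier_L1_def)
  ultimately show ?thesis by simp
qed

lemma fourier_eigenfunction_diff_cmult:
  assumes u: "u \<in> L1 \<inter> Linfty" and f: "fourier_eigenfunction u l f" and g: "fourier_eigenfunction u l g"
  shows "fourier_eigenfunction u l (\<lambda>x. f x - c * g x)"
proof -
  have fL: "f \<in> L2" and gL: "g \<in> L2" using f g by (auto simp: fourier_eigenfunction_def)
  have eq: "eigen_symbol u l (\<lambda>x. f x - c * g x) t = eigen_symbol u l f t - c * eigen_symbol u l g t" for t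
  proof -
    have "fourier_L1 (\<lambda>x. of_real (u x) * (f x - c * g x)) t =
        fourier_L1 (\<lambda>x. of_real (u x) * f x - c * (of_real (u x) * g x)) t"
      by (simp add: algebra_simps)
    also have "\<dots> = fourier_L1 (\<lambda>x. of_real (u x) * f x) t - c * fourier_L1 (\<lambda>x. of_real (u x) * g x) t"
      using potential_mult[OF u fL] potential_mult[OF u gL]
      by (subst fourier_L1_diff) (auto simp: fourier_L1_cmult)
    finally show ?thesis by (simp add: eigen_symbol_def diff_divide_distrib)
  qed
  have "AE t in lborel. fourier_L2 (\<lambda>x. f x - c * g x) t = fourier_L2 f t - fourier_L2 (\<lambda>x. c * g x) t"
    by (rule fourier_L2_diff[OF fL L2_cmult[OF gL]])
  moreover have "AE t in lborel. fourier_L2 (\<lambda>x. c * g x) t = c * fourier_L2 g t"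
    by (rule fourier_L2_cmult[OF gL])
  moreover have "AE t in lborel. fourier_L2 f t = eigen_symbol u l f t" "AE t in lborel. fourier_L2 g t = eigen_symbol u l g t"
    using f g by (auto simp: fourier_eigenfunction_def)
  ultimately have "AE t in lborel. fourier_L2 (\<lambda>x. f x - c * g x) t = eigen_symbol u l (\<lambda>x. f x - c * g x) t"
    unfolding eq by eventually_elim simp
  then show ?thesis using L2_diff[OF fL L2_cmult[OF gL]] by (simp add: fourier_eigenfunction_def)
qed

text \<open>
  Subtracting from \<open>f\<close> the multiple of \<open>g\<close> with the same total mass of \<open>u f\<close> leaves an eigenfunction of
  mass zero, hence of norm zero.
\<close>

theorem eigenspace_dim_1:
  assumes u: "u \<in> L1 \<inter> Linfty" and l: "l < 0" and ev: "L_eigenvalue u (of_real l)"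
  shows "has_dim_ae (L_eigenspace u (of_real l)) 1"
proof -
  obtain g where g: "g \<in> L_eigenspace u (of_real l)" "\<not> (AE x in lborel. g x = 0)"
    using ev by (auto simp: L_eigenvalue_def)
  have gF: "fourier_eigenfunction u l g" by (rule L_eigenspace_imp_fourier_eigenfunction[OF u l g(1)])
  then have gL: "g \<in> L2" by (simp add: fourier_eigenfunction_def)
  define m where "m = (\<lambda>f. LINT x|lborel. complex_of_real (u x) * f x)"
  have "sq_norm g \<noteq> 0" using g(2) sq_norm_eq_0_iff[OF gL] by simp
  then have m0: "m g \<noteq> 0"
    using eigenfunction_mass_identity[OF u l gF] l by (auto simp: m_def)
  have span: "AE x in lborel. f x = m f / m g * g x" if f: "f \<in> L_eigenspace u (of_real l)" for f
  proof -
    have fF: "fourier_eigenfunction u l f" by (rule L_eigenspace_imp_fourier_eigenfunction[OF u l f])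
    then have fL: "f \<in> L2" by (simp add: fourier_eigenfunction_def)
    define d where "d = (\<lambda>x. f x - m f / m g * g x)"
    have dF: "fourier_eigenfunction u l d"
      unfolding d_def by (rule fourier_eigenfunction_diff_cmult[OF u fF gF])
    then have dL: "d \<in> L2" by (simp add: fourier_eigenfunction_def)
    have "m d = (LINT x|lborel. of_real (u x) * f x - m f / m g * (of_real (u x) * g x))"
      unfolding m_def d_def by (simp add: algebra_simps)
    also have "\<dots> = m f - m f / m g * m g"
      unfolding m_def using potential_mult[OF u fL] potential_mult[OF u gL]
      by (subst Bochner_Integration.integral_diff) auto
    also have "\<dots> = 0" using m0 by simp
    finally have "- 2 * pi * l * sq_norm d = 0"
      using eigenfunction_mass_identity[OF u l dF] by (simp add: m_def)
    then have "sq_norm d = 0" using l by simp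
    then have "AE x in lborel. d x = 0" using sq_norm_eq_0_iff[OF dL] by simp
    then show ?thesis by eventually_elim (simp add: d_def)
  qed
  have s1: "{..<1::nat} = {0}" by auto
  show ?thesis
    unfolding has_dim_ae_def
  proof (intro exI[of _ "\<lambda>_. g"] conjI allI impI ballI)
    fix c :: "nat \<Rightarrow> complex" and i :: nat
    assume c: "AE x in lborel. (\<Sum>i<1. c i * g x) = 0" and i: "i < 1"
    show "c i = 0"
    proof (rule ccontr)
      assume "c i \<noteq> 0"
      with c i have "AE x in lborel. g x = 0" by simp
      with g(2) show False ..
    qed
  next
    fix f assume "f \<in> L_eigenspace u (of_real l)"
    from span[OF this] show "\<exists>c. AE x in lborel. f x = (\<Sum>i<(1::nat). c i * g x)"
      by (intro exI[of _ "\<lambda>_. m f / m g"]) (simp add: s1 del: sum_constant)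
  qed (use g in auto)
qed

section \<open>The energy of combinations of eigenfunctions\<close>

text \<open>
  Gaussian elimination: an equation with a nonzero coefficient eliminates one unknown.
\<close>

lemma homogeneous_system_nontrivial_solution:
  fixes a :: "'i \<Rightarrow> 'j \<Rightarrow> 'k::field"
  assumes "finite I" "finite J" "card I < card J"
  shows "\<exists>c. (\<exists>j\<in>J. c j \<noteq> 0) \<and> (\<forall>i\<in>I. (\<Sum>j\<in>J. c j * a i j) = 0)"
  using assms
proof (induction I arbitrary: J a rule: finite_induct)
  case empty
  then obtain j where "j \<in> J" by fastforce
  then show ?case by (intro exI[of _ "\<lambda>_. 1"]) auto
next
  case (insert i I)
  show ?case
  proof (cases "\<forall>j\<in>J. a i j = 0")
    case True
    from insert.IH[of J a] insert.prems insert.hyps obtain c where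
      "\<exists>j\<in>J. c j \<noteq> 0" "\<forall>r\<in>I. (\<Sum>j\<in>J. c j * a r j) = 0" by auto
    then show ?thesis using True by (intro exI[of _ c]) auto
  next
    case False
    then obtain j0 where j0: "j0 \<in> J" "a i j0 \<noteq> 0" by blast
    define a' where "a' = (\<lambda>r j. a r j - a r j0 * a i j / a i j0)"
    have "card I < card (J - {j0})" using insert j0 by simp
    then obtain c where c: "\<exists>j\<in>J - {j0}. c j \<noteq> 0" "\<forall>r\<in>I. (\<Sum>j\<in>J - {j0}. c j * a' r j) = 0"
      using insert.IH[of "J - {j0}" a'] insert.prems by auto
    define c0 where "c0 = - (\<Sum>j\<in>J - {j0}. c j * a i j) / a i j0"
    have split: "(\<Sum>j\<in>J. (c(j0 := c0)) j * a r j) = c0 * a r j0 + (\<Sum>j\<in>J - {j0}. c j * a r j)" for r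
      using insert.prems j0 by (subst sum.remove[of _ j0]) (auto intro!: sum.cong)
    have "(\<Sum>j\<in>J. (c(j0 := c0)) j * a r j) = 0" if "r \<in> insert i I" for r
    proof (cases "r = i")
      case True
      then show ?thesis unfolding split using j0 by (simp add: c0_def)
    next
      case False
      then have "(\<Sum>j\<in>J - {j0}. c j * a' r j) = 0" using c that by auto
      also have "(\<Sum>j\<in>J - {j0}. c j * a' r j) = (\<Sum>j\<in>J - {j0}. c j * a r j) - (a r j0 / a i j0) * (\<Sum>j\<in>J - {j0}. c j * a i j)"
        unfolding a'_def by (simp add: sum_distrib_left sum_subtractf algebra_simps)
      finally show ?thesis unfolding split using j0 by (simp add: c0_def field_simps)
    qed
    moreover have "\<exists>j\<in>J. (c(j0 := c0)) j \<noteq> 0" using c by auto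
    ultimately show ?thesis by blast
  qed
qed

lemma eigenfunctions_potential_pairing:
  assumes u: "u \<in> L1 \<inter> Linfty" and l: "l < 0" and g: "fourier_eigenfunction u l g" and f: "f \<in> L2"
  shows "(LINT t|lborel. fourier_L1 (\<lambda>x. of_real (u x) * f x) t * cnj (eigen_symbol u l g t)) =
    2 * of_real pi * (LINT x|lborel. of_real (u x) * f x * cnj (g x))"
proof -
  note uf = potential_mult[OF u f]
  have gL: "g \<in> L2" and gF: "AE t in lborel. fourier_L2 g t = eigen_symbol u l g t"
    using g by (auto simp: fourier_eigenfunction_def)
  show ?thesis
    by (rule Plancherel_representatives[OF uf(1) fourier_L2_eq_L1[OF uf] fourier_L1_Bessel(1)[OF uf(2,1)]
          gL gF eigen_symbol_L2[OF u gL l]])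
qed

text \<open>
  The usual argument for a symmetric operator: multiplication by \<open>t\<close> and the real potential \<open>u\<close> both
  move across the inner product, so the difference of the eigenvalues times the inner product is zero.
\<close>

lemma eigen_symbols_orthogonal:
  assumes u: "u \<in> L1 \<inter> Linfty" and l: "l < 0" "m < 0" "l \<noteq> m"
    and f: "fourier_eigenfunction u l f" and g: "fourier_eigenfunction u m g"
  shows "(LINT t|lborel. eigen_symbol u l f t * cnj (eigen_symbol u m g t)) = 0"
proof -
  define P where "P = eigen_symbol u l f"
  define Q where "Q = eigen_symbol u m g"
  define V where "V = fourier_L1 (\<lambda>x. of_real (u x) * f x)"
  define W where "W = fourier_L1 (\<lambda>x. of_real (u x) * g x)"
  have fL: "f \<in> L2" and gL: "g \<in> L2" using f g by (auto simp: fourier_eigenfunction_def)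
  note uf = potential_mult[OF u fL] and ug = potential_mult[OF u gL]
  have L: "P \<in> L2" "Q \<in> L2" "V \<in> L2" "W \<in> L2"
    unfolding P_def Q_def V_def W_def
    by (intro eigen_symbol_L2 u fL gL l fourier_L1_Bessel uf ug)+
  have VQ: "(LINT t|lborel. V t * cnj (Q t)) = 2 * of_real pi * (LINT x|lborel. of_real (u x) * f x * cnj (g x))"
    unfolding V_def Q_def by (rule eigenfunctions_potential_pairing[OF u l(2) g fL])
  have "(LINT t|lborel. P t * cnj (W t)) = cnj (LINT t|lborel. W t * cnj (P t))"
    by (simp add: mult.commute flip: Bochner_Integration.integral_cnj)
  also have "(LINT t|lborel. W t * cnj (P t)) = 2 * of_real pi * (LINT x|lborel. of_real (u x) * g x * cnj (f x))"
    unfolding W_def P_def by (rule eigenfunctions_potential_pairing[OF u l(1) f gL])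
  also have "cnj \<dots> = 2 * of_real pi * (LINT x|lborel. of_real (u x) * f x * cnj (g x))"
    by (simp add: mult_ac flip: Bochner_Integration.integral_cnj)
  finally have PW: "(LINT t|lborel. P t * cnj (W t)) = (LINT t|lborel. V t * cnj (Q t))" using VQ by simp
  have pt: "V t * cnj (Q t) - P t * cnj (W t) = of_real (m - l) * (P t * cnj (Q t))" for t
  proof (cases "0 \<le> t")
    case True
    have V: "V t = of_real (t - l) * P t" and W: "W t = of_real (t - m) * Q t"
      using eigen_symbol_mult[OF l(1) True, of u f] eigen_symbol_mult[OF l(2) True, of u g]
      by (auto simp: V_def W_def P_def Q_def)
    show ?thesis unfolding V W by (simp add: algebra_simps)
  qed (simp add: P_def Q_def eigen_symbol_def)
  have "of_real (m - l) * (LINT t|lborel. P t * cnj (Q t)) = (LINT t|lborel. V t * cnj (Q t) - P t * cnj (W t))"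
    unfolding pt by (rule integral_mult_right_zero[symmetric])
  also have "\<dots> = 0"
    using L by (subst Bochner_Integration.integral_diff) (auto intro!: L2_mult_integrable L2_cnj simp: PW)
  finally show ?thesis using l(3) by (simp add: P_def Q_def)
qed

text \<open>
  The right-hand side without the potential term is the quadratic form of \<open>L\<^sub>u\<close> on the Fourier side: it is
  diagonal on eigenfunctions, by orthogonality. It is negative unless every term of the combination vanishes.
\<close>

lemma energy_of_combination:
  fixes c :: "real \<Rightarrow> complex"
  assumes u: "u \<in> L1 \<inter> Linfty" and S: "finite S" "\<And>l. l \<in> S \<Longrightarrow> l < 0"
    and \<phi>: "\<And>l. l \<in> S \<Longrightarrow> fourier_eigenfunction u l (\<phi> l)"
  defines "f \<equiv> \<lambda>x. \<Sum>l\<in>S. c l * \<phi> l x"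
    and "P \<equiv> \<lambda>t. \<Sum>l\<in>S. c l * eigen_symbol u l (\<phi> l) t"
  shows "f \<in> L2" "P \<in> L2" "AE t in lborel. fourier_L2 f t = P t"
    "integrable lborel (\<lambda>t. t * (cmod (P t))\<^sup>2)"
    "(LINT t|lborel. t * (cmod (P t))\<^sup>2) =
      2 * pi * (LINT x|lborel. u x * (cmod (f x))\<^sup>2) + (\<Sum>l\<in>S. l * (cmod (c l))\<^sup>2 * sq_norm (eigen_symbol u l (\<phi> l)))"
proof -
  define p where "p = (\<lambda>l. eigen_symbol u l (\<phi> l))"
  have \<phi>L: "\<phi> l \<in> L2" and \<phi>F: "AE t in lborel. fourier_L2 (\<phi> l) t = p l t" if "l \<in> S" for l
    using \<phi>[OF that] by (auto simp: fourier_eigenfunction_def p_def)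
  have pL: "p l \<in> L2" if "l \<in> S" for l unfolding p_def by (rule eigen_symbol_L2[OF u \<phi>L[OF that] S(2)[OF that]])
  show fL: "f \<in> L2" unfolding f_def by (intro L2_sum L2_cmult \<phi>L)
  show PL: "P \<in> L2" unfolding P_def using pL by (intro L2_sum L2_cmult) (simp add: p_def)
  have "AE t in lborel. \<forall>l\<in>S. fourier_L2 (\<phi> l) t = p l t"
    using S(1) \<phi>F by (intro AE_finite_allI) auto
  with fourier_L2_sum[OF S(1), of \<phi> c] \<phi>L
  show fP: "AE t in lborel. fourier_L2 f t = P t"
    unfolding f_def P_def by (auto elim!: eventually_elim2 simp: p_def)
  define V where "V = fourier_L1 (\<lambda>x. of_real (u x) * f x)"
  note uf = potential_mult[OF u fL]
  have VL: "V \<in> L2" unfolding V_def by (rule fourier_L1_Bessel[OF uf(2,1)])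
  have V: "V t = (\<Sum>l\<in>S. c l * fourier_L1 (\<lambda>x. of_real (u x) * \<phi> l x) t)" for t
  proof -
    have "V t = (LINT x|lborel. (\<Sum>l\<in>S. c l * (modulation t x * (of_real (u x) * \<phi> l x))))"
      unfolding V_def fourier_L1_def f_def by (simp add: sum_distrib_left mult_ac)
    also have "\<dots> = (\<Sum>l\<in>S. LINT x|lborel. c l * (modulation t x * (of_real (u x) * \<phi> l x)))"
      by (intro Bochner_Integration.integral_sum integrable_mult_right integrable_exp_mult potential_mult[OF u \<phi>L])
    also have "\<dots> = (\<Sum>l\<in>S. c l * fourier_L1 (\<lambda>x. of_real (u x) * \<phi> l x) t)"
      unfolding fourier_L1_def by (intro sum.cong refl integral_mult_right_zero)
    finally show ?thesis .
  qed
  define T where "T = (\<lambda>t. indicator {0..} t * V t + (\<Sum>l\<in>S. (of_real l * c l) * p l t))"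
  have tP: "of_real t * P t = T t" for t
  proof (cases "0 \<le> t")
    case True
    have "of_real t * P t = (\<Sum>l\<in>S. c l * (of_real (t - l) * p l t) + (of_real l * c l) * p l t)"
      unfolding P_def p_def by (simp add: sum_distrib_left algebra_simps)
    also have "\<dots> = (\<Sum>l\<in>S. c l * fourier_L1 (\<lambda>x. of_real (u x) * \<phi> l x) t + (of_real l * c l) * p l t)"
      using S(2) True unfolding p_def by (intro sum.cong refl) (simp only: eigen_symbol_mult)
    finally show ?thesis using True by (simp add: T_def V sum.distrib)
  qed (simp add: P_def T_def p_def eigen_symbol_def)
  have TL: "T \<in> L2" unfolding T_def
    by (intro L2_add L2_indicator_mult VL L2_sum L2_cmult pL) auto
  have eT: "complex_of_real (t * (cmod (P t))\<^sup>2) = T t * cnj (P t)" for t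
    by (simp add: tP[symmetric] mult.assoc complex_norm_square[unfolded of_real_power])
  have iT: "integrable lborel (\<lambda>t. T t * cnj (P t))"
    by (intro L2_mult_integrable L2_cnj TL PL)
  then show iE: "integrable lborel (\<lambda>t. t * (cmod (P t))\<^sup>2)"
    unfolding eT[symmetric] complex_of_real_integrable_eq .
  have VP: "indicator {0..} t * V t * cnj (P t) = V t * cnj (P t)" for t
    by (cases "0 \<le> t") (auto simp: P_def eigen_symbol_def)
  have sumP: "(LINT t|lborel. p l t * cnj (P t)) = cnj (c l) * of_real (sq_norm (p l))" if l: "l \<in> S" for l
  proof -
    have "(LINT t|lborel. p l t * cnj (P t)) = (LINT t|lborel. (\<Sum>m\<in>S. cnj (c m) * (p l t * cnj (p m t))))"
      unfolding P_def p_def by (simp add: sum_distrib_left mult_ac)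
    also have "\<dots> = (\<Sum>m\<in>S. LINT t|lborel. cnj (c m) * (p l t * cnj (p m t)))"
      using pL l by (intro Bochner_Integration.integral_sum integrable_mult_right L2_mult_integrable L2_cnj)
    also have "\<dots> = (\<Sum>m\<in>S. if m = l then cnj (c l) * of_real (sq_norm (p l)) else 0)"
    proof (rule sum.cong[OF refl])
      fix m assume m: "m \<in> S"
      have "(LINT t|lborel. p l t * cnj (p m t)) = (if m = l then of_real (sq_norm (p l)) else 0)"
        using eigen_symbols_orthogonal[OF u S(2)[OF l] S(2)[OF m] _ \<phi>[OF l] \<phi>[OF m]]
        by (auto simp: p_def of_real_sq_norm)
      then show "(LINT t|lborel. cnj (c m) * (p l t * cnj (p m t))) = (if m = l then cnj (c l) * of_real (sq_norm (p l)) else 0)"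
        by simp
    qed
    also have "\<dots> = cnj (c l) * of_real (sq_norm (p l))" using S(1) l by simp
    finally show ?thesis .
  qed
  have "complex_of_real (LINT t|lborel. t * (cmod (P t))\<^sup>2) = (LINT t|lborel. T t * cnj (P t))"
    unfolding integral_complex_of_real[symmetric] eT ..
  also have "\<dots> = (LINT t|lborel. V t * cnj (P t) + (\<Sum>l\<in>S. (of_real l * c l) * (p l t * cnj (P t))))"
    unfolding T_def ring_distribs VP by (simp add: sum_distrib_right mult.assoc)
  also have "\<dots> = (LINT t|lborel. V t * cnj (P t)) + (LINT t|lborel. (\<Sum>l\<in>S. (of_real l * c l) * (p l t * cnj (P t))))"
    using VL PL pL
    by (intro Bochner_Integration.integral_add Bochner_Integration.integrable_sum integrable_mult_right L2_mult_integrable L2_cnj)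
  also have "(LINT t|lborel. (\<Sum>l\<in>S. (of_real l * c l) * (p l t * cnj (P t)))) =
      (\<Sum>l\<in>S. LINT t|lborel. (of_real l * c l) * (p l t * cnj (P t)))"
    using PL pL by (intro Bochner_Integration.integral_sum integrable_mult_right L2_mult_integrable L2_cnj)
  also have "\<dots> = (\<Sum>l\<in>S. (of_real l * c l) * (LINT t|lborel. p l t * cnj (P t)))"
    by (intro sum.cong refl integral_mult_right_zero)
  also have "(LINT t|lborel. V t * cnj (P t)) = 2 * of_real pi * (LINT x|lborel. of_real (u x) * f x * cnj (f x))"
    unfolding V_def
    by (rule Plancherel_representatives[OF uf(1) fourier_L2_eq_L1[OF uf] fourier_L1_Bessel(1)[OF uf(2,1)] fL fP PL])
  also have "(LINT x|lborel. of_real (u x) * f x * cnj (f x)) = complex_of_real (LINT x|lborel. u x * (cmod (f x))\<^sup>2)"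
    unfolding integral_complex_of_real[symmetric] by (simp add: mult.assoc complex_norm_square[unfolded of_real_power])
  also have "(\<Sum>l\<in>S. (of_real l * c l) * (LINT t|lborel. p l t * cnj (P t))) =
      (\<Sum>l\<in>S. complex_of_real (l * (cmod (c l))\<^sup>2 * sq_norm (p l)))"
  proof (rule sum.cong[OF refl])
    fix l assume l: "l \<in> S"
    show "(of_real l * c l) * (LINT t|lborel. p l t * cnj (P t)) = complex_of_real (l * (cmod (c l))\<^sup>2 * sq_norm (p l))"
      unfolding sumP[OF l] by (simp add: complex_norm_square[unfolded of_real_power] mult_ac)
  qed
  finally have "complex_of_real (LINT t|lborel. t * (cmod (P t))\<^sup>2) =
      complex_of_real (2 * pi * (LINT x|lborel. u x * (cmod (f x))\<^sup>2) + (\<Sum>l\<in>S. l * (cmod (c l))\<^sup>2 * sq_norm (p l)))"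
    by simp
  then show "(LINT t|lborel. t * (cmod (P t))\<^sup>2) =
      2 * pi * (LINT x|lborel. u x * (cmod (f x))\<^sup>2) + (\<Sum>l\<in>S. l * (cmod (c l))\<^sup>2 * sq_norm (eigen_symbol u l (\<phi> l)))"
    unfolding of_real_eq_iff p_def .
qed

section \<open>Control of the potential energy\<close>

lemma nonneg_has_integral_lborel:
  fixes f :: "real \<Rightarrow> real"
  assumes [measurable]: "f \<in> borel_measurable borel" "A \<in> sets borel"
    and nn: "\<And>x. x \<in> A \<Longrightarrow> 0 \<le> f x" and I: "(f has_integral I) A"
  shows "integrable lborel (\<lambda>x. indicator A x * f x)" "(LINT x|lborel. indicator A x * f x) = I"
proof -
  have "0 \<le> I" using has_integral_nonneg[OF I nn] by blast
  then have "has_bochner_integral lborel (\<lambda>x. indicator A x * f x) I"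
    using nn_integral_has_integral_lebesgue[OF nn I] nn
    by (intro has_bochner_integral_nn_integral) (auto simp: indicator_def)
  then show "integrable lborel (\<lambda>x. indicator A x * f x)" "(LINT x|lborel. indicator A x * f x) = I"
    by (auto simp: has_bochner_integral_iff)
qed

text \<open>
  For \<open>\<bar>x\<bar> \<ge> 1\<close> the product is \<open>\<bar>x u\<bar> \<bar>x\<bar>\<^sup>-\<^sup>3\<^sup>/\<^sup>4\<close>, where both factors are square-integrable. Any
  exponent below \<open>1/2\<close> in place of \<open>1/4\<close> would do.
\<close>

lemma integrable_power_weight:
  fixes u :: "real \<Rightarrow> real"
  assumes u: "integrable lborel u" and xu: "(\<lambda>x. x * u x) \<in> L2"
  shows "integrable lborel (\<lambda>x. \<bar>u x\<bar> * \<bar>x\<bar> powr (1/4))"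
proof -
  have [measurable]: "u \<in> borel_measurable borel" using borel_measurable_integrable[OF u] by simp
  define w where "w = (\<lambda>x::real. indicator {1..} x * x powr (- 3/2))"
  have w: "integrable lborel w"
    unfolding w_def using has_integral_powr_to_inf[of "- 3/2" 1]
    by (intro nonneg_has_integral_lborel(1)[where I="- (1 powr (- 3/2 + 1)) / (- 3/2 + 1)"]) auto
  have w': "integrable lborel (\<lambda>x. w (- x))"
    using lborel_integrable_real_affine[OF w, of "-1" 0] by simp
  have "integrable lborel (\<lambda>x. \<bar>u x\<bar> + (x * u x)\<^sup>2 + w x + w (- x))"
    using u xu w w' by (auto simp: L2_def)
  then show ?thesis
  proof (rule Bochner_Integration.integrable_bound)
    show "AE x in lborel. norm (\<bar>u x\<bar> * \<bar>x\<bar> powr (1/4)) \<le> norm (\<bar>u x\<bar> + (x * u x)\<^sup>2 + w x + w (- x))"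
    proof (rule AE_I2)
      fix x
      have w0: "0 \<le> w y" for y by (simp add: w_def)
      have "\<bar>u x\<bar> * \<bar>x\<bar> powr (1/4) \<le> \<bar>u x\<bar> + (x * u x)\<^sup>2 + w x + w (- x)"
      proof (cases "\<bar>x\<bar> < 1")
        case True
        then have "\<bar>x\<bar> powr (1/4) \<le> 1" by (intro powr_le1) auto
        then have "\<bar>u x\<bar> * \<bar>x\<bar> powr (1/4) \<le> \<bar>u x\<bar>" by (intro mult_left_le) auto
        then show ?thesis using w0[of x] w0[of "- x"] by (smt (verit) zero_le_power2)
      next
        case False
        define a where "a = \<bar>x\<bar> powr (- 3/4)"
        have x: "\<bar>x\<bar> > 0" using False by simp
        have "\<bar>u x\<bar> * \<bar>x\<bar> powr (1/4) = \<bar>x * u x\<bar> * a"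
        proof -
          have "\<bar>x\<bar> powr (1/4) = \<bar>x\<bar> powr (1 + - 3/4)" by simp
          also have "\<dots> = \<bar>x\<bar> * a" unfolding powr_add a_def using x by simp
          finally show ?thesis by (simp add: abs_mult)
        qed
        also have "\<dots> \<le> \<bar>x * u x\<bar>\<^sup>2 + a\<^sup>2"
        proof -
          have "2 * \<bar>x * u x\<bar> * a \<le> \<bar>x * u x\<bar>\<^sup>2 + a\<^sup>2" by (rule sum_squares_bound)
          moreover have "0 \<le> \<bar>x * u x\<bar> * a" by (simp add: a_def)
          ultimately show ?thesis by linarith
        qed
        also have "a\<^sup>2 = \<bar>x\<bar> powr (- 3/2)"
          unfolding a_def using x by (simp add: power2_eq_square flip: powr_add)
        also have "\<dots> \<le> w x + w (- x)"
          using False w0 by (cases "x \<ge> 0") (auto simp: w_def)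
        finally show ?thesis by simp
      qed
      then show "norm (\<bar>u x\<bar> * \<bar>x\<bar> powr (1/4)) \<le> norm (\<bar>u x\<bar> + (x * u x)\<^sup>2 + w x + w (- x))"
        by simp
    qed
  qed measurable
qed

text \<open>
  An interpolation between the bounds \<open>2\<close> and \<open>\<bar>\<theta>\<bar>\<close> for the chord. With \<open>\<theta>\<close> proportional to \<open>x\<close> it
  produces the weight \<open>\<bar>x\<bar>\<^sup>1\<^sup>/\<^sup>4\<close>, which \<open>u\<close> can absorb.
\<close>

lemma cmod_exp_i_minus_1_sq_le: "(cmod (exp (\<i> * of_real \<theta>) - 1))\<^sup>2 \<le> 4 * \<bar>\<theta>\<bar> powr (1/4)"
proof (cases "\<bar>\<theta>\<bar> < 1")
  case True
  have "cmod (exp (\<i> * of_real \<theta>) - 1) \<le> \<bar>\<theta>\<bar>"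
    using iexp_approx1[of \<theta> 0] by simp
  then have "(cmod (exp (\<i> * of_real \<theta>) - 1))\<^sup>2 \<le> \<bar>\<theta>\<bar>\<^sup>2" by (intro power_mono) auto
  also have "\<dots> \<le> \<bar>\<theta>\<bar> powr (1/4)"
  proof (cases "\<theta> = 0")
    case False
    then have "\<bar>\<theta>\<bar>\<^sup>2 = \<bar>\<theta>\<bar> powr 2" by simp
    also have "\<dots> \<le> \<bar>\<theta>\<bar> powr (1/4)" using True False by (intro powr_mono') auto
    finally show ?thesis .
  qed simp
  also have "\<dots> \<le> 4 * \<bar>\<theta>\<bar> powr (1/4)" by simp
  finally show ?thesis .
next
  case False
  have "cmod (exp (\<i> * of_real \<theta>) - 1) \<le> cmod (exp (\<i> * of_real \<theta>)) + cmod 1" by (rule norm_triangle_ineq4)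
  also have "\<dots> = 2" by simp
  finally have "(cmod (exp (\<i> * of_real \<theta>) - 1))\<^sup>2 \<le> 2\<^sup>2" by (intro power_mono) auto
  also have "\<dots> \<le> 4 * \<bar>\<theta>\<bar> powr (1/4)" using False ge_one_powr_ge_zero[of "\<bar>\<theta>\<bar>" "1/4"] by simp
  finally show ?thesis .
qed

text \<open>
  On \<open>[0, k h)\<close> this is the exponential \<open>exp (\<i> x t)\<close> with \<open>t\<close> rounded down to a multiple of \<open>h\<close>; it is
  zero elsewhere.
\<close>

definition cell_phase :: "real \<Rightarrow> nat \<Rightarrow> real \<Rightarrow> real \<Rightarrow> complex" where
  "cell_phase h k x t = (\<Sum>i<k. exp (\<i> * of_real (x * (real i * h))) * indicator {real i * h..<real (Suc i) * h} t)"

lemma cell_phase_eq: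
  assumes h: "h > 0" and t: "0 \<le> t" "t < real k * h"
  defines "i \<equiv> nat \<lfloor>t / h\<rfloor>"
  shows "cell_phase h k x t = exp (\<i> * of_real (x * (real i * h)))" "real i * h \<le> t" "t < real i * h + h"
proof -
  have "real i = of_int \<lfloor>t / h\<rfloor>" using h t by (simp add: i_def)
  then have i: "real i \<le> t / h" "t / h < real i + 1" by linarith+
  then show i': "real i * h \<le> t" "t < real i * h + h"
    using h by (simp_all add: field_simps)
  have "real i * h < real k * h" using i' t by linarith
  then have ik: "i < k" using h by simp
  have ind: "indicator {real j * h..<real (Suc j) * h} t = (if j = i then 1 else 0 :: complex)" for j
  proof -
    have "t \<in> {real j * h..<real (Suc j) * h} \<longleftrightarrow> j = i"
    proof
      assume "t \<in> {real j * h..<real (Suc j) * h}"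
      then have "real j \<le> t / h" "t / h < real (Suc j)" using h by (simp_all add: field_simps)
      then have "real j < real i + 1" "real i < real j + 1" using i by linarith+
      then show "j = i" by linarith
    qed (use i' in \<open>auto simp: ring_distribs\<close>)
    then show ?thesis by (simp add: indicator_def)
  qed
  show "cell_phase h k x t = exp (\<i> * of_real (x * (real i * h)))"
  proof -
    have "cell_phase h k x t = (\<Sum>j<k. if j = i then exp (\<i> * of_real (x * (real j * h))) else 0)"
      unfolding cell_phase_def ind by (intro sum.cong) auto
    then show ?thesis using ik by simp
  qed
qed

text \<open>
  Rounding changes \<open>t\<close> by at most \<open>min h t\<close>, which is at most the geometric mean of \<open>h\<close> and \<open>t\<close>. The power of
  \<open>h\<close> makes the error small, and the power of \<open>t\<close> makes it vanish at \<open>t = 0\<close>, which compensates for the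
  degeneracy of the energy at low frequencies.
\<close>

lemma phase_error_bound:
  assumes h: "h > 0" and t: "0 \<le> t" "t < real k * h"
  shows "(cmod (exp (\<i> * of_real (x * t)) - cell_phase h k x t))\<^sup>2 \<le>
    4 * \<bar>x\<bar> powr (1/4) * (h powr (1/8) * t powr (1/8))"
proof -
  define i where "i = nat \<lfloor>t / h\<rfloor>"
  note i = cell_phase_eq[OF h t, folded i_def]
  define d where "d = t - real i * h"
  have d: "0 \<le> d" "d \<le> h" "d \<le> t" using i(2,3) h by (auto simp: d_def)
  have "exp (\<i> * of_real (x * t)) - cell_phase h k x t =
      exp (\<i> * of_real (x * (real i * h))) * (exp (\<i> * of_real (x * d)) - 1)"
    unfolding i(1)[of x] d_def by (simp add: algebra_simps flip: exp_add)
  then have "(cmod (exp (\<i> * of_real (x * t)) - cell_phase h k x t))\<^sup>2 = (cmod (exp (\<i> * of_real (x * d)) - 1))\<^sup>2"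
    by (simp add: norm_mult del: of_real_mult)
  also have "\<dots> \<le> 4 * \<bar>x * d\<bar> powr (1/4)" by (rule cmod_exp_i_minus_1_sq_le)
  also have "\<bar>x * d\<bar> powr (1/4) \<le> (\<bar>x\<bar> * (h * t) powr (1/2)) powr (1/4)"
  proof (intro powr_mono2)
    have "d * d \<le> h * t" using d by (intro mult_mono) auto
    then have "d \<le> sqrt (h * t)" using d by (intro real_le_rsqrt) (simp add: power2_eq_square)
    then have "d \<le> (h * t) powr (1/2)" using h t by (simp add: powr_half_sqrt)
    then show "\<bar>x * d\<bar> \<le> \<bar>x\<bar> * (h * t) powr (1/2)"
      using d by (simp add: abs_mult mult_left_mono)
  qed auto
  also have "\<dots> = \<bar>x\<bar> powr (1/4) * (h powr (1/8) * t powr (1/8))"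
    using h t by (simp add: powr_mult powr_powr)
  finally show ?thesis by (simp add: mult_ac)
qed

text \<open>
  The cell conditions allow the rounded exponential to be subtracted from the true one without changing the
  integral. By the Cauchy-Schwarz inequality with weight \<open>t\<close>, what remains is the energy times the
  integral of the squared phase error divided by \<open>t\<close>, and the latter is at most a multiple of
  \<open>\<integral> t\<^sup>-\<^sup>7\<^sup>/\<^sup>8\<close> over \<open>[0, k h]\<close>, which converges.
\<close>

lemma low_frequency_bound:
  fixes P :: "real \<Rightarrow> complex"
  assumes P: "P \<in> L2" and iE: "integrable lborel (\<lambda>t. t * (cmod (P t))\<^sup>2)" and P0: "\<And>t. t < 0 \<Longrightarrow> P t = 0"
    and h: "h > 0" and cells: "\<And>i. i < k \<Longrightarrow> (LINT t|lborel. indicator {real i * h..<real (Suc i) * h} t * P t) = 0"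
  shows "(cmod (LINT t|lborel. exp (\<i> * of_real (x * t)) * (indicator {0..<real k * h} t * P t)))\<^sup>2 \<le>
    32 * \<bar>x\<bar> powr (1/4) * (h powr (1/8) * (real k * h) powr (1/8)) * (LINT t|lborel. t * (cmod (P t))\<^sup>2)"
proof -
  define M where "M = real k * h"
  have M: "M \<ge> 0" using h by (simp add: M_def)
  let ?e = "\<lambda>t. exp (\<i> * of_real (x * t)) * (indicator {0..<M} t * P t)"
  let ?w = "\<lambda>t. indicator {0..M} t * t powr (- 7/8)"
  have [measurable]: "P \<in> borel_measurable borel" by (rule L2_measurable[OF P])
  have [measurable]: "cell_phase h k x \<in> borel_measurable borel" unfolding cell_phase_def by measurable
  note iI = L2_Ico_integrable[OF P]
  define D where "D = (\<lambda>t. exp (\<i> * of_real (x * t)) - cell_phase h k x t)"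
  define q where "q = (\<lambda>t. complex_of_real (sqrt t) * P t)"
  define d where "d = (\<lambda>t. complex_of_real (indicator {0..<M} t / sqrt t) * D t)"
  \<comment> \<open>\<open>P\<close> vanishes to the left of the cells and the rounded exponential to their right.\<close>
  have cp_out: "cell_phase h k x t * P t = cell_phase h k x t * (indicator {0..<M} t * P t)" for t
  proof (cases "t < M")
    case True
    then show ?thesis using P0[of t] by (auto simp: indicator_def)
  next
    case False
    have "indicator {real i * h..<real (Suc i) * h} t = (0::complex)" if "i < k" for i
    proof -
      have "real (Suc i) * h \<le> M" unfolding M_def using that h by (intro mult_right_mono) auto
      then show ?thesis using False by (simp add: indicator_def)
    qed
    then have "cell_phase h k x t = 0" unfolding cell_phase_def by (intro sum.neutral) auto
    then show ?thesis by simp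
  qed
  have cp: "(LINT t|lborel. cell_phase h k x t * P t) = 0" "integrable lborel (\<lambda>t. cell_phase h k x t * P t)"
  proof -
    have eq: "cell_phase h k x t * P t = (\<Sum>i<k. exp (\<i> * of_real (x * (real i * h))) * (indicator {real i * h..<real (Suc i) * h} t * P t))" for t
      unfolding cell_phase_def sum_distrib_right by (intro sum.cong refl mult.assoc)
    show "integrable lborel (\<lambda>t. cell_phase h k x t * P t)"
      unfolding eq by (intro Bochner_Integration.integrable_sum integrable_mult_right iI)
    have "(LINT t|lborel. cell_phase h k x t * P t) = (\<Sum>i<k. LINT t|lborel. exp (\<i> * of_real (x * (real i * h))) * (indicator {real i * h..<real (Suc i) * h} t * P t))"
      unfolding eq by (intro Bochner_Integration.integral_sum integrable_mult_right iI)
    also have "\<dots> = 0"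
      by (intro sum.neutral ballI) (simp only: integral_mult_right_zero, simp add: cells del: of_nat_Suc)
    finally show "(LINT t|lborel. cell_phase h k x t * P t) = 0" .
  qed
  have ie: "integrable lborel (\<lambda>t. ?e t)"
    by (rule Bochner_Integration.integrable_bound[OF iI[of 0 M]]) (auto simp: norm_mult)
  have "(LINT t|lborel. ?e t) =
      (LINT t|lborel. ?e t - cell_phase h k x t * P t)"
    using ie cp by simp
  also have "\<dots> = (LINT t|lborel. d t * q t)"
  proof (rule Bochner_Integration.integral_cong_AE)
    show "AE t in lborel. ?e t - cell_phase h k x t * P t = d t * q t"
      using AE_lborel_singleton[of "0::real"]
    proof eventually_elim
      case (elim t)
      have "?e t - cell_phase h k x t * P t = D t * (indicator {0..<M} t * P t)"
        unfolding cp_out D_def by (simp only: left_diff_distrib)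
      also have "\<dots> = d t * q t"
        using elim by (cases "t \<in> {0..<M}") (auto simp: d_def q_def indicator_def simp flip: of_real_mult)
      finally show ?case .
    qed
  qed (simp_all add: d_def q_def D_def)
  finally have eq: "(LINT t|lborel. ?e t) = (LINT t|lborel. d t * q t)" .
  have q_sq: "(cmod (q t))\<^sup>2 = t * (cmod (P t))\<^sup>2" for t
    using P0[of t] by (cases "t < 0") (auto simp: q_def norm_mult power_mult_distrib)
  have qL: "q \<in> L2" using iE by (simp add: L2_def q_sq) (simp add: q_def)
  have q_norm: "sq_norm q = (LINT t|lborel. t * (cmod (P t))\<^sup>2)" by (simp add: sq_norm_def q_sq)
  define c where "c = 4 * \<bar>x\<bar> powr (1/4) * h powr (1/8)"
  have c0: "c \<ge> 0" by (simp add: c_def)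
  have w: "integrable lborel (\<lambda>t. ?w t)"
      "(LINT t|lborel. ?w t) = M powr (1/8) / (1/8)"
    using has_integral_powr_from_0[of "- 7/8" M] M
    by (auto intro!: nonneg_has_integral_lborel)
  have d_sq: "(cmod (d t))\<^sup>2 \<le> c * ?w t" if "t \<noteq> 0" for t
  proof (cases "t \<in> {0..<M}")
    case True
    then have t: "t > 0" using that by auto
    have "(cmod (d t))\<^sup>2 = (cmod (D t))\<^sup>2 / t"
      using True t by (simp add: d_def norm_mult norm_divide power_divide power_mult_distrib del: of_real_divide)
    also have "\<dots> \<le> (4 * \<bar>x\<bar> powr (1/4) * (h powr (1/8) * t powr (1/8))) / t"
      unfolding D_def using True t h by (intro divide_right_mono phase_error_bound) (auto simp: M_def)
    also have "\<dots> = c * (t powr (1/8) / t powr 1)" using t by (simp add: c_def)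
    also have "t powr (1/8) / t powr 1 = t powr (1/8 - 1)" by (rule powr_diff[symmetric])
    also have "1/8 - 1 = (- 7/8 :: real)" by simp
    finally show ?thesis using True by simp
  qed (use c0 in \<open>simp add: d_def\<close>)
  have d_AE: "AE t in lborel. (cmod (d t))\<^sup>2 \<le> c * ?w t"
    using AE_lborel_singleton[of "0::real"] by eventually_elim (rule d_sq)
  have dL: "d \<in> L2"
  proof (rule L2I_bound[OF _ _ d_AE])
    show "d \<in> borel_measurable borel" unfolding d_def D_def by measurable
    show "integrable lborel (\<lambda>t. c * ?w t)"
      using w(1) by (rule integrable_mult_right)
  qed
  have "sq_norm d \<le> (LINT t|lborel. c * ?w t)"
    unfolding sq_norm_def using d_AE
    by (intro integral_mono_AE L2_integrable[OF dL] integrable_mult_right w(1))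
  also have "\<dots> = c * (8 * M powr (1/8))" unfolding integral_mult_right_zero w(2) by simp
  finally have d_norm: "sq_norm d \<le> c * (8 * M powr (1/8))" .
  have "(cmod (LINT t|lborel. d t * q t))\<^sup>2 \<le> sq_norm d * sq_norm q" by (rule integral_Cauchy_Schwarz[OF dL qL])
  also have "\<dots> \<le> (c * (8 * M powr (1/8))) * sq_norm q" by (intro mult_right_mono d_norm) simp
  finally show ?thesis unfolding eq[unfolded M_def] q_norm c_def M_def by (simp add: mult_ac)
qed

text \<open>
  Split \<open>f\<close> at frequency \<open>M = k h\<close>. The squared norm of the high frequency part is at most
  \<open>E / (2\<pi> M)\<close>, and \<open>\<bar>u\<bar> \<le> C\<close> there; the low frequency part is bounded pointwise by the previous lemma and
  integrated against \<open>\<bar>u\<bar>\<close>.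
\<close>

lemma potential_energy_bound:
  fixes u :: "real \<Rightarrow> real"
  assumes u: "u \<in> L1 \<inter> Linfty" and C: "AE x in lborel. \<bar>u x\<bar> \<le> C" "C > 0"
    and iB: "integrable lborel (\<lambda>x. \<bar>u x\<bar> * \<bar>x\<bar> powr (1/4))"
    and f: "f \<in> L2" and P: "P \<in> L2" "AE t in lborel. fourier_L2 f t = P t"
    and iE: "integrable lborel (\<lambda>t. t * (cmod (P t))\<^sup>2)" and P0: "\<And>t. t < 0 \<Longrightarrow> P t = 0"
    and h: "h > 0" and k: "k > 0"
    and cells: "\<And>i. i < k \<Longrightarrow> (LINT t|lborel. indicator {real i * h..<real (Suc i) * h} t * P t) = 0"
  defines "E \<equiv> LINT t|lborel. t * (cmod (P t))\<^sup>2" and "B \<equiv> LINT x|lborel. \<bar>u x\<bar> * \<bar>x\<bar> powr (1/4)"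
    and "M \<equiv> real k * h"
  shows "2 * pi * (LINT x|lborel. u x * (cmod (f x))\<^sup>2) \<le> (2 * C / M + 4 * pi * B * (h powr (1/8) * M powr (1/8))) * E"
proof -
  have M: "M > 0" using h k by (simp add: M_def)
  note um [measurable] = L1_Linfty_facts(1)[OF u]
  have [measurable]: "f \<in> borel_measurable borel" "P \<in> borel_measurable borel"
    using f P by (auto intro: L2_measurable)
  define p where "p = (\<lambda>t. indicator {0..<M} t * P t)"
  define lo where "lo = fourier_inv p"
  define hi where "hi = (\<lambda>x. f x - lo x)"
  have pL: "p \<in> L2" unfolding p_def by (intro L2_indicator_mult P) auto
  have pI: "integrable lborel p" unfolding p_def by (rule L2_Ico_integrable[OF P(1)])
  have loL: "lo \<in> L2" unfolding lo_def by (rule fourier_inv_L2[OF pL])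
  have hiL: "hi \<in> L2" unfolding hi_def by (rule L2_diff[OF f loL])
  have E0: "0 \<le> E"
  proof -
    have "0 \<le> t * (cmod (P t))\<^sup>2" for t using P0[of t] by (cases "t < 0") auto
    then show ?thesis unfolding E_def by simp
  qed
  define r where "r = h powr (1/8) * M powr (1/8)"
  have r0: "0 \<le> r" by (simp add: r_def)
  have lo_bound: "AE x in lborel. (cmod (lo x))\<^sup>2 \<le> \<bar>x\<bar> powr (1/4) * r * E"
    using fourier_inv_eq_L1[OF pL pI]
  proof eventually_elim
    case (elim x)
    have "fourier_L1 p (- x) = (LINT t|lborel. exp (\<i> * of_real (x * t)) * (indicator {0..<real k * h} t * P t))"
      unfolding fourier_L1_def p_def M_def by (simp add: mult.commute)
    then have b: "(cmod (fourier_L1 p (- x)))\<^sup>2 \<le> 32 * \<bar>x\<bar> powr (1/4) * r * E"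
      using low_frequency_bound[OF P(1) iE P0 h cells, of k x] by (simp add: r_def M_def E_def)
    have "lo x = fourier_L1 p (- x) / (2 * of_real pi)" using elim by (simp only: lo_def)
    then have "(cmod (lo x))\<^sup>2 = (cmod (fourier_L1 p (- x)))\<^sup>2 / (4 * pi\<^sup>2)"
      by (simp add: norm_divide norm_mult power_divide power_mult_distrib)
    also have "\<dots> \<le> (32 * \<bar>x\<bar> powr (1/4) * r * E) / (4 * pi\<^sup>2)"
      by (intro divide_right_mono b) simp
    \<comment> \<open>The constant \<open>32\<close> from the low frequency bound is absorbed by \<open>4\<pi>\<^sup>2\<close>.\<close>
    also have "\<dots> \<le> (32 * \<bar>x\<bar> powr (1/4) * r * E) / 32"
    proof (intro divide_left_mono)
      have "3\<^sup>2 \<le> pi\<^sup>2" using pi_gt3 by (intro power_mono) auto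
      then show "32 \<le> 4 * pi\<^sup>2" by simp
    qed (use r0 E0 in auto)
    finally show ?case by simp
  qed
  have hi_norm: "sq_norm hi \<le> E / (2 * pi * M)"
  proof -
    have "AE t in lborel. fourier_L2 hi t = indicator {M..} t * P t"
      using fourier_L2_diff[OF f loL, folded hi_def] P(2) fourier_L2_fourier_inv[OF pL, folded lo_def]
    proof eventually_elim
      case (elim t)
      then show ?case using P0[of t] M by (auto simp: p_def indicator_def)
    qed
    then have "sq_norm (fourier_L2 hi) = sq_norm (\<lambda>t. indicator {M..} t * P t)"
      by (intro sq_norm_cong_AE fourier_L2_L2 hiL L2_indicator_mult P) auto
    also have "\<dots> \<le> (LINT t|lborel. (1 / M) * (t * (cmod (P t))\<^sup>2))"
      unfolding sq_norm_def
    proof (intro integral_mono L2_integrable L2_indicator_mult P integrable_mult_right iE)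
      fix t
      show "(cmod (indicator {M..} t * P t))\<^sup>2 \<le> (1 / M) * (t * (cmod (P t))\<^sup>2)"
      proof (cases "t \<ge> M")
        case True
        then have "M * (cmod (P t))\<^sup>2 \<le> t * (cmod (P t))\<^sup>2" by (intro mult_right_mono) auto
        then show ?thesis using True M by (simp add: field_simps)
      next
        case False
        then show ?thesis using P0[of t] M by (cases "t < 0") auto
      qed
    qed auto
    also have "\<dots> = E / M" by (simp add: E_def)
    finally show ?thesis using M unfolding sq_norm_fourier_L2[OF hiL] by (simp add: field_simps)
  qed
  have i_lo: "integrable lborel (\<lambda>x. (\<bar>u x\<bar> * \<bar>x\<bar> powr (1/4)) * (r * E))"
    by (rule integrable_mult_left[OF iB])
  have i_hi: "integrable lborel (\<lambda>x. C * (cmod (hi x))\<^sup>2)"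
    by (intro integrable_mult_right L2_integrable hiL)
  have pt: "AE x in lborel. u x * (cmod (f x))\<^sup>2 \<le> 2 * ((\<bar>u x\<bar> * \<bar>x\<bar> powr (1/4)) * (r * E)) + 2 * (C * (cmod (hi x))\<^sup>2)"
    using lo_bound C(1)
  proof eventually_elim
    case (elim x)
    have "u x * (cmod (f x))\<^sup>2 \<le> \<bar>u x\<bar> * (cmod (f x))\<^sup>2" by (intro mult_right_mono) auto
    also have "(cmod (f x))\<^sup>2 \<le> 2 * (cmod (lo x))\<^sup>2 + 2 * (cmod (hi x))\<^sup>2"
      using cmod_add_sq_le[of "lo x" "hi x"] by (simp add: hi_def)
    then have "\<bar>u x\<bar> * (cmod (f x))\<^sup>2 \<le> \<bar>u x\<bar> * (2 * (cmod (lo x))\<^sup>2 + 2 * (cmod (hi x))\<^sup>2)"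
      by (rule mult_left_mono) simp
    also have "\<dots> = 2 * (\<bar>u x\<bar> * (cmod (lo x))\<^sup>2) + 2 * (\<bar>u x\<bar> * (cmod (hi x))\<^sup>2)" by (simp add: algebra_simps)
    also have "\<dots> \<le> 2 * (\<bar>u x\<bar> * (\<bar>x\<bar> powr (1/4) * r * E)) + 2 * (C * (cmod (hi x))\<^sup>2)"
      using elim by (intro add_mono mult_left_mono mult_right_mono) auto
    finally show ?case by (simp add: mult_ac)
  qed
  have "(LINT x|lborel. u x * (cmod (f x))\<^sup>2) \<le>
      (LINT x|lborel. 2 * ((\<bar>u x\<bar> * \<bar>x\<bar> powr (1/4)) * (r * E)) + 2 * (C * (cmod (hi x))\<^sup>2))"
  proof (rule integral_mono_AE[OF _ _ pt])
    show "integrable lborel (\<lambda>x. u x * (cmod (f x))\<^sup>2)"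
    proof (rule Bochner_Integration.integrable_bound)
      show "integrable lborel (\<lambda>x. C * (cmod (f x))\<^sup>2)" by (intro integrable_mult_right L2_integrable f)
      show "AE x in lborel. norm (u x * (cmod (f x))\<^sup>2) \<le> norm (C * (cmod (f x))\<^sup>2)"
        using C(1) by eventually_elim (use C(2) in \<open>auto simp: abs_mult intro!: mult_right_mono\<close>)
    qed measurable
  qed (intro Bochner_Integration.integrable_add integrable_mult_right[OF i_lo] integrable_mult_right[OF i_hi])
  also have "\<dots> = 2 * (B * (r * E)) + 2 * (C * sq_norm hi)"
    using i_lo i_hi unfolding B_def sq_norm_def
    by (subst Bochner_Integration.integral_add) (auto simp: integral_mult_left_zero)
  also have "C * sq_norm hi \<le> C * (E / (2 * pi * M))"
    using C(2) by (intro mult_left_mono hi_norm) auto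
  finally have "(LINT x|lborel. u x * (cmod (f x))\<^sup>2) \<le> 2 * (B * (r * E)) + 2 * (C * (E / (2 * pi * M)))"
    by simp
  then have "2 * pi * (LINT x|lborel. u x * (cmod (f x))\<^sup>2) \<le> 2 * pi * (2 * (B * (r * E)) + 2 * (C * (E / (2 * pi * M))))"
    by (intro mult_left_mono) auto
  also have "\<dots> = (2 * C / M + 4 * pi * B * r) * E"
    using M by (simp add: field_simps)
  finally show ?thesis by (simp only: r_def)
qed

section \<open>Finiteness\<close>

text \<open>
  More than \<open>k\<close> eigenfunctions have a nontrivial combination that satisfies the \<open>k\<close> cell conditions. Its
  potential energy is then at most its energy, whereas the quadratic form of \<open>L\<^sub>u\<close> is negative on it.
\<close>

lemma eigenvalue_count_bound:
  assumes u: "u \<in> L1 \<inter> Linfty" and C: "AE x in lborel. \<bar>u x\<bar> \<le> C" "C > 0"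
    and iB: "integrable lborel (\<lambda>x. \<bar>u x\<bar> * \<bar>x\<bar> powr (1/4))"
    and h: "h > 0" and k: "k > 0"
    and small: "2 * C / (real k * h) + 4 * pi * (LINT x|lborel. \<bar>u x\<bar> * \<bar>x\<bar> powr (1/4)) * (h powr (1/8) * (real k * h) powr (1/8)) \<le> 1"
    and S: "finite S" "\<And>l. l \<in> S \<Longrightarrow> l < 0"
    and \<phi>: "\<And>l. l \<in> S \<Longrightarrow> fourier_eigenfunction u l (\<phi> l)" "\<And>l. l \<in> S \<Longrightarrow> \<not> (AE x in lborel. \<phi> l x = 0)"
  shows "card S \<le> k"
proof (rule ccontr)
  assume "\<not> card S \<le> k"
  then have card: "card {..<k} < card S" by simp
  define p where "p = (\<lambda>l. eigen_symbol u l (\<phi> l))"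
  have \<phi>L: "\<phi> l \<in> L2" if "l \<in> S" for l using \<phi>(1)[OF that] by (simp add: fourier_eigenfunction_def)
  have pL: "p l \<in> L2" if "l \<in> S" for l unfolding p_def by (rule eigen_symbol_L2[OF u \<phi>L[OF that] S(2)[OF that]])
  let ?I = "\<lambda>i::nat. indicator {real i * h..<real (Suc i) * h} :: real \<Rightarrow> complex"
  have iI: "integrable lborel (\<lambda>t. ?I i t * p l t)" if "l \<in> S" for i l
    by (rule L2_Ico_integrable[OF pL[OF that]])
  obtain c :: "real \<Rightarrow> complex" where c: "\<exists>l\<in>S. c l \<noteq> 0"
    "\<And>i. i < k \<Longrightarrow> (\<Sum>l\<in>S. c l * (LINT t|lborel. ?I i t * p l t)) = 0"
    using homogeneous_system_nontrivial_solution[OF _ S(1) card, of "\<lambda>i l. LINT t|lborel. ?I i t * p l t"] by auto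
  define f where "f = (\<lambda>x. \<Sum>l\<in>S. c l * \<phi> l x)"
  define P where "P = (\<lambda>t. \<Sum>l\<in>S. c l * eigen_symbol u l (\<phi> l) t)"
  have en: "f \<in> L2" "P \<in> L2" "AE t in lborel. fourier_L2 f t = P t"
    "integrable lborel (\<lambda>t. t * (cmod (P t))\<^sup>2)"
    "(LINT t|lborel. t * (cmod (P t))\<^sup>2) =
      2 * pi * (LINT x|lborel. u x * (cmod (f x))\<^sup>2) + (\<Sum>l\<in>S. l * (cmod (c l))\<^sup>2 * sq_norm (p l))"
    unfolding f_def P_def p_def
    by (rule energy_of_combination[of u S \<phi> c, OF u S \<phi>(1)]; assumption)+
  define E where "E = (LINT t|lborel. t * (cmod (P t))\<^sup>2)"
  have P0: "P t = 0" if "t < 0" for t using that by (simp add: P_def eigen_symbol_def)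
  have cells: "(LINT t|lborel. ?I i t * P t) = 0" if "i < k" for i
  proof -
    have "(LINT t|lborel. ?I i t * P t) = (LINT t|lborel. (\<Sum>l\<in>S. c l * (?I i t * p l t)))"
      unfolding P_def p_def sum_distrib_left
      by (intro Bochner_Integration.integral_cong sum.cong refl mult.left_commute)
    also have "\<dots> = (\<Sum>l\<in>S. LINT t|lborel. c l * (?I i t * p l t))"
      by (intro Bochner_Integration.integral_sum integrable_mult_right iI)
    also have "\<dots> = (\<Sum>l\<in>S. c l * (LINT t|lborel. ?I i t * p l t))"
      by (intro sum.cong refl integral_mult_right_zero)
    finally show ?thesis using c(2)[OF that] by simp
  qed
  have E0: "0 \<le> E"
  proof -
    have "0 \<le> t * (cmod (P t))\<^sup>2" for t using P0[of t] by (cases "t < 0") auto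
    then show ?thesis unfolding E_def by simp
  qed
  have "2 * pi * (LINT x|lborel. u x * (cmod (f x))\<^sup>2) \<le>
      (2 * C / (real k * h) + 4 * pi * (LINT x|lborel. \<bar>u x\<bar> * \<bar>x\<bar> powr (1/4)) * (h powr (1/8) * (real k * h) powr (1/8))) * E"
    unfolding E_def by (rule potential_energy_bound[OF u C iB en(1-4) P0 h k cells])
  also have "\<dots> \<le> 1 * E" using small E0 by (rule mult_right_mono)
  finally have "0 \<le> (\<Sum>l\<in>S. l * (cmod (c l))\<^sup>2 * sq_norm (p l))"
    using en(5) by (simp add: E_def)
  moreover have "(\<Sum>l\<in>S. l * (cmod (c l))\<^sup>2 * sq_norm (p l)) < 0"
  proof -
    obtain l0 where l0: "l0 \<in> S" "c l0 \<noteq> 0" using c(1) by blast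
    have pos: "sq_norm (p l0) > 0"
    proof -
      have "sq_norm (p l0) = sq_norm (fourier_L2 (\<phi> l0))"
        using \<phi>(1)[OF l0(1)] pL[OF l0(1)] \<phi>L[OF l0(1)]
        by (intro sq_norm_cong_AE fourier_L2_L2) (auto simp: fourier_eigenfunction_def p_def elim: eventually_mono)
      also have "\<dots> = 2 * pi * sq_norm (\<phi> l0)" by (rule sq_norm_fourier_L2[OF \<phi>L[OF l0(1)]])
      also have "sq_norm (\<phi> l0) \<noteq> 0" using sq_norm_eq_0_iff[OF \<phi>L[OF l0(1)]] \<phi>(2)[OF l0(1)] by simp
      then have "2 * pi * sq_norm (\<phi> l0) > 0" by (simp add: less_le)
      finally show ?thesis .
    qed
    have le: "l * (cmod (c l))\<^sup>2 * sq_norm (p l) \<le> 0" if "l \<in> S" for l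
      using S(2)[OF that] by (intro mult_nonpos_nonneg) auto
    have "(\<Sum>l\<in>S. l * (cmod (c l))\<^sup>2 * sq_norm (p l)) < (\<Sum>l\<in>S. 0)"
    proof (rule sum_strict_mono_ex1[OF S(1)])
      show "\<exists>l\<in>S. l * (cmod (c l))\<^sup>2 * sq_norm (p l) < 0"
        using l0 S(2)[OF l0(1)] pos by (intro bexI[of _ l0] mult_neg_pos) auto
    qed (use le in auto)
    then show ?thesis by simp
  qed
  ultimately show False by simp
qed

text \<open>
  The choice \<open>M = 4 C\<close> makes the high frequency contribution equal to \<open>1/2\<close>. With \<open>M\<close> fixed, the low
  frequency contribution tends to \<open>0\<close> as the number of cells grows.
\<close>

theorem finite_negative_eigenvalues:
  assumes u: "u \<in> L1 \<inter> Linfty" and xu: "(\<lambda>x. x * u x) \<in> L2"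
  shows "finite {l :: real. l < 0 \<and> L_eigenvalue u (of_real l)}"
proof -
  note U = L1_Linfty_facts[OF u]
  obtain C where C: "C > 0" "AE x in lborel. \<bar>u x\<bar> \<le> C" using U(3) by blast
  define B where "B = (LINT x|lborel. \<bar>u x\<bar> * \<bar>x\<bar> powr (1/4))"
  have iB: "integrable lborel (\<lambda>x. \<bar>u x\<bar> * \<bar>x\<bar> powr (1/4))" by (rule integrable_power_weight[OF U(2) xu])
  define M where "M = 4 * C"
  have M: "M > 0" using C by (simp add: M_def)
  have "((\<lambda>n. 4 * pi * B * ((M * inverse (real (Suc n))) powr (1/8) * M powr (1/8))) \<longlongrightarrow> 4 * pi * B * ((M * 0) powr (1/8) * M powr (1/8))) sequentially"
    using M by (intro tendsto_intros LIMSEQ_inverse_real_of_nat tendsto_powr') auto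
  then have "((\<lambda>n. 4 * pi * B * ((M * inverse (real (Suc n))) powr (1/8) * M powr (1/8))) \<longlongrightarrow> 0) sequentially" by simp
  from order_tendstoD(2)[OF this, of "1/2"] obtain n where
    n: "4 * pi * B * ((M * inverse (real (Suc n))) powr (1/8) * M powr (1/8)) < 1/2"
    by (auto simp: eventually_sequentially)
  define k where "k = Suc n"
  define h where "h = M / real k"
  have k: "k > 0" and h: "h > 0" and kh: "real k * h = M" using M by (auto simp: k_def h_def)
  have CM: "2 * C / M = 1/2" using C by (simp add: M_def)
  have small: "2 * C / (real k * h) + 4 * pi * (LINT x|lborel. \<bar>u x\<bar> * \<bar>x\<bar> powr (1/4)) * (h powr (1/8) * (real k * h) powr (1/8)) \<le> 1"
  proof -
    have "h = M * inverse (real (Suc n))" unfolding h_def k_def by (rule divide_inverse)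
    with n CM show ?thesis unfolding kh B_def by simp
  qed
  have "card S \<le> k" if "S \<subseteq> {l. l < 0 \<and> L_eigenvalue u (of_real l)}" "finite S" for S
  proof -
    have "\<forall>l\<in>S. \<exists>\<phi>. \<phi> \<in> L_eigenspace u (of_real l) \<and> \<not> (AE x in lborel. \<phi> x = 0)"
      using that by (auto simp: L_eigenvalue_def)
    then obtain \<phi> where \<phi>: "\<And>l. l \<in> S \<Longrightarrow> \<phi> l \<in> L_eigenspace u (of_real l)" "\<And>l. l \<in> S \<Longrightarrow> \<not> (AE x in lborel. \<phi> l x = 0)"
      by metis
    show ?thesis
    proof (rule eigenvalue_count_bound[OF u C(2,1) iB h k small that(2) _ _ \<phi>(2)])
      show "l < 0" if "l \<in> S" for l using that \<open>S \<subseteq> _\<close> by auto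
      then show "fourier_eigenfunction u l (\<phi> l)" if "l \<in> S" for l
        using that \<phi>(1)[OF that] by (intro L_eigenspace_imp_fourier_eigenfunction[OF u])
    qed
  qed
  then show ?thesis using finite_if_finite_subsets_card_bdd by blast
qed

theorem theorem1p2:
  fixes u :: "real \<Rightarrow> real"
  assumes "u \<in> L1 \<inter> Linfty"
    and "(\<lambda>x. x * u x) \<in> L2"
  shows "finite {l :: real. l < 0 \<and> L_eigenvalue u (of_real l)} \<and>
    (\<forall>l :: real. l < 0 \<and> L_eigenvalue u (of_real l) \<longrightarrow>
       has_dim_ae (L_eigenspace u (of_real l)) 1)"
  using finite_negative_eigenvalues[OF assms] eigenspace_dim_1[OF assms(1)] by blast

end
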